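(* Let $\mathcal{X},\mathcal{Y},\mathcal{Z}$ be finite sets, $P_{Y,Z|X}$ a channel from $\mathcal{X}$ to $\mathcal{Y}\times\mathcal{Z}$, $\mathsf{C}:\mathcal{X}\to\mathbb{R}_{\geq 0}$ a cost function and $b\geq \mathsf{c}_{\min}:=\min_{x\in\mathcal{X}}\mathsf{C}(x)$. Then the weak-secrecy capacity, the strong-secrecy capacity and the semantic-security capacity of the cost-constrained wiretap channel $(\mathcal{X},\mathcal{Y},\mathcal{Z},P_{Y,Z|X},\mathsf{C},b)$ coincide and equal $\bar C(b)$: $$C_{\mathsf{sem}}(b)=C_{\mathsf{str}}(b)=C_{\mathsf{weak}}(b)=\bar C(b),$$ where $$\bar C(b):=\sup\Big\{ I_P(V;Y|U)-I_P(V;Z|U)\Big\},$$ the supremum being over all finite sets $\mathcal{U},\mathcal{V}$ and all PMFs $P_{U,V,X}$ on $\mathcal{U}\times\mathcal{V}\times\mathcal{X}$ with $P_{U,V,X}=P_{U,V}P_{X|V}$ (i.e. $U-V-X$ is a Markov chain) and $\mathbb{E}_P[\mathsf{C}(X)]\leq b$, and the mutual informations are computed under $P=P_{U,V,X}P_{Y,Z|X}$.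
   Context: Cost-constrained wiretap channel (CC WTC) setup. For $n\in\mathbb{N}$ and $R\ge 0$, let $\mathcal{M}_n:=\{m\in\mathbb{N}:1\le m\le 2^{nR}\}$. An $(n,R)$-code $c_n=(f_n,g_n)$ consists of a stochastic encoder $f_n:\mathcal{M}_n\to\mathcal{P}(\mathcal{X}^n)$ satisfying the per-message cost constraint $\sum_{\mathbf{x}\in\mathcal{X}^n} f_n(\mathbf{x}|m)\,\mathsf{C}_n(\mathbf{x})\le b$ for all $m\in\mathcal{M}_n$, where $\mathsf{C}_n(\mathbf{x}):=\frac1n\sum_{i=1}^n\mathsf{C}(x_i)$, and a decoder $g_n:\mathcal{Y}^n\to\mathcal{M}_n$. A message PMF $P_M$ and the code induce the joint PMF $P_M(m)f_n(\mathbf{x}|m)P_{Y,Z|X}^{\otimes n}(\mathbf{y},\mathbf{z}|\mathbf{x})\mathbb{1}\{\hat m=g_n(\mathbf{y})\}$ (memoryless channel). The maximal error probability is $e(c_n):=\max_m \sum_{\mathbf{x}}f_n(\mathbf{x}|m)\sum_{\mathbf{y}:g_n(\mathbf{y})\neq m}P^{\otimes n}_{Y|X}(\mathbf{y}|\mathbf{x})$. The leakage is $\ell(P_M,c_n):=I(M;\mathbf{Z})$ under the induced PMF. With $\bar P_M$ uniform on $\mathcal{M}_n$: $\ell_{\mathsf{weak}}(c_n):=\frac1n\ell(\bar P_M,c_n)$, $\ell_{\mathsf{str}}(c_n):=\ell(\bar P_M,c_n)$, $\ell_{\mathsf{sem}}(c_n):=\max_{P_M\in\mathcal{P}(\mathcal{M}_n)}\ell(P_M,c_n)$.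 A rate $R$ is achievable under a given metric $\ell_\ast$ if for every $\epsilon>0$ and all sufficiently large $n$ there is an $(n,R)$-code satisfying the per-message cost constraint and $\max\{e(c_n),\ell_\ast(c_n)\}\le\epsilon$. $C_{\mathsf{sem}}(b)$, $C_{\mathsf{str}}(b)$, $C_{\mathsf{weak}}(b)$ denote the suprema of rates achievable under $\ell_{\mathsf{sem}},\ell_{\mathsf{str}},\ell_{\mathsf{weak}}$ respectively. *)

theory Defs
  imports "HOL-Probability.Probability"
begin

text \<open>Finite-alphabet cost-constrained wiretap channel. The channel is
W :: 'x \<Rightarrow> ('y \<times> 'z) pmf (i.e. P_{Y,Z|X}); n-letter sequences are lists of
length n; information is measured in bits (log base 2), matching 2^{nR}.\<close>

definition seqs :: "nat \<Rightarrow> 'a list set" where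
  "seqs n = {xs. length xs = n}"

definition msgs :: "nat \<Rightarrow> real \<Rightarrow> nat set" where
  "msgs n R = {m. 1 \<le> m \<and> real m \<le> 2 powr (real n * R)}"

definition chY :: "('x \<Rightarrow> ('y::finite \<times> 'z::finite) pmf) \<Rightarrow> 'x \<Rightarrow> 'y \<Rightarrow> real" where
  "chY W x y = (\<Sum>z\<in>UNIV. pmf (W x) (y, z))"

definition chZ :: "('x \<Rightarrow> ('y::finite \<times> 'z::finite) pmf) \<Rightarrow> 'x \<Rightarrow> 'z \<Rightarrow> real" where
  "chZ W x z = (\<Sum>y\<in>UNIV. pmf (W x) (y, z))"

definition prodch :: "('x \<Rightarrow> 'y \<Rightarrow> real) \<Rightarrow> 'x list \<Rightarrow> 'y list \<Rightarrow> real" where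
  "prodch K xs ys = (\<Prod>i<length xs. K (xs ! i) (ys ! i))"

definition cost_n :: "('x \<Rightarrow> real) \<Rightarrow> 'x list \<Rightarrow> real" where
  "cost_n C xs = sum_list (map C xs) / real (length xs)"

definition mutual_info :: "'a set \<Rightarrow> 'b set \<Rightarrow> ('a \<Rightarrow> 'b \<Rightarrow> real) \<Rightarrow> real" where
  "mutual_info A B p =
     (\<Sum>a\<in>A. \<Sum>b\<in>B. if p a b = 0 then 0
        else p a b * log 2 (p a b / ((\<Sum>b'\<in>B. p a b') * (\<Sum>a'\<in>A. p a' b))))"

definition cond_mutual_info :: "'u set \<Rightarrow> 'a set \<Rightarrow> 'b set \<Rightarrow> ('u \<Rightarrow> 'a \<Rightarrow> 'b \<Rightarrow> real) \<Rightarrow> real" where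
  "cond_mutual_info U A B p =
     (\<Sum>u\<in>U. \<Sum>a\<in>A. \<Sum>b\<in>B. if p u a b = 0 then 0
        else p u a b * log 2 (p u a b * (\<Sum>a'\<in>A. \<Sum>b'\<in>B. p u a' b')
               / ((\<Sum>b'\<in>B. p u a b') * (\<Sum>a'\<in>A. p u a' b))))"

definition is_code :: "('x \<Rightarrow> real) \<Rightarrow> real \<Rightarrow> nat \<Rightarrow> real
      \<Rightarrow> (nat \<Rightarrow> 'x list \<Rightarrow> real) \<Rightarrow> ('y list \<Rightarrow> nat) \<Rightarrow> bool" where
  "is_code C b n R f g \<longleftrightarrow>
     (\<forall>m\<in>msgs n R. (\<forall>xs\<in>seqs n. 0 \<le> f m xs) \<and> (\<Sum>xs\<in>seqs n. f m xs) = 1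
        \<and> (\<Sum>xs\<in>seqs n. f m xs * cost_n C xs) \<le> b)
     \<and> (\<forall>ys\<in>seqs n. g ys \<in> msgs n R)"

definition max_err :: "('x \<Rightarrow> ('y::finite \<times> 'z::finite) pmf) \<Rightarrow> nat \<Rightarrow> real
      \<Rightarrow> (nat \<Rightarrow> 'x list \<Rightarrow> real) \<Rightarrow> ('y list \<Rightarrow> nat) \<Rightarrow> real" where
  "max_err W n R f g = Max ((\<lambda>m. \<Sum>xs\<in>seqs n. f m xs *
        (\<Sum>ys\<in>{ys\<in>seqs n. g ys \<noteq> m}. prodch (chY W) xs ys)) ` msgs n R)"

definition leak :: "('x \<Rightarrow> ('y::finite \<times> 'z::finite) pmf) \<Rightarrow> nat \<Rightarrow> real
      \<Rightarrow> (nat \<Rightarrow> 'x list \<Rightarrow> real) \<Rightarrow> (nat \<Rightarrow> real) \<Rightarrow> real" where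
  "leak W n R f PM = mutual_info (msgs n R) (seqs n)
     (\<lambda>m (zs :: 'z list). PM m * (\<Sum>xs\<in>seqs n. f m xs * prodch (chZ W) xs zs))"

definition leak_str :: "('x \<Rightarrow> ('y::finite \<times> 'z::finite) pmf) \<Rightarrow> nat \<Rightarrow> real
      \<Rightarrow> (nat \<Rightarrow> 'x list \<Rightarrow> real) \<Rightarrow> real" where
  "leak_str W n R f = leak W n R f (\<lambda>m. 1 / real (card (msgs n R)))"

definition leak_weak :: "('x \<Rightarrow> ('y::finite \<times> 'z::finite) pmf) \<Rightarrow> nat \<Rightarrow> real
      \<Rightarrow> (nat \<Rightarrow> 'x list \<Rightarrow> real) \<Rightarrow> real" where
  "leak_weak W n R f = leak_str W n R f / real n"

definition leak_sem :: "('x \<Rightarrow> ('y::finite \<times> 'z::finite) pmf) \<Rightarrow> nat \<Rightarrow> real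
      \<Rightarrow> (nat \<Rightarrow> 'x list \<Rightarrow> real) \<Rightarrow> real" where
  "leak_sem W n R f = Sup {leak W n R f PM | PM.
      (\<forall>m\<in>msgs n R. 0 \<le> PM m) \<and> (\<Sum>m\<in>msgs n R. PM m) = 1}"

definition achievable :: "(('x \<Rightarrow> ('y::finite \<times> 'z::finite) pmf) \<Rightarrow> nat \<Rightarrow> real
        \<Rightarrow> (nat \<Rightarrow> 'x list \<Rightarrow> real) \<Rightarrow> real)
      \<Rightarrow> ('x \<Rightarrow> ('y \<times> 'z) pmf) \<Rightarrow> ('x \<Rightarrow> real) \<Rightarrow> real \<Rightarrow> real \<Rightarrow> bool" where
  "achievable L W C b R \<longleftrightarrow>
     (\<forall>\<epsilon>>0. \<exists>N. \<forall>n\<ge>N. \<exists>f g. is_code C b n R f g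
         \<and> max_err W n R f g \<le> \<epsilon> \<and> L W n R f \<le> \<epsilon>)"

definition capacity :: "(('x \<Rightarrow> ('y::finite \<times> 'z::finite) pmf) \<Rightarrow> nat \<Rightarrow> real
        \<Rightarrow> (nat \<Rightarrow> 'x list \<Rightarrow> real) \<Rightarrow> real)
      \<Rightarrow> ('x \<Rightarrow> ('y \<times> 'z) pmf) \<Rightarrow> ('x \<Rightarrow> real) \<Rightarrow> real \<Rightarrow> real" where
  "capacity L W C b = Sup {R. 0 \<le> R \<and> achievable L W C b R}"

text \<open>Cbar(b): supremum of I(V;Y|U) - I(V;Z|U) over finite alphabets U, V (represented,
without loss of generality, as finite sets of naturals) and PMFs P_{U,V,X} = P_{U,V} P_{X|V}
with E[C(X)] \<le> b.\<close>
definition Cbar :: "('x::finite \<Rightarrow> ('y::finite \<times> 'z::finite) pmf) \<Rightarrow> ('x \<Rightarrow> real) \<Rightarrow> real \<Rightarrow> real" where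
  "Cbar W C b = Sup {cond_mutual_info U V UNIV (\<lambda>u v y. \<Sum>x\<in>UNIV. PUV u v * K v x * chY W x y)
                    - cond_mutual_info U V UNIV (\<lambda>u v z. \<Sum>x\<in>UNIV. PUV u v * K v x * chZ W x z)
      | (U :: nat set) (V :: nat set) (PUV :: nat \<Rightarrow> nat \<Rightarrow> real) (K :: nat \<Rightarrow> 'x \<Rightarrow> real).
         finite U \<and> finite V
         \<and> (\<forall>u\<in>U. \<forall>v\<in>V. 0 \<le> PUV u v) \<and> (\<Sum>u\<in>U. \<Sum>v\<in>V. PUV u v) = 1
         \<and> (\<forall>v\<in>V. (\<forall>x. 0 \<le> K v x) \<and> (\<Sum>x\<in>UNIV. K v x) = 1)
         \<and> (\<Sum>u\<in>U. \<Sum>v\<in>V. \<Sum>x\<in>UNIV. PUV u v * K v x * C x) \<le> b}"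

end

theory Submission
  imports Defs
begin

text \<open>Converse: by a Fano bound the rate is at most \<open>I(M;Y\<^sup>n) - I(M;Z\<^sup>n)\<close> per letter, up to vanishing
  terms; passing from \<open>Z\<^sup>n\<close> to \<open>Y\<^sup>n\<close> one coordinate at a time makes this difference a telescoping sum
  of differences of conditional informations, which a uniformly distributed time index turns into
  a single one.

  Achievability: fix a sequence \<open>u\<^sup>n\<close> and draw codewords \<open>v\<^sup>n\<close> from the conditional law, \<open>J\<close> for each
  message, with \<open>J\<close> slightly larger than \<open>2\<^sup>n\<^sup>I\<^sup>(\<^sup>V\<^sup>;\<^sup>Z\<^sup>|\<^sup>U\<^sup>)\<close>. Averaged over messages, the expected error
  of a threshold decoder, the expected divergence of the induced law of \<open>Z\<^sup>n\<close> from its mean, and the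
  probability of violating the cost constraint all decay exponentially. Discarding the worse half of
  the messages bounds the three quantities for every remaining message at once, and the divergence of
  the worst message dominates the leakage under every message distribution. The capacities are thus
  squeezed between the semantic achievability bound and the weak converse.\<close>

section \<open>Entropy form and elementary inequalities\<close>

text \<open>The cost constraint is the obstacle that shapes achievability. It must hold exactly for
  every message, while random coding yields it only up to a small probability of overshoot, so slack
  is required. If \<open>b\<close> exceeds the least letter cost, slack is bought by mixing in the
  cheapest letter with small weight, announced by a fresh value of \<open>U\<close> so that the gain
  merely shrinks by a factor. If \<open>b\<close> equals the least cost there is no slack, but then
  every letter of \<open>V\<close> with positive weight already costs exactly \<open>b\<close>.

  Mutual information under the uniform message law says little about other laws. Divergence from one
  reference law common to all messages does not involve the message law at all, which is why the
  code is controlled in that form.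

  Logarithms are traded for powers with a small exponent, since averages of powers factor over the
  \<open>n\<close> letters; an exponent that gives decay exists because the relevant log-ratio has
  negative mean once a margin \<delta> is left.

  In the converse the channel input must depend on \<open>V\<close> alone, so the message is paired
  with the conditioning variable to form \<open>V\<close>.\<close>

definition xlog :: "real \<Rightarrow> real" where
  "xlog x = x * log 2 x"

lemma xlog_0 [simp]: "xlog 0 = 0"
  by (simp add: xlog_def)

text \<open>A positive joint weight makes both marginals positive, so the logarithm splits; the
  remaining case is absorbed by \<open>xlog 0 = 0\<close>. In this form the chain rule is a mere
  cancellation.\<close>

lemma mutual_info_entropy:
  assumes fin: "finite A" "finite B" and nn: "\<And>a b. a \<in> A \<Longrightarrow> b \<in> B \<Longrightarrow> 0 \<le> p a b"
  shows "mutual_info A B p = (\<Sum>a\<in>A. \<Sum>b\<in>B. xlog (p a b))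
           - (\<Sum>a\<in>A. xlog (\<Sum>b\<in>B. p a b)) - (\<Sum>b\<in>B. xlog (\<Sum>a\<in>A. p a b))"
proof -
  have "(if p a b = 0 then 0
        else p a b * log 2 (p a b / ((\<Sum>b'\<in>B. p a b') * (\<Sum>a'\<in>A. p a' b))))
      = xlog (p a b) - p a b * log 2 (\<Sum>b\<in>B. p a b) - p a b * log 2 (\<Sum>a\<in>A. p a b)"
    if "a \<in> A" "b \<in> B" for a b
  proof (cases "p a b = 0")
    case False
    then have p: "0 < p a b" using nn that by force
    have "p a b \<le> (\<Sum>b'\<in>B. p a b')" "p a b \<le> (\<Sum>a'\<in>A. p a' b)"
      using that fin nn by (auto intro: member_le_sum)
    then have "0 < (\<Sum>b'\<in>B. p a b')" "0 < (\<Sum>a'\<in>A. p a' b)"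
      using p by auto
    then show ?thesis
      using p by (simp add: xlog_def log_divide_pos log_mult_pos algebra_simps)
  qed auto
  then have "mutual_info A B p = (\<Sum>a\<in>A. \<Sum>b\<in>B. xlog (p a b) - p a b * log 2 (\<Sum>b\<in>B. p a b)
      - p a b * log 2 (\<Sum>a\<in>A. p a b))"
    unfolding mutual_info_def by (intro sum.cong refl) blast
  also have "\<dots> = (\<Sum>a\<in>A. \<Sum>b\<in>B. xlog (p a b))
       - (\<Sum>a\<in>A. \<Sum>b\<in>B. p a b * log 2 (\<Sum>b\<in>B. p a b))
       - (\<Sum>b\<in>B. \<Sum>a\<in>A. p a b * log 2 (\<Sum>a\<in>A. p a b))"
    by (subst (4) sum.swap) (simp add: sum_subtractf)
  finally show ?thesis
    by (simp add: xlog_def sum_distrib_right)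
qed

text \<open>Normalising within the slice \<open>u\<close> is what adds the term in the total weight
  of that slice.\<close>

lemma cond_mutual_info_entropy:
  assumes fin: "finite A" "finite B"
    and nn: "\<And>u a b. u \<in> U \<Longrightarrow> a \<in> A \<Longrightarrow> b \<in> B \<Longrightarrow> 0 \<le> p u a b"
  shows "cond_mutual_info U A B p = (\<Sum>u\<in>U. (\<Sum>a\<in>A. \<Sum>b\<in>B. xlog (p u a b))
           + xlog (\<Sum>a\<in>A. \<Sum>b\<in>B. p u a b)
           - (\<Sum>a\<in>A. xlog (\<Sum>b\<in>B. p u a b)) - (\<Sum>b\<in>B. xlog (\<Sum>a\<in>A. p u a b)))"
  unfolding cond_mutual_info_def
proof (intro sum.cong refl)
  fix u assume u: "u \<in> U"
  let ?P = "\<Sum>a\<in>A. \<Sum>b\<in>B. p u a b"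
  have "(if p u a b = 0 then 0
        else p u a b * log 2 (p u a b * ?P / ((\<Sum>b'\<in>B. p u a b') * (\<Sum>a'\<in>A. p u a' b))))
      = xlog (p u a b) + p u a b * log 2 ?P
        - p u a b * log 2 (\<Sum>b\<in>B. p u a b) - p u a b * log 2 (\<Sum>a\<in>A. p u a b)"
    if "a \<in> A" "b \<in> B" for a b
  proof (cases "p u a b = 0")
    case False
    then have p: "0 < p u a b" using nn[OF u] that by force
    have 1: "p u a b \<le> (\<Sum>b'\<in>B. p u a b')" "p u a b \<le> (\<Sum>a'\<in>A. p u a' b)"
      using that fin nn[OF u] by (auto intro: member_le_sum)
    have "(\<Sum>b'\<in>B. p u a b') \<le> ?P"
      using that fin nn[OF u] by (intro member_le_sum[where f = "\<lambda>a. \<Sum>b'\<in>B. p u a b'"] sum_nonneg) auto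
    with 1 have "0 < (\<Sum>b'\<in>B. p u a b')" "0 < (\<Sum>a'\<in>A. p u a' b)" "0 < ?P"
      using p by auto
    then show ?thesis
      using p by (simp add: xlog_def log_divide_pos log_mult_pos algebra_simps)
  qed auto
  then have "(\<Sum>a\<in>A. \<Sum>b\<in>B. if p u a b = 0 then 0
        else p u a b * log 2 (p u a b * ?P / ((\<Sum>b'\<in>B. p u a b') * (\<Sum>a'\<in>A. p u a' b))))
    = (\<Sum>a\<in>A. \<Sum>b\<in>B. xlog (p u a b) + p u a b * log 2 ?P
        - p u a b * log 2 (\<Sum>b\<in>B. p u a b) - p u a b * log 2 (\<Sum>a\<in>A. p u a b))"
    by (intro sum.cong refl) blast
  also have "\<dots> = (\<Sum>a\<in>A. \<Sum>b\<in>B. xlog (p u a b)) + (\<Sum>a\<in>A. \<Sum>b\<in>B. p u a b * log 2 ?P)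
       - (\<Sum>a\<in>A. \<Sum>b\<in>B. p u a b * log 2 (\<Sum>b\<in>B. p u a b))
       - (\<Sum>b\<in>B. \<Sum>a\<in>A. p u a b * log 2 (\<Sum>a\<in>A. p u a b))"
    by (subst sum.swap[of "\<lambda>b a. p u a b * log 2 (\<Sum>a\<in>A. p u a b)" A B])
      (simp add: sum_subtractf sum.distrib)
  finally show "(\<Sum>a\<in>A. \<Sum>b\<in>B. if p u a b = 0 then 0
        else p u a b * log 2 (p u a b * ?P / ((\<Sum>b'\<in>B. p u a b') * (\<Sum>a'\<in>A. p u a' b))))
     = (\<Sum>a\<in>A. \<Sum>b\<in>B. xlog (p u a b)) + xlog ?P
        - (\<Sum>a\<in>A. xlog (\<Sum>b\<in>B. p u a b)) - (\<Sum>b\<in>B. xlog (\<Sum>a\<in>A. p u a b))"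
    by (simp add: xlog_def sum_distrib_right)
qed

text \<open>In entropy form the terms in the marginals of \<open>(s, a)\<close> and of
  \<open>s\<close> occur with opposite signs and cancel. The converse uses this to isolate one
  output coordinate.\<close>

lemma mutual_info_chain:
  assumes fin: "finite A" "finite S" "finite T"
    and nn: "\<And>s a t. s \<in> S \<Longrightarrow> a \<in> A \<Longrightarrow> t \<in> T \<Longrightarrow> 0 \<le> q s a t"
  shows "mutual_info A (S \<times> T) (\<lambda>a (s, t). q s a t)
       = mutual_info A S (\<lambda>a s. \<Sum>t\<in>T. q s a t) + cond_mutual_info S A T q"
proof -
  have 1: "(\<Sum>a\<in>A. \<Sum>s\<in>S. xlog (\<Sum>t\<in>T. q s a t)) = (\<Sum>s\<in>S. \<Sum>a\<in>A. xlog (\<Sum>t\<in>T. q s a t))"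
    by (rule sum.swap)
  have 2: "(\<Sum>a\<in>A. \<Sum>s\<in>S. \<Sum>t\<in>T. xlog (q s a t)) = (\<Sum>s\<in>S. \<Sum>a\<in>A. \<Sum>t\<in>T. xlog (q s a t))"
    by (rule sum.swap)
  have "mutual_info A (S \<times> T) (\<lambda>a (s, t). q s a t)
    = (\<Sum>a\<in>A. \<Sum>(s,t)\<in>S\<times>T. xlog (q s a t)) - (\<Sum>a\<in>A. xlog (\<Sum>(s,t)\<in>S\<times>T. q s a t))
      - (\<Sum>(s,t)\<in>S\<times>T. xlog (\<Sum>a\<in>A. q s a t))"
    using fin nn by (subst mutual_info_entropy) (auto simp: case_prod_unfold)
  also have "\<dots> = (\<Sum>s\<in>S. \<Sum>a\<in>A. \<Sum>t\<in>T. xlog (q s a t)) - (\<Sum>a\<in>A. xlog (\<Sum>s\<in>S. \<Sum>t\<in>T. q s a t))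
      - (\<Sum>s\<in>S. \<Sum>t\<in>T. xlog (\<Sum>a\<in>A. q s a t))"
    by (simp add: sum.cartesian_product[symmetric] 2)
  also have "\<dots> = mutual_info A S (\<lambda>a s. \<Sum>t\<in>T. q s a t) + cond_mutual_info S A T q"
    using fin nn by (simp add: mutual_info_entropy cond_mutual_info_entropy sum_nonneg
        sum.distrib sum_subtractf 1)
  finally show ?thesis .
qed

lemma mutual_info_reindex:
  assumes "bij_betw h B' B"
  shows "mutual_info A B p = mutual_info A B' (\<lambda>a b. p a (h b))"
  unfolding mutual_info_def by (simp add: sum.reindex_bij_betw[OF assms, symmetric] cong: if_cong)

lemma cond_mutual_info_reindex:
  assumes "bij_betw h U' U" "bij_betw k A' A"
  shows "cond_mutual_info U A B p = cond_mutual_info U' A' B (\<lambda>u a b. p (h u) (k a) b)"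
  unfolding cond_mutual_info_def
  by (simp add: sum.reindex_bij_betw[OF assms(1), symmetric] sum.reindex_bij_betw[OF assms(2), symmetric]
      cong: if_cong)

lemma mutual_info_cong:
  "(\<And>a b. a \<in> A \<Longrightarrow> b \<in> B \<Longrightarrow> p a b = q a b) \<Longrightarrow> mutual_info A B p = mutual_info A B q"
  unfolding mutual_info_def by (simp cong: sum.cong if_cong)

lemma cond_mutual_info_cong:
  "(\<And>u a b. u \<in> U \<Longrightarrow> a \<in> A \<Longrightarrow> b \<in> B \<Longrightarrow> p u a b = q u a b)
    \<Longrightarrow> cond_mutual_info U A B p = cond_mutual_info U A B q"
  unfolding cond_mutual_info_def by (simp cong: sum.cong if_cong)

text \<open>The argument of the logarithm is homogeneous of degree 0, so only the weight in front
  scales. This serves the weight \<open>1 / n\<close> of a time index and the weight of a mixture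
  component.\<close>

lemma cond_mutual_info_scale:
  assumes "t \<noteq> 0"
  shows "cond_mutual_info U A B (\<lambda>u a b. t * p u a b) = t * cond_mutual_info U A B p"
proof -
  have "(if t * p u a b = 0 then 0 else t * p u a b * log 2 (t * p u a b * (\<Sum>a'\<in>A. \<Sum>b'\<in>B. t * p u a' b')
               / ((\<Sum>b'\<in>B. t * p u a b') * (\<Sum>a'\<in>A. t * p u a' b))))
    = t * (if p u a b = 0 then 0 else p u a b * log 2 (p u a b * (\<Sum>a'\<in>A. \<Sum>b'\<in>B. p u a' b')
               / ((\<Sum>b'\<in>B. p u a b') * (\<Sum>a'\<in>A. p u a' b))))" for u a b
    using assms unfolding sum_distrib_left[symmetric] by (simp add: mult_ac)
  then show ?thesis
    unfolding cond_mutual_info_def by (simp only: sum_distrib_left)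
qed

section \<open>Gibbs' inequality and bounds on conditional information\<close>

lemma gibbs_ln:
  fixes p q :: real
  assumes "0 \<le> p" "0 \<le> q" "p \<noteq> 0 \<Longrightarrow> q \<noteq> 0"
  shows "p - q \<le> p * ln (p / q)"
proof (cases "p = 0")
  case False
  then have pq: "0 < p" "0 < q" using assms by auto
  have "ln (q / p) \<le> q / p - 1" using pq by (intro ln_le_minus_one) auto
  then have "p * (1 - q / p) \<le> p * ln (p / q)"
    using pq by (intro mult_left_mono) (auto simp: ln_div)
  then show ?thesis using pq by (simp add: algebra_simps)
qed (use assms in simp)

lemma gibbs_log2:
  fixes p q :: real
  assumes "0 \<le> p" "0 \<le> q" "p \<noteq> 0 \<Longrightarrow> q \<noteq> 0"
  shows "(p - q) / ln 2 \<le> p * log 2 (p / q)"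
  using divide_right_mono[OF gibbs_ln[OF assms], of "ln 2"] by (simp add: log_def)

text \<open>Gibbs' inequality is summed against the weights that make both variables independent
  given \<open>u\<close>. These have the same total mass on each slice, so the linear terms
  cancel.\<close>

lemma cond_mutual_info_nonneg:
  assumes fin: "finite A" "finite B"
    and nn: "\<And>u a b. u \<in> U \<Longrightarrow> a \<in> A \<Longrightarrow> b \<in> B \<Longrightarrow> 0 \<le> p u a b"
  shows "0 \<le> cond_mutual_info U A B p"
  unfolding cond_mutual_info_def
proof (rule sum_nonneg)
  fix u assume u: "u \<in> U"
  let ?P = "\<Sum>a\<in>A. \<Sum>b\<in>B. p u a b"
  let ?q = "\<lambda>a b. (\<Sum>b'\<in>B. p u a b') * (\<Sum>a'\<in>A. p u a' b) / ?P"
  have "(p u a b - ?q a b) / ln 2 \<le> (if p u a b = 0 then 0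
        else p u a b * log 2 (p u a b * ?P / ((\<Sum>b'\<in>B. p u a b') * (\<Sum>a'\<in>A. p u a' b))))"
    if "a \<in> A" "b \<in> B" for a b
  proof -
    have 1: "p u a b \<le> (\<Sum>b'\<in>B. p u a b')" "p u a b \<le> (\<Sum>a'\<in>A. p u a' b)"
      using that fin nn[OF u] by (auto intro: member_le_sum)
    have 2: "(\<Sum>b'\<in>B. p u a b') \<le> ?P"
      using that fin nn[OF u] by (intro member_le_sum[where f = "\<lambda>a. \<Sum>b'\<in>B. p u a b'"] sum_nonneg) auto
    have p: "0 \<le> p u a b" using nn[OF u] that by auto
    have "(p u a b - ?q a b) / ln 2 \<le> p u a b * log 2 (p u a b / ?q a b)"
    proof (rule gibbs_log2)
      show "0 \<le> ?q a b" using 1 2 p by (intro divide_nonneg_nonneg mult_nonneg_nonneg) linarith+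
      show "?q a b \<noteq> 0" if "p u a b \<noteq> 0"
        using 1 2 p that by auto
    qed (use p in auto)
    then show ?thesis by auto
  qed
  then have "(\<Sum>a\<in>A. \<Sum>b\<in>B. (p u a b - ?q a b) / ln 2) \<le> (\<Sum>a\<in>A. \<Sum>b\<in>B. if p u a b = 0 then 0
        else p u a b * log 2 (p u a b * ?P / ((\<Sum>b'\<in>B. p u a b') * (\<Sum>a'\<in>A. p u a' b))))"
    by (intro sum_mono) blast
  moreover have "(\<Sum>a\<in>A. \<Sum>b\<in>B. ?q a b) = ?P"
  proof -
    have "(\<Sum>a\<in>A. \<Sum>b\<in>B. ?q a b) = ?P * (\<Sum>b\<in>B. \<Sum>a'\<in>A. p u a' b) / ?P"
      by (simp add: sum_divide_distrib[symmetric] sum_distrib_left[symmetric] sum_distrib_right[symmetric])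
    also have "(\<Sum>b\<in>B. \<Sum>a'\<in>A. p u a' b) = ?P" by (rule sum.swap)
    finally show ?thesis by simp
  qed
  then have "(\<Sum>a\<in>A. \<Sum>b\<in>B. (p u a b - ?q a b) / ln 2) = 0"
    by (simp add: sum_divide_distrib[symmetric] sum_subtractf)
  ultimately show "0 \<le> (\<Sum>a\<in>A. \<Sum>b\<in>B. if p u a b = 0 then 0
        else p u a b * log 2 (p u a b * ?P / ((\<Sum>b'\<in>B. p u a b') * (\<Sum>a'\<in>A. p u a' b))))"
    by simp
qed

text \<open>A crude bound that makes the supremum in \<open>Cbar\<close> one of a bounded set.
  Bounding the conditional weight of \<open>b\<close> given \<open>u\<close> and \<open>a\<close> by
  1 leaves terms of the form \<open>t * log 2 (P / t)\<close>, each at most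
  \<open>P / ln 2\<close>.\<close>

lemma cond_mutual_info_le:
  fixes p :: "'u \<Rightarrow> 'a \<Rightarrow> 'b \<Rightarrow> real"
  assumes fin: "finite A" "finite B"
    and nn: "\<And>u a b. u \<in> U \<Longrightarrow> a \<in> A \<Longrightarrow> b \<in> B \<Longrightarrow> 0 \<le> p u a b"
  shows "cond_mutual_info U A B p \<le> card B * (\<Sum>u\<in>U. \<Sum>a\<in>A. \<Sum>b\<in>B. p u a b) / ln 2"
proof -
  have "(\<Sum>a\<in>A. \<Sum>b\<in>B. if p u a b = 0 then 0 else p u a b * log 2 (p u a b *
      (\<Sum>a\<in>A. \<Sum>b\<in>B. p u a b) / ((\<Sum>b'\<in>B. p u a b') * (\<Sum>a'\<in>A. p u a' b))))
     \<le> card B * (\<Sum>a\<in>A. \<Sum>b\<in>B. p u a b) / ln 2" (is "?L \<le> _") if u: "u \<in> U" for u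
  proof -
    let ?P = "\<Sum>a\<in>A. \<Sum>b\<in>B. p u a b"
    let ?pb = "\<lambda>b. \<Sum>a\<in>A. p u a b"
    have "(if p u a b = 0 then 0
        else p u a b * log 2 (p u a b * ?P / ((\<Sum>b'\<in>B. p u a b') * (\<Sum>a'\<in>A. p u a' b))))
        \<le> p u a b * log 2 (?P / ?pb b)"
      if "a \<in> A" "b \<in> B" for a b
    proof (cases "p u a b = 0")
      case False
      then have p: "0 < p u a b" using nn[OF u] that by force
      have 1: "p u a b \<le> (\<Sum>b'\<in>B. p u a b')" "p u a b \<le> (\<Sum>a'\<in>A. p u a' b)"
        using that fin nn[OF u] by (auto intro: member_le_sum)
      have 2: "(\<Sum>b'\<in>B. p u a b') \<le> ?P"
        using that fin nn[OF u] by (intro member_le_sum[where f = "\<lambda>a. \<Sum>b'\<in>B. p u a b'"] sum_nonneg) auto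
      have 3: "0 < (\<Sum>b'\<in>B. p u a b')" "0 < ?pb b" "0 < ?P" using 1 2 p by auto
      have "p u a b * ?P / ((\<Sum>b'\<in>B. p u a b') * ?pb b) = (p u a b / (\<Sum>b'\<in>B. p u a b')) * (?P / ?pb b)"
        by simp
      also have "\<dots> \<le> 1 * (?P / ?pb b)"
        using 1 3 by (intro mult_right_mono) auto
      finally have "p u a b * ?P / ((\<Sum>b'\<in>B. p u a b') * ?pb b) \<le> ?P / ?pb b" by simp
      then show ?thesis using False 3 p by (simp add: log_le_cancel_iff)
    qed auto
    then have "?L \<le> (\<Sum>a\<in>A. \<Sum>b\<in>B. p u a b * log 2 (?P / ?pb b))"
      by (intro sum_mono) blast
    also have "\<dots> = (\<Sum>b\<in>B. ?pb b * log 2 (?P / ?pb b))"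
      by (subst sum.swap) (simp add: sum_distrib_right)
    also have "\<dots> \<le> (\<Sum>b\<in>B. ?P / ln 2)"
    proof (rule sum_mono)
      fix b assume b: "b \<in> B"
      have P0: "0 \<le> ?P" using nn[OF u] by (intro sum_nonneg) auto
      have pb0: "0 \<le> ?pb b" using nn[OF u] b by (intro sum_nonneg) auto
      show "?pb b * log 2 (?P / ?pb b) \<le> ?P / ln 2"
      proof (cases "?pb b = 0")
        case False
        then have "0 < ?pb b" using pb0 by simp
        moreover have "?pb b \<le> ?P"
          using b fin nn[OF u] by (intro sum_mono member_le_sum) auto
        ultimately have "?pb b * ln (?P / ?pb b) \<le> ?pb b * (?P / ?pb b - 1)"
          by (intro mult_left_mono ln_le_minus_one) auto
        also have "\<dots> \<le> ?P" using False pb0 by (simp add: algebra_simps)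
        finally show ?thesis by (simp add: log_def divide_right_mono)
      qed (use P0 in simp)
    qed
    finally show ?thesis by simp
  qed
  then have "cond_mutual_info U A B p \<le> (\<Sum>u\<in>U. card B * (\<Sum>a\<in>A. \<Sum>b\<in>B. p u a b) / ln 2)"
    unfolding cond_mutual_info_def by (intro sum_mono) auto
  also have "\<dots> = card B * (\<Sum>u\<in>U. \<Sum>a\<in>A. \<Sum>b\<in>B. p u a b) / ln 2"
    by (simp add: sum_divide_distrib sum_distrib_left)
  finally show ?thesis .
qed

section \<open>Sums over words and memoryless channels\<close>

text \<open>Auxiliary alphabets are finite subsets of a type, whereas \<open>seqs\<close> uses the
  whole type; here the alphabet is carried explicitly.\<close>

definition words :: "nat \<Rightarrow> 'a set \<Rightarrow> 'a list set" where
  "words n A = {xs. set xs \<subseteq> A \<and> length xs = n}"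

lemma finite_words [simp]: "finite A \<Longrightarrow> finite (words n A)"
  by (simp add: words_def finite_lists_length_eq)

lemma seqs_eq_words: "seqs n = words n UNIV"
  by (simp add: seqs_def words_def)

lemma finite_seqs [simp]: "finite (seqs n :: 'a::finite list set)"
  by (simp add: seqs_eq_words)

lemma words_0 [simp]: "words 0 A = {[]}"
  by (auto simp: words_def)

lemma words_Suc: "words (Suc n) A = (\<lambda>(a, xs). a # xs) ` (A \<times> words n A)"
  by (force simp: words_def length_Suc_conv)

lemma sum_words_Suc: "(\<Sum>xs\<in>words (Suc n) A. F xs) = (\<Sum>a\<in>A. \<Sum>xs\<in>words n A. F (a # xs))"
  unfolding words_Suc
  by (subst sum.reindex) (auto simp: inj_on_def sum.cartesian_product case_prod_unfold)

text \<open>The distributive law. Passages from a sum over words to a product or a power of letter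
  sums rest on it.\<close>

lemma sum_words_prod:
  fixes g :: "nat \<Rightarrow> 'a \<Rightarrow> 'b::comm_semiring_1"
  shows "(\<Sum>xs\<in>words n A. \<Prod>i<n. g i (xs ! i)) = (\<Prod>i<n. \<Sum>a\<in>A. g i a)"
proof (induction n arbitrary: g)
  case (Suc n)
  have "(\<Sum>xs\<in>words (Suc n) A. \<Prod>i<Suc n. g i (xs ! i))
      = (\<Sum>a\<in>A. \<Sum>xs\<in>words n A. g 0 a * (\<Prod>i<n. g (Suc i) (xs ! i)))"
    by (simp add: sum_words_Suc prod.lessThan_Suc_shift del: prod.lessThan_Suc)
  also have "\<dots> = (\<Prod>i<Suc n. \<Sum>a\<in>A. g i a)"
    by (simp add: sum_distrib_left[symmetric] Suc[of "\<lambda>i. g (Suc i)"] sum_distrib_right[symmetric]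
        prod.lessThan_Suc_shift del: prod.lessThan_Suc)
  finally show ?case .
qed simp

lemma sum_words_marginal:
  fixes g :: "nat \<Rightarrow> 'a \<Rightarrow> real"
  assumes "\<And>i. i < n \<Longrightarrow> (\<Sum>a\<in>A. g i a) = 1" and k: "k < n"
  shows "(\<Sum>xs\<in>words n A. (\<Prod>i<n. g i (xs ! i)) * F (xs ! k)) = (\<Sum>a\<in>A. g k a * F a)"
proof -
  \<comment> \<open>The test function is absorbed into the factor at \<open>k\<close>, which leaves
    a pure product to be summed.\<close>
  have "(\<Prod>i<n. g i (xs ! i)) * F (xs ! k)
      = (\<Prod>i<n. g i (xs ! i) * (if i = k then F (xs ! i) else 1))" for xs
    using k by (simp add: prod.distrib prod.delta)
  then have "(\<Sum>xs\<in>words n A. (\<Prod>i<n. g i (xs ! i)) * F (xs ! k))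
     = (\<Prod>i<n. \<Sum>a\<in>A. g i a * (if i = k then F a else 1))"
    by (simp only: sum_words_prod[where g = "\<lambda>i a. g i a * (if i = k then F a else 1)"])
  also have "\<dots> = (\<Prod>i<n. if i = k then \<Sum>a\<in>A. g i a * F a else 1)"
    using assms by (intro prod.cong) auto
  also have "\<dots> = (\<Sum>a\<in>A. g k a * F a)" using k by (simp add: prod.delta)
  finally show ?thesis .
qed

section \<open>Memoryless channels and message sets\<close>

lemma prodch_Nil [simp]: "prodch K [] ys = 1"
  by (simp add: prodch_def)

lemma prodch_Cons [simp]: "prodch K (x # xs) (y # ys) = K x y * prodch K xs ys"
  by (simp add: prodch_def prod.lessThan_Suc_shift del: prod.lessThan_Suc)

lemma prodch_append:
  "length xs = length ys \<Longrightarrow> prodch K (xs @ xs') (ys @ ys') = prodch K xs ys * prodch K xs' ys'"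
  by (induction xs ys rule: list_induct2) auto

lemma prodch_nonneg: "(\<And>x y. 0 \<le> K x y) \<Longrightarrow> 0 \<le> prodch K xs ys"
  by (simp add: prodch_def prod_nonneg)

lemma sum_prodch:
  assumes "length xs = n" "\<And>x. x \<in> set xs \<Longrightarrow> (\<Sum>y\<in>A. K x y) = 1"
  shows "(\<Sum>ys\<in>words n A. prodch K xs ys) = 1"
  using assms by (simp add: prodch_def sum_words_prod[where g = "\<lambda>i. K (xs ! i)"])

lemma chY_nonneg [simp]: "0 \<le> chY W x y" and chZ_nonneg [simp]: "0 \<le> chZ W x z"
  by (simp_all add: chY_def chZ_def sum_nonneg)

lemma sum_chY [simp]: "(\<Sum>y\<in>UNIV. chY W x y) = 1"
  and sum_chZ [simp]: "(\<Sum>z\<in>UNIV. chZ W x z) = 1"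
proof -
  have "(\<Sum>(y, z)\<in>UNIV \<times> UNIV. pmf (W x) (y, z)) = 1"
    using sum_pmf_eq_1[of "UNIV \<times> UNIV" "W x"] by simp
  then show "(\<Sum>y\<in>UNIV. chY W x y) = 1"
    by (simp add: chY_def sum.cartesian_product)
  then show "(\<Sum>z\<in>UNIV. chZ W x z) = 1"
    unfolding chZ_def by (subst sum.swap) (simp add: chY_def)
qed

lemma msgs_eq: "msgs n R = {1..nat \<lfloor>2 powr (real n * R)\<rfloor>}"
proof -
  have "real m \<le> t \<longleftrightarrow> m \<le> nat \<lfloor>t\<rfloor>" if "0 \<le> t" for m t
    using that by linarith
  from this[OF powr_ge_zero, of _ 2 "real n * R"] show ?thesis
    unfolding msgs_def atLeastAtMost_def atLeast_def atMost_def by blast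
qed

lemma finite_msgs [simp]: "finite (msgs n R)"
  by (simp add: msgs_eq)

lemma card_msgs: "card (msgs n R) = nat \<lfloor>2 powr (real n * R)\<rfloor>"
  by (simp add: msgs_eq)

text \<open>Rounding down loses at most a factor 2 because \<open>2 powr (real n * R)\<close> is at
  least 1; the converse pays one bit for it.\<close>

lemma card_msgs_bounds:
  assumes "0 \<le> R"
  shows "0 < card (msgs n R)" "card (msgs n R) \<le> 2 powr (real n * R)"
    "2 powr (real n * R) / 2 \<le> card (msgs n R)" "1 \<in> msgs n R"
proof -
  have 1: "1 \<le> 2 powr (real n * R)" using assms by (simp add: ge_one_powr_ge_zero)
  then have 2: "1 \<le> \<lfloor>2 powr (real n * R)\<rfloor>" by simp
  then show "0 < card (msgs n R)" by (simp add: card_msgs)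
  have r: "real (card (msgs n R)) = \<lfloor>2 powr (real n * R)\<rfloor>" using 2 by (simp add: card_msgs)
  show "card (msgs n R) \<le> 2 powr (real n * R)" unfolding r by simp
  show "2 powr (real n * R) / 2 \<le> card (msgs n R)" unfolding r using 1 2 by linarith
  show "1 \<in> msgs n R" using 1 by (simp add: msgs_def)
qed

section \<open>Converse: single-letterization\<close>

lemma sum_slice:
  assumes "finite U" "finite A" "u \<in> U" "\<And>v. fst v \<noteq> u \<Longrightarrow> F v = 0"
  shows "(\<Sum>v\<in>U \<times> A. F v) = (\<Sum>m\<in>A. F (u, m) :: real)"
proof -
  have "(\<Sum>v\<in>U \<times> A. F v) = (\<Sum>v\<in>{u} \<times> A. F v)"
    using assms by (intro sum.mono_neutral_right) fastforce+
  also have "\<dots> = (\<Sum>m\<in>A. F (u, m))"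
    by (simp add: sum.cartesian_product' )
  finally show ?thesis .
qed

text \<open>Given \<open>u\<close>, the pair \<open>(u, m)\<close> carries the same information as
  \<open>m\<close>. The copy of \<open>u\<close> lets the input kernel, which sees \<open>V\<close>
  only, depend on both, so that \<open>U - V - X\<close> becomes a Markov chain.\<close>

lemma cond_mutual_info_slice:
  assumes "finite U" "finite A"
  shows "cond_mutual_info U (U \<times> A) B (\<lambda>u v b. if fst v = u then p u (snd v) b else 0)
       = cond_mutual_info U A B p"
  unfolding cond_mutual_info_def
  by (intro sum.cong refl) (simp add: sum_slice assms cong: if_cong)

text \<open>A time index moved into the conditioning variable turns a sum over time into one
  conditional information.\<close>

lemma cond_mutual_info_Sigma:
  assumes "finite I" "\<And>i. i \<in> I \<Longrightarrow> finite (S i)"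
  shows "cond_mutual_info (Sigma I S) A B p = (\<Sum>i\<in>I. cond_mutual_info (S i) A B (\<lambda>s. p (i, s)))"
  unfolding cond_mutual_info_def using assms
  by (simp add: sum.Sigma case_prod_unfold cong: if_cong)

section \<open>Competitors in the supremum \<open>Cbar\<close>\<close>

definition Cbar_witness ::
  "('x::finite \<Rightarrow> real) \<Rightarrow> real \<Rightarrow> 'u set \<Rightarrow> 'v set \<Rightarrow> ('u \<Rightarrow> 'v \<Rightarrow> real) \<Rightarrow> ('v \<Rightarrow> 'x \<Rightarrow> real) \<Rightarrow> bool" where
  "Cbar_witness C b U V PUV K \<longleftrightarrow> finite U \<and> finite V
         \<and> (\<forall>u\<in>U. \<forall>v\<in>V. 0 \<le> PUV u v) \<and> (\<Sum>u\<in>U. \<Sum>v\<in>V. PUV u v) = 1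
         \<and> (\<forall>v\<in>V. (\<forall>x. 0 \<le> K v x) \<and> (\<Sum>x\<in>UNIV. K v x) = 1)
         \<and> (\<Sum>u\<in>U. \<Sum>v\<in>V. \<Sum>x\<in>UNIV. PUV u v * K v x * C x) \<le> b"

text \<open>Polymorphic in the auxiliary letters, because achievability is also applied to option
  types in which a fresh symbol has been adjoined.\<close>

definition secrecy_gain ::
  "('x::finite \<Rightarrow> ('y::finite \<times> 'z::finite) pmf) \<Rightarrow> 'u set \<Rightarrow> 'v set \<Rightarrow> ('u \<Rightarrow> 'v \<Rightarrow> real)
    \<Rightarrow> ('v \<Rightarrow> 'x \<Rightarrow> real) \<Rightarrow> real" where
  "secrecy_gain W U V PUV K =
     cond_mutual_info U V UNIV (\<lambda>u v y. \<Sum>x\<in>UNIV. PUV u v * K v x * chY W x y)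
   - cond_mutual_info U V UNIV (\<lambda>u v z. \<Sum>x\<in>UNIV. PUV u v * K v x * chZ W x z)"

lemma Cbar_eq:
  "Cbar W C b = Sup {secrecy_gain W U V PUV K | (U :: nat set) (V :: nat set) PUV K.
     Cbar_witness C b U V PUV K}"
  unfolding Cbar_def Cbar_witness_def secrecy_gain_def ..

lemma sum_stochastic_mult:
  fixes T :: "'x \<Rightarrow> 'y \<Rightarrow> real"
  assumes "\<And>x. x \<in> X \<Longrightarrow> (\<Sum>y\<in>Y. T x y) = 1"
  shows "(\<Sum>y\<in>Y. \<Sum>x\<in>X. k x * T x y) = (\<Sum>x\<in>X. k x)"
  using assms by (subst sum.swap) (simp add: sum_distrib_left[symmetric])

lemma secrecy_gain_le:
  fixes W :: "'x::finite \<Rightarrow> ('y::finite \<times> 'z::finite) pmf"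
  assumes "Cbar_witness C b U V PUV K"
  shows "secrecy_gain W U V PUV K \<le> CARD('y) / ln 2"
proof -
  have w: "finite V" "\<And>u v. u \<in> U \<Longrightarrow> v \<in> V \<Longrightarrow> 0 \<le> PUV u v" "(\<Sum>u\<in>U. \<Sum>v\<in>V. PUV u v) = 1"
    "\<And>v x. v \<in> V \<Longrightarrow> 0 \<le> K v x" "\<And>v. v \<in> V \<Longrightarrow> (\<Sum>x\<in>UNIV. K v x) = 1"
    using assms by (auto simp: Cbar_witness_def)
  have 1: "(\<Sum>y\<in>UNIV. \<Sum>x\<in>UNIV. PUV u v * K v x * chY W x y) = PUV u v" if "v \<in> V" for u v
    using that w(5) by (simp add: sum_stochastic_mult sum_distrib_left[symmetric])
  have "cond_mutual_info U V UNIV (\<lambda>u v y. \<Sum>x\<in>UNIV. PUV u v * K v x * chY W x y)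
    \<le> real CARD('y) * (\<Sum>u\<in>U. \<Sum>v\<in>V. \<Sum>y\<in>UNIV. \<Sum>x\<in>UNIV. PUV u v * K v x * chY W x y) / ln 2"
    using w by (intro cond_mutual_info_le sum_nonneg) auto
  also have "\<dots> = CARD('y) / ln 2"
    using w by (simp add: 1)
  moreover have "0 \<le> cond_mutual_info U V UNIV (\<lambda>u v z. \<Sum>x\<in>UNIV. PUV u v * K v x * chZ W x z)"
    using w by (intro cond_mutual_info_nonneg sum_nonneg) auto
  ultimately show ?thesis unfolding secrecy_gain_def by linarith
qed

lemma secrecy_gain_le_Cbar:
  fixes U :: "nat set" and V :: "nat set"
  assumes "Cbar_witness C b U V PUV K"
  shows "secrecy_gain W U V PUV K \<le> Cbar W C b"
  unfolding Cbar_eq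
proof (rule cSup_upper)
  show "bdd_above {secrecy_gain W U V PUV K |(U :: nat set) (V :: nat set) PUV K. Cbar_witness C b U V PUV K}"
    by (rule bdd_aboveI[of _ "CARD('b) / ln 2"]) (auto intro: secrecy_gain_le)
qed (use assms in blast)

text \<open>Any joint weight on \<open>(u, m, x)\<close> of admissible cost becomes a competitor:
  \<open>V\<close> is the pair \<open>(u, m)\<close>, \<open>K\<close> the conditional law of
  \<open>x\<close> given it, and both alphabets are numbered injectively.\<close>

lemma gain_le_Cbar:
  fixes a :: "'u \<Rightarrow> 'm \<Rightarrow> 'x::finite \<Rightarrow> real" and W :: "'x \<Rightarrow> ('y::finite \<times> 'z::finite) pmf"
  assumes fin: "finite U" "finite A"
    and nn: "\<And>u m x. u \<in> U \<Longrightarrow> m \<in> A \<Longrightarrow> 0 \<le> a u m x"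
    and sum1: "(\<Sum>u\<in>U. \<Sum>m\<in>A. \<Sum>x\<in>UNIV. a u m x) = 1"
    and cost: "(\<Sum>u\<in>U. \<Sum>m\<in>A. \<Sum>x\<in>UNIV. a u m x * C x) \<le> b"
  shows "cond_mutual_info U A UNIV (\<lambda>u m y. \<Sum>x\<in>UNIV. a u m x * chY W x y)
       - cond_mutual_info U A UNIV (\<lambda>u m z. \<Sum>x\<in>UNIV. a u m x * chZ W x z) \<le> Cbar W C b"
proof -
  obtain eu :: "'u \<Rightarrow> nat" where eu: "inj_on eu U"
    using finite_imp_inj_to_nat_seg[OF fin(1)] by blast
  obtain ev :: "'u \<times> 'm \<Rightarrow> nat" where ev: "inj_on ev (U \<times> A)"
    using finite_imp_inj_to_nat_seg[of "U \<times> A"] fin by blast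
  define du where "du = inv_into U eu"
  define dv where "dv = inv_into (U \<times> A) ev"
  have du: "du (eu u) = u" if "u \<in> U" for u using eu that by (simp add: du_def)
  have dv: "dv (ev v) = v" if "v \<in> U \<times> A" for v using ev that by (simp add: dv_def)
  have beu: "bij_betw eu U (eu ` U)" and bev: "bij_betw ev (U \<times> A) (ev ` (U \<times> A))"
    using eu ev by (auto simp: bij_betw_def)
  define S where "S u m = (\<Sum>x\<in>UNIV. a u m x)" for u m
  define PUV where "PUV u v = (if fst (dv v) = du u then S (du u) (snd (dv v)) else 0)" for u v
  \<comment> \<open>On pairs of weight zero the conditional law is undefined. The uniform law keeps
    \<open>K\<close> stochastic there, and the factor \<open>PUV\<close> annihilates the
    choice.\<close>
  define K where "K v x = (case dv v of (u, m) \<Rightarrow>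
      if S u m = 0 then 1 / CARD('x) else a u m x / S u m)" for v x
  have S0: "0 \<le> S u m" if "u \<in> U" "m \<in> A" for u m
    using that nn by (simp add: S_def sum_nonneg)
  have joint: "PUV (eu u) (ev v) * K (ev v) x = (if fst v = u then a u (snd v) x else 0)"
    if "u \<in> U" "v \<in> U \<times> A" for u v x
  proof -
    have "a u (snd v) x = 0" if "S u (snd v) = 0"
      using that \<open>u \<in> U\<close> \<open>v \<in> U \<times> A\<close> nn by (auto simp: S_def sum_nonneg_eq_0_iff)
    then show ?thesis
      using that by (auto simp: PUV_def K_def du dv split: prod.splits)
  qed
  have slice: "(\<Sum>v\<in>U \<times> A. \<Sum>x\<in>UNIV. PUV (eu u) (ev v) * K (ev v) x * c x)
     = (\<Sum>m\<in>A. \<Sum>x\<in>UNIV. a u m x * c x)" if "u \<in> U" for u and c :: "'x \<Rightarrow> real"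
    using that fin by (simp add: joint sum_slice cong: sum.cong)
  have K1: "(\<Sum>x\<in>UNIV. K v x) = 1" if v_in: "v \<in> ev ` (U \<times> A)" for v
  proof -
    obtain u m where v: "v = ev (u, m)" "(u, m) \<in> U \<times> A" using v_in by blast
    show ?thesis
    proof (cases "S u m = 0")
      case False
      then show ?thesis
        using v by (simp add: K_def dv sum_divide_distrib[symmetric]) (simp add: S_def)
    qed (use v in \<open>simp add: K_def dv\<close>)
  qed
  have sum_slice': "(\<Sum>u\<in>eu ` U. \<Sum>v\<in>ev ` (U \<times> A). \<Sum>x\<in>UNIV. PUV u v * K v x * c x)
      = (\<Sum>u\<in>U. \<Sum>m\<in>A. \<Sum>x\<in>UNIV. a u m x * c x)" for c :: "'x \<Rightarrow> real"
    by (simp add: sum.reindex[OF eu] sum.reindex[OF ev] slice)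
  have "Cbar_witness C b (eu ` U) (ev ` (U \<times> A)) PUV K"
    unfolding Cbar_witness_def
  proof (intro conjI ballI allI)
    show "(\<Sum>u\<in>eu ` U. \<Sum>v\<in>ev ` (U \<times> A). PUV u v) = 1"
      using sum_slice'[of "\<lambda>_. 1"] K1 sum1 by (simp add: sum_distrib_left[symmetric])
    show "(\<Sum>u\<in>eu ` U. \<Sum>v\<in>ev ` (U \<times> A). \<Sum>x\<in>UNIV. PUV u v * K v x * C x) \<le> b"
      using sum_slice'[of C] cost by simp
  qed (use fin S0 nn K1 in \<open>auto simp: PUV_def K_def du dv\<close>)
  then have 1: "secrecy_gain W (eu ` U) (ev ` (U \<times> A)) PUV K \<le> Cbar W C b"
    by (rule secrecy_gain_le_Cbar)
  have 2: "cond_mutual_info (eu ` U) (ev ` (U \<times> A)) UNIV (\<lambda>u v y. \<Sum>x\<in>UNIV. PUV u v * K v x * T x y)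
      = cond_mutual_info U A UNIV (\<lambda>u m y. \<Sum>x\<in>UNIV. a u m x * T x y)" for T :: "'x \<Rightarrow> 'c::finite \<Rightarrow> real"
  proof -
    have "cond_mutual_info (eu ` U) (ev ` (U \<times> A)) UNIV (\<lambda>u v y. \<Sum>x\<in>UNIV. PUV u v * K v x * T x y)
      = cond_mutual_info U (U \<times> A) UNIV (\<lambda>u v y. \<Sum>x\<in>UNIV. PUV (eu u) (ev v) * K (ev v) x * T x y)"
      by (rule cond_mutual_info_reindex[OF beu bev])
    also have "\<dots> = cond_mutual_info U (U \<times> A) UNIV
        (\<lambda>u v y. if fst v = u then \<Sum>x\<in>UNIV. a u (snd v) x * T x y else 0)"
      by (intro cond_mutual_info_cong) (simp add: joint)
    also have "\<dots> = cond_mutual_info U A UNIV (\<lambda>u m y. \<Sum>x\<in>UNIV. a u m x * T x y)"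
      by (rule cond_mutual_info_slice[OF fin])
    finally show ?thesis .
  qed
  show ?thesis using 1 by (simp add: secrecy_gain_def 2)
qed

lemma bij_betw_snoc:
  "bij_betw (\<lambda>((ys, zs), y). (ys @ [y], zs)) ((seqs i \<times> S) \<times> UNIV) (seqs (Suc i) \<times> S)"
proof (rule bij_betw_byWitness[where f' = "\<lambda>(ys, zs). ((butlast ys, zs), last ys)"])
  show "\<forall>a'\<in>seqs (Suc i) \<times> S. (\<lambda>((ys, zs), y). (ys @ [y], zs)) ((\<lambda>(ys, zs). ((butlast ys, zs), last ys)) a') = a'"
    by (auto simp: seqs_def) (metis append_butlast_last_id length_0_conv nat.distinct(1))
qed (auto simp: seqs_def)

lemma bij_betw_Cons:
  "bij_betw (\<lambda>((ys, zs), z). (ys, z # zs)) ((S \<times> seqs j) \<times> UNIV) (S \<times> seqs (Suc j))"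
proof (rule bij_betw_byWitness[where f' = "\<lambda>(ys, zs). ((ys, tl zs), hd zs)"])
  show "\<forall>a'\<in>S \<times> seqs (Suc j). (\<lambda>((ys, zs), z). (ys, z # zs)) ((\<lambda>(ys, zs). ((ys, tl zs), hd zs)) a') = a'"
    by (auto simp: seqs_def length_Suc_conv)
qed (auto simp: seqs_def)

text \<open>The informations that the message shares with the hybrid outputs
  \<open>(Y\<^sub>1,\<dots>,Y\<^sub>i,Z\<^sub>i\<^sub>+\<^sub>1,\<dots>,Z\<^sub>n)\<close> telescope, which replaces the Csiszar sum identity.\<close>

lemma info_difference_le_Cbar:
  fixes w :: "'m \<Rightarrow> 'x::finite list \<Rightarrow> real" and W :: "'x \<Rightarrow> ('y::finite \<times> 'z::finite) pmf"
  assumes M: "finite M" and n: "0 < n"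
    and nn: "\<And>m xs. m \<in> M \<Longrightarrow> xs \<in> seqs n \<Longrightarrow> 0 \<le> w m xs"
    and sum1: "(\<Sum>m\<in>M. \<Sum>xs\<in>seqs n. w m xs) = 1"
    and cost: "(\<Sum>m\<in>M. \<Sum>xs\<in>seqs n. w m xs * cost_n C xs) \<le> b"
  shows "mutual_info M (seqs n) (\<lambda>m ys. \<Sum>xs\<in>seqs n. w m xs * prodch (chY W) xs ys)
       - mutual_info M (seqs n) (\<lambda>m zs. \<Sum>xs\<in>seqs n. w m xs * prodch (chZ W) xs zs)
       \<le> real n * Cbar W C b"
proof -
  define hyb where "hyb i m ys zs = (\<Sum>xs\<in>seqs n. w m xs *
      (prodch (chY W) (take i xs) ys * prodch (chZ W) (drop i xs) zs))" for i m ys zs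
  define J where "J i = mutual_info M (seqs i \<times> seqs (n - i)) (\<lambda>m (ys, zs). hyb i m ys zs)" for i
  \<comment> \<open>Coordinate \<open>i\<close>, counted from 0, is left out: \<open>s\<close> holds
    the first \<open>i\<close> legitimate outputs and the last \<open>n - Suc i\<close> eavesdropper
    outputs, on which both neighbouring hybrids agree.\<close>
  define S :: "nat \<Rightarrow> ('y list \<times> 'z list) set" where "S i = seqs i \<times> seqs (n - Suc i)" for i
  define e where "e i s m xs = w m xs * (prodch (chY W) (take i xs) (fst s) *
      prodch (chZ W) (drop (Suc i) xs) (snd s))" for i s m xs
  \<comment> \<open>The missing output depends on the input word only through its letter at
    \<open>i\<close>, so words are grouped by that letter.\<close>
  define a where "a i s m x = (\<Sum>xs | xs \<in> seqs n \<and> xs ! i = x. e i s m xs)" for i s m x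
  have a_mult: "(\<Sum>x\<in>UNIV. a i s m x * k x) = (\<Sum>xs\<in>seqs n. e i s m xs * k (xs ! i))"
    for i s m and k :: "'x \<Rightarrow> real"
  proof -
    have "(\<Sum>x\<in>UNIV. a i s m x * k x)
        = (\<Sum>x\<in>UNIV. \<Sum>xs | xs \<in> seqs n \<and> xs ! i = x. e i s m xs * k (xs ! i))"
      unfolding a_def sum_distrib_right by (intro sum.cong) auto
    also have "\<dots> = (\<Sum>xs\<in>seqs n. e i s m xs * k (xs ! i))"
      by (rule sum.group) auto
    finally show ?thesis .
  qed
  have e_nn: "0 \<le> e i s m xs" if "m \<in> M" "xs \<in> seqs n" for i s m xs
    unfolding e_def using nn that by (intro mult_nonneg_nonneg prodch_nonneg) auto
  have a_nn: "0 \<le> a i s m x" if "m \<in> M" for i s m x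
    unfolding a_def using e_nn that by (intro sum_nonneg) auto
  have finS: "finite (S i)" for i by (simp add: S_def)
  have cm_nn: "0 \<le> (\<Sum>x\<in>UNIV. a i s m x * T x y)"
    if "m \<in> M" "\<And>x y. 0 \<le> T x y" for i s m y and T :: "'x \<Rightarrow> 'c \<Rightarrow> real"
    using that a_nn by (intro sum_nonneg mult_nonneg_nonneg) auto
  \<comment> \<open>Either hybrid consists of \<open>s\<close> and one more output at coordinate
    \<open>i\<close>, produced by \<open>chY\<close> or by \<open>chZ\<close>. The chain rule splits
    off the same information between message and \<open>s\<close>, which cancels.\<close>
  have step: "J (Suc i) - J i
      = cond_mutual_info (S i) M UNIV (\<lambda>s m y. \<Sum>x\<in>UNIV. a i s m x * chY W x y)
      - cond_mutual_info (S i) M UNIV (\<lambda>s m z. \<Sum>x\<in>UNIV. a i s m x * chZ W x z)"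
    if i: "i < n" for i
  proof -
    have ni: "n - i = Suc (n - Suc i)" using i by simp
    have Y: "hyb (Suc i) m (ys @ [y]) zs = (\<Sum>x\<in>UNIV. a i (ys, zs) m x * chY W x y)"
      if "ys \<in> seqs i" for m ys zs y
      unfolding hyb_def a_mult e_def
      by (intro sum.cong refl) (use that i in \<open>auto simp: seqs_def take_Suc_conv_app_nth prodch_append\<close>)
    have Z: "hyb i m ys (z # zs) = (\<Sum>x\<in>UNIV. a i (ys, zs) m x * chZ W x z)" for m ys zs z
      unfolding hyb_def a_mult e_def
      by (intro sum.cong refl) (use i in \<open>auto simp: seqs_def Cons_nth_drop_Suc[symmetric]\<close>)
    have "J (Suc i) = mutual_info M (S i \<times> UNIV) (\<lambda>m ((ys, zs), y). hyb (Suc i) m (ys @ [y]) zs)"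
      unfolding J_def S_def
      by (subst mutual_info_reindex[OF bij_betw_snoc]) (simp add: case_prod_unfold)
    also have "\<dots> = mutual_info M (S i \<times> UNIV) (\<lambda>m (s, y). \<Sum>x\<in>UNIV. a i s m x * chY W x y)"
      by (intro mutual_info_cong) (auto simp: S_def Y)
    also have "\<dots> = mutual_info M (S i) (\<lambda>m s. \<Sum>y\<in>UNIV. \<Sum>x\<in>UNIV. a i s m x * chY W x y)
        + cond_mutual_info (S i) M UNIV (\<lambda>s m y. \<Sum>x\<in>UNIV. a i s m x * chY W x y)"
      using M finS by (intro mutual_info_chain) (auto intro!: cm_nn)
    finally have 1: "J (Suc i) = mutual_info M (S i) (\<lambda>m s. \<Sum>x\<in>UNIV. a i s m x)
        + cond_mutual_info (S i) M UNIV (\<lambda>s m y. \<Sum>x\<in>UNIV. a i s m x * chY W x y)"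
      by (simp add: sum_stochastic_mult)
    have "J i = mutual_info M (S i \<times> UNIV) (\<lambda>m ((ys, zs), z). hyb i m ys (z # zs))"
      unfolding J_def S_def ni
      by (subst mutual_info_reindex[OF bij_betw_Cons]) (simp add: case_prod_unfold)
    also have "\<dots> = mutual_info M (S i \<times> UNIV) (\<lambda>m (s, z). \<Sum>x\<in>UNIV. a i s m x * chZ W x z)"
      by (intro mutual_info_cong) (auto simp: S_def Z)
    also have "\<dots> = mutual_info M (S i) (\<lambda>m s. \<Sum>z\<in>UNIV. \<Sum>x\<in>UNIV. a i s m x * chZ W x z)
        + cond_mutual_info (S i) M UNIV (\<lambda>s m z. \<Sum>x\<in>UNIV. a i s m x * chZ W x z)"
      using M finS by (intro mutual_info_chain) (auto intro!: cm_nn)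
    finally have 2: "J i = mutual_info M (S i) (\<lambda>m s. \<Sum>x\<in>UNIV. a i s m x)
        + cond_mutual_info (S i) M UNIV (\<lambda>s m z. \<Sum>x\<in>UNIV. a i s m x * chZ W x z)"
      by (simp add: sum_stochastic_mult)
    show ?thesis using 1 2 by simp
  qed
  have Jn: "J n = mutual_info M (seqs n) (\<lambda>m ys. \<Sum>xs\<in>seqs n. w m xs * prodch (chY W) xs ys)"
  proof -
    have "bij_betw (\<lambda>ys. (ys, [])) (seqs n :: 'y list set) (seqs n \<times> (seqs 0 :: 'z list set))"
      by (rule bij_betw_byWitness[where f' = fst]) (auto simp: seqs_def)
    note reindex = mutual_info_reindex[OF this]
    have "J n = mutual_info M (seqs n) (\<lambda>m ys. hyb n m ys [])"
      unfolding J_def by (simp add: reindex)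
    also have "\<dots> = mutual_info M (seqs n) (\<lambda>m ys. \<Sum>xs\<in>seqs n. w m xs * prodch (chY W) xs ys)"
      unfolding hyb_def by (intro mutual_info_cong sum.cong) (auto simp: seqs_def)
    finally show ?thesis .
  qed
  have J0: "J 0 = mutual_info M (seqs n) (\<lambda>m zs. \<Sum>xs\<in>seqs n. w m xs * prodch (chZ W) xs zs)"
  proof -
    have "bij_betw (\<lambda>zs. ([], zs)) (seqs n :: 'z list set) ((seqs 0 :: 'y list set) \<times> seqs n)"
      by (rule bij_betw_byWitness[where f' = snd]) (auto simp: seqs_def)
    note reindex = mutual_info_reindex[OF this]
    have "J 0 = mutual_info M (seqs n) (\<lambda>m zs. hyb 0 m [] zs)"
      unfolding J_def by (simp add: reindex)
    also have "\<dots> = mutual_info M (seqs n) (\<lambda>m zs. \<Sum>xs\<in>seqs n. w m xs * prodch (chZ W) xs zs)"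
      unfolding hyb_def by (intro mutual_info_cong sum.cong) auto
    finally show ?thesis .
  qed
  \<comment> \<open>The conditioning variable is a time index together with its side outputs; the
    uniform law of the index is the factor \<open>1 / real n\<close> in \<open>aa\<close>.\<close>
  define U where "U = Sigma {..<n} S"
  define aa where "aa u m x = 1 / real n * a (fst u) (snd u) m x" for u m x
  have finU: "finite U" using finS by (auto simp: U_def)
  have info: "cond_mutual_info U M UNIV (\<lambda>u m y. \<Sum>x\<in>UNIV. aa u m x * T x y)
     = 1 / real n * (\<Sum>i<n. cond_mutual_info (S i) M UNIV (\<lambda>s m y. \<Sum>x\<in>UNIV. a i s m x * T x y))"
    for T :: "'x \<Rightarrow> 'c::finite \<Rightarrow> real"
  proof -
    have "cond_mutual_info U M UNIV (\<lambda>u m y. \<Sum>x\<in>UNIV. aa u m x * T x y)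
      = cond_mutual_info U M UNIV (\<lambda>u m y. 1 / real n * (\<Sum>x\<in>UNIV. a (fst u) (snd u) m x * T x y))"
      by (simp add: aa_def sum_distrib_left mult.assoc)
    also have "\<dots> = 1 / real n * cond_mutual_info U M UNIV (\<lambda>u m y. \<Sum>x\<in>UNIV. a (fst u) (snd u) m x * T x y)"
      using n by (intro cond_mutual_info_scale) simp
    also have "cond_mutual_info U M UNIV (\<lambda>u m y. \<Sum>x\<in>UNIV. a (fst u) (snd u) m x * T x y)
      = (\<Sum>i<n. cond_mutual_info (S i) M UNIV (\<lambda>s m y. \<Sum>x\<in>UNIV. a i s m x * T x y))"
      unfolding U_def using finS by (subst cond_mutual_info_Sigma) auto
    finally show ?thesis .
  qed
  have sum_e: "(\<Sum>s\<in>S i. e i s m xs) = w m xs" if "xs \<in> seqs n" "i < n" for i m xs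
  proof -
    have "(\<Sum>ys\<in>seqs i. prodch (chY W) (take i xs) ys) = 1"
      using that unfolding seqs_eq_words by (intro sum_prodch) (auto simp: words_def)
    moreover have "(\<Sum>zs\<in>seqs (n - Suc i). prodch (chZ W) (drop (Suc i) xs) zs) = 1"
      using that unfolding seqs_eq_words by (intro sum_prodch) (auto simp: words_def)
    ultimately show ?thesis
      unfolding S_def e_def
      by (simp add: sum.cartesian_product' sum_distrib_left[symmetric])
  qed
  \<comment> \<open>The side outputs sum to one, so a letter function has the mean of its average
    along the word. The choices 1 and \<open>C\<close> give total mass and cost.\<close>
  have sum_aa: "(\<Sum>u\<in>U. \<Sum>m\<in>M. \<Sum>x\<in>UNIV. aa u m x * k x)
      = (\<Sum>m\<in>M. \<Sum>xs\<in>seqs n. w m xs * ((\<Sum>i<n. k (xs ! i)) / n))" for k :: "'x \<Rightarrow> real"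
  proof -
    have "(\<Sum>u\<in>U. \<Sum>m\<in>M. \<Sum>x\<in>UNIV. aa u m x * k x)
       = 1 / n * (\<Sum>u\<in>U. \<Sum>m\<in>M. \<Sum>xs\<in>seqs n. e (fst u) (snd u) m xs * k (xs ! fst u))"
      unfolding aa_def by (simp add: mult.assoc sum_distrib_left[symmetric] a_mult
          sum_divide_distrib[symmetric])
    also have "(\<Sum>u\<in>U. \<Sum>m\<in>M. \<Sum>xs\<in>seqs n. e (fst u) (snd u) m xs * k (xs ! fst u))
       = (\<Sum>i<n. \<Sum>s\<in>S i. \<Sum>m\<in>M. \<Sum>xs\<in>seqs n. e i s m xs * k (xs ! i))"
      unfolding U_def using finS by (subst sum.Sigma) (auto simp: case_prod_unfold)
    also have "\<dots> = (\<Sum>i<n. \<Sum>m\<in>M. \<Sum>xs\<in>seqs n. \<Sum>s\<in>S i. e i s m xs * k (xs ! i))"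
      by (intro sum.cong refl, subst sum.swap, intro sum.cong refl, rule sum.swap)
    also have "\<dots> = (\<Sum>i<n. \<Sum>m\<in>M. \<Sum>xs\<in>seqs n. w m xs * k (xs ! i))"
      by (intro sum.cong refl) (simp add: sum_distrib_right[symmetric] sum_e)
    also have "\<dots> = (\<Sum>m\<in>M. \<Sum>xs\<in>seqs n. \<Sum>i<n. w m xs * k (xs ! i))"
      by (subst sum.swap, intro sum.cong refl, rule sum.swap)
    finally show ?thesis by (simp add: sum_distrib_left sum_divide_distrib mult.commute)
  qed
  have "cond_mutual_info U M UNIV (\<lambda>u m y. \<Sum>x\<in>UNIV. aa u m x * chY W x y)
      - cond_mutual_info U M UNIV (\<lambda>u m z. \<Sum>x\<in>UNIV. aa u m x * chZ W x z) \<le> Cbar W C b"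
  proof (rule gain_le_Cbar[OF finU M])
    show "0 \<le> aa u m x" if "m \<in> M" for u m x using a_nn[OF that] by (simp add: aa_def)
    show "(\<Sum>u\<in>U. \<Sum>m\<in>M. \<Sum>x\<in>UNIV. aa u m x) = 1"
      using sum_aa[of "\<lambda>_. 1"] sum1 n by simp
    have "cost_n C xs = (\<Sum>i<n. C (xs ! i)) / n" if "xs \<in> seqs n" for xs
      using that by (simp add: cost_n_def seqs_def sum_list_sum_nth atLeast0LessThan)
    then show "(\<Sum>u\<in>U. \<Sum>m\<in>M. \<Sum>x\<in>UNIV. aa u m x * C x) \<le> b"
      using cost unfolding sum_aa by (simp cong: sum.cong)
  qed
  moreover have "J n - J 0 = (\<Sum>i<n. J (Suc i) - J i)"
    by (simp add: sum_lessThan_telescope)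
  ultimately have "(J n - J 0) / n \<le> Cbar W C b"
    by (simp add: info step sum_subtractf diff_divide_distrib)
  then show ?thesis using n by (simp add: Jn J0 field_simps)
qed

section \<open>Converse: Fano bound\<close>

lemma max_err_ge:
  fixes W :: "'x::finite \<Rightarrow> ('y::finite \<times> 'z::finite) pmf"
  assumes "m \<in> msgs n R"
  shows "(\<Sum>xs\<in>seqs n. f m xs * (\<Sum>ys\<in>{ys\<in>seqs n. g ys \<noteq> m}. prodch (chY W) xs ys)) \<le> max_err W n R f g"
  unfolding max_err_def using assms by (intro Max_ge) auto

text \<open>Gibbs' inequality against the guessed posterior that puts mass \<open>1/2\<close> on the decoded message
  and spreads the rest uniformly.\<close>

lemma fano:
  fixes p :: "'m \<Rightarrow> 'y \<Rightarrow> real"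
  assumes fin: "finite M" "finite Y" and M0: "M \<noteq> {}"
    and nn: "\<And>m y. m \<in> M \<Longrightarrow> y \<in> Y \<Longrightarrow> 0 \<le> p m y"
    and unif: "\<And>m. m \<in> M \<Longrightarrow> (\<Sum>y\<in>Y. p m y) = 1 / card M"
    and g: "\<And>y. y \<in> Y \<Longrightarrow> g y \<in> M"
    and err: "(\<Sum>m\<in>M. \<Sum>y | y \<in> Y \<and> g y \<noteq> m. p m y) \<le> e"
  shows "(1 - e) * log 2 (card M) - 1 \<le> mutual_info M Y p"
proof -
  define N where "N = real (card M)"
  have N: "1 \<le> N" using fin M0 by (simp add: N_def Suc_le_eq card_gt_0_iff)
  define Q where "Q m y = (of_bool (m = g y) + 1 / N) / 2" for m y
  define pY where "pY y = (\<Sum>m\<in>M. p m y)" for y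
  have pY0: "0 \<le> pY y" if "y \<in> Y" for y using nn that by (auto simp: pY_def intro: sum_nonneg)
  have Q0: "0 < Q m y" for m y using N by (auto simp: Q_def intro: add_pos_pos)
  have Q1: "(\<Sum>m\<in>M. Q m y) = 1" if "y \<in> Y" for y
  proof -
    have "(\<Sum>m\<in>M. Q m y) = ((\<Sum>m\<in>M. of_bool (m = g y)) + (\<Sum>m\<in>M. 1 / N)) / 2"
      unfolding Q_def sum_divide_distrib[symmetric] sum.distrib ..
    also have "(\<Sum>m\<in>M. of_bool (m = g y)) = (1::real)"
      using g[OF that] fin by (simp add: of_bool_def)
    also have "(\<Sum>m\<in>M. 1 / N) = 1" using N by (simp add: N_def)
    finally show ?thesis by simp
  qed
  have tot: "(\<Sum>m\<in>M. \<Sum>y\<in>Y. p m y) = 1" using N by (simp add: unif N_def[symmetric])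
  have summand: "(p m y - pY y * Q m y) / ln 2 + p m y * (log 2 N * of_bool (g y = m) - 1)
      \<le> (if p m y = 0 then 0 else p m y * log 2 (p m y / ((\<Sum>b'\<in>Y. p m b') * (\<Sum>a'\<in>M. p a' y))))"
    if "m \<in> M" "y \<in> Y" for m y
  proof (cases "p m y = 0")
    case True
    then show ?thesis using Q0[of m y] pY0[OF that(2)] by (simp add: divide_nonpos_nonneg)
  next
    case False
    then have p: "0 < p m y" using nn that by force
    have "p m y \<le> pY y" unfolding pY_def
      using that nn fin by (intro member_le_sum[where f = "\<lambda>m. p m y"]) auto
    then have pY: "0 < pY y" using p by simp
    have "(p m y - pY y * Q m y) / ln 2 \<le> p m y * log 2 (p m y / (pY y * Q m y))"
      using p pY Q0[of m y] by (intro gibbs_log2) auto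
    \<comment> \<open>\<open>N * Q m y\<close> is \<open>(N + 1) / 2\<close> at the decoded message
      and \<open>1 / 2\<close> elsewhere. Replacing the former by \<open>N / 2\<close> makes the
      loss one bit in both cases.\<close>
    moreover have "log 2 N * of_bool (g y = m) - 1 \<le> log 2 (N * Q m y)"
    proof -
      have "N * Q m y = (if m = g y then (N + 1) / 2 else 1 / 2)"
        using N by (auto simp: Q_def distrib_left)
      moreover have "2 powr (log 2 N * of_bool (g y = m) - 1) = (if m = g y then N / 2 else 1 / 2)"
        using N by (auto simp: powr_diff)
      ultimately have "2 powr (log 2 N * of_bool (g y = m) - 1) \<le> N * Q m y"
        by simp
      then have "log 2 (2 powr (log 2 N * of_bool (g y = m) - 1)) \<le> log 2 (N * Q m y)"
        using N Q0[of m y] by (subst log_le_cancel_iff) auto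
      then show ?thesis by simp
    qed
    then have "p m y * (log 2 N * of_bool (g y = m) - 1) \<le> p m y * log 2 (N * Q m y)"
      using p by (intro mult_left_mono) auto
    moreover have "p m y * log 2 (p m y / ((\<Sum>b'\<in>Y. p m b') * (\<Sum>a'\<in>M. p a' y)))
        = p m y * log 2 (p m y / (pY y * Q m y)) + p m y * log 2 (N * Q m y)"
      using p pY Q0[of m y] N that
      by (simp add: unif N_def[symmetric] pY_def[symmetric] log_mult_pos log_divide_pos algebra_simps)
    ultimately show ?thesis using False by (simp only: if_False)
  qed
  have "(\<Sum>m\<in>M. \<Sum>y\<in>Y. (p m y - pY y * Q m y) / ln 2 + p m y * (log 2 N * of_bool (g y = m) - 1))
      \<le> mutual_info M Y p"
    unfolding mutual_info_def by (intro sum_mono summand)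
  moreover have "(\<Sum>m\<in>M. \<Sum>y\<in>Y. (p m y - pY y * Q m y) / ln 2) = 0"
  proof -
    have "(\<Sum>m\<in>M. \<Sum>y\<in>Y. pY y * Q m y) = (\<Sum>y\<in>Y. \<Sum>m\<in>M. p m y)"
      by (subst sum.swap) (simp add: sum_distrib_left[symmetric] Q1 pY_def)
    also have "\<dots> = 1" using tot by (subst sum.swap)
    finally show ?thesis using tot by (simp add: sum_divide_distrib[symmetric] sum_subtractf)
  qed
  moreover have "(1 - e) * log 2 N - 1 \<le> (\<Sum>m\<in>M. \<Sum>y\<in>Y. p m y * (log 2 N * of_bool (g y = m) - 1))"
  proof -
    have "(\<Sum>y\<in>Y. p m y * of_bool (g y = m)) = (\<Sum>y\<in>Y. p m y) - (\<Sum>y | y \<in> Y \<and> g y \<noteq> m. p m y)" for m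
    proof -
      have "(\<Sum>y\<in>Y. p m y) = (\<Sum>y\<in>Y. p m y * of_bool (g y = m)) + (\<Sum>y\<in>Y. if g y \<noteq> m then p m y else 0)"
        by (subst sum.distrib[symmetric]) (intro sum.cong, auto)
      also have "(\<Sum>y\<in>Y. if g y \<noteq> m then p m y else 0) = (\<Sum>y | y \<in> Y \<and> g y \<noteq> m. p m y)"
        using fin by (simp add: sum.inter_filter)
      finally show ?thesis by simp
    qed
    then have "(\<Sum>m\<in>M. \<Sum>y\<in>Y. p m y * of_bool (g y = m)) = 1 - (\<Sum>m\<in>M. \<Sum>y | y \<in> Y \<and> g y \<noteq> m. p m y)"
      using tot by (simp add: sum_subtractf)
    then have "1 - e \<le> (\<Sum>m\<in>M. \<Sum>y\<in>Y. p m y * of_bool (g y = m))" using err by simp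
    then have "(1 - e) * log 2 N \<le> (\<Sum>m\<in>M. \<Sum>y\<in>Y. p m y * of_bool (g y = m)) * log 2 N"
      using N by (intro mult_right_mono) auto
    also have "\<dots> - 1 = (\<Sum>m\<in>M. \<Sum>y\<in>Y. p m y * (log 2 N * of_bool (g y = m) - 1))"
      using tot by (simp add: right_diff_distrib sum_subtractf sum_distrib_right
            mult.assoc mult.commute[of "log 2 N"])
    finally show ?thesis by simp
  qed
  ultimately show ?thesis by (simp add: sum.distrib N_def)
qed

text \<open>One subtracted bit is the rounding of the number of messages, the other the loss in the
  Fano bound. Under uniform messages the maximal error bounds the average error, and the per-message
  costs bound the average cost.\<close>

lemma rate_bound:
  fixes W :: "'x::finite \<Rightarrow> ('y::finite \<times> 'z::finite) pmf"
  assumes n: "0 < n" and R: "0 \<le> R" and code: "is_code C b n R f g"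
    and e: "max_err W n R f g \<le> e" "e \<le> 1"
  shows "(1 - e) * (real n * R - 1) - 1 \<le> real n * Cbar W C b + leak_str W n R f"
proof -
  let ?M = "msgs n R"
  define N where "N = real (card ?M)"
  have N: "0 < N" "2 powr (n * R) / 2 \<le> N"
    using card_msgs_bounds[OF R, of n] by (auto simp: N_def)
  define w where "w m xs = 1 / N * f m xs" for m xs
  have f: "\<And>m xs. m \<in> ?M \<Longrightarrow> xs \<in> seqs n \<Longrightarrow> 0 \<le> f m xs" "\<And>m. m \<in> ?M \<Longrightarrow> (\<Sum>xs\<in>seqs n. f m xs) = 1"
    "\<And>m. m \<in> ?M \<Longrightarrow> (\<Sum>xs\<in>seqs n. f m xs * cost_n C xs) \<le> b" "\<And>ys. ys \<in> seqs n \<Longrightarrow> g ys \<in> ?M"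
    using code by (auto simp: is_code_def)
  have w_sum: "(\<Sum>xs\<in>seqs n. w m xs * k xs) = 1 / N * (\<Sum>xs\<in>seqs n. f m xs * k xs)" for m k
    by (simp add: w_def sum_divide_distrib)
  have w0: "0 \<le> w m xs" if "m \<in> ?M" "xs \<in> seqs n" for m xs
    using f(1)[OF that] N by (simp add: w_def)
  define pY where "pY m ys = (\<Sum>xs\<in>seqs n. w m xs * prodch (chY W) xs ys)" for m ys
  have fano: "(1 - e) * log 2 (card ?M) - 1 \<le> mutual_info ?M (seqs n) pY"
  proof (rule fano)
    show "?M \<noteq> {}" using N by (auto simp: N_def)
    show "0 \<le> pY m ys" if "m \<in> ?M" for m ys
      unfolding pY_def using w0 that by (intro sum_nonneg mult_nonneg_nonneg prodch_nonneg) auto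
    have one: "(\<Sum>ys\<in>seqs n. prodch (chY W) xs ys) = 1" if "xs \<in> seqs n" for xs
      using that unfolding seqs_eq_words by (intro sum_prodch) (auto simp: words_def)
    show "(\<Sum>ys\<in>seqs n. pY m ys) = 1 / card ?M" if "m \<in> ?M" for m
      using f(2)[OF that] w_sum[of m "\<lambda>_. 1"] unfolding pY_def
      by (subst sum_stochastic_mult) (auto simp: one N_def)
    have "(\<Sum>y | y \<in> seqs n \<and> g y \<noteq> m. pY m y) \<le> 1 / N * e" if "m \<in> ?M" for m
    proof -
      have "(\<Sum>y | y \<in> seqs n \<and> g y \<noteq> m. pY m y)
         = (\<Sum>xs\<in>seqs n. w m xs * (\<Sum>ys\<in>{ys\<in>seqs n. g ys \<noteq> m}. prodch (chY W) xs ys))"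
        unfolding pY_def by (subst sum.swap) (simp add: sum_distrib_left)
      also have "\<dots> \<le> 1 / N * e"
        unfolding w_sum using max_err_ge[OF that, where f = f and g = g and W = W] e N by (intro mult_left_mono) auto
      finally show ?thesis .
    qed
    then have "(\<Sum>m\<in>?M. \<Sum>y | y \<in> seqs n \<and> g y \<noteq> m. pY m y) \<le> (\<Sum>m\<in>?M. 1 / N * e)"
      by (intro sum_mono)
    also have "\<dots> = e" using N by (auto simp: N_def)
    finally show "(\<Sum>m\<in>?M. \<Sum>y | y \<in> seqs n \<and> g y \<noteq> m. pY m y) \<le> e" .
  qed (use f in auto)
  have "mutual_info ?M (seqs n) (\<lambda>m ys. \<Sum>xs\<in>seqs n. w m xs * prodch (chY W) xs ys)
       - mutual_info ?M (seqs n) (\<lambda>m zs. \<Sum>xs\<in>seqs n. w m xs * prodch (chZ W) xs zs)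
       \<le> real n * Cbar W C b"
  proof (rule info_difference_le_Cbar[OF finite_msgs n w0])
    show "(\<Sum>m\<in>?M. \<Sum>xs\<in>seqs n. w m xs) = 1"
      using w_sum[of _ "\<lambda>_. 1"] f(2) N by (auto simp: N_def)
    have "(\<Sum>m\<in>?M. \<Sum>xs\<in>seqs n. w m xs * cost_n C xs) \<le> (\<Sum>m\<in>?M. 1 / N * b)"
      unfolding w_sum using f(3) N by (intro sum_mono mult_left_mono) auto
    also have "\<dots> = b" using N by (auto simp: N_def)
    finally show "(\<Sum>m\<in>?M. \<Sum>xs\<in>seqs n. w m xs * cost_n C xs) \<le> b" .
  qed
  moreover have "leak_str W n R f
      = mutual_info ?M (seqs n) (\<lambda>m zs. \<Sum>xs\<in>seqs n. w m xs * prodch (chZ W) xs zs)"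
    unfolding leak_str_def leak_def N_def[symmetric] w_sum ..
  moreover have "(1 - e) * (real n * R - 1) \<le> (1 - e) * log 2 (card ?M)"
  proof (rule mult_left_mono)
    have "log 2 (2 powr (n * R) / 2) \<le> log 2 N"
      using N by (subst log_le_cancel_iff) auto
    then show "real n * R - 1 \<le> log 2 (card ?M)" by (simp add: N_def log_divide_pos)
  qed (use e in simp)
  ultimately show ?thesis using fano unfolding pY_def by linarith
qed

lemma achievable_weak_le_Cbar:
  fixes W :: "'x::finite \<Rightarrow> ('y::finite \<times> 'z::finite) pmf"
  assumes R: "0 \<le> R" and ach: "achievable leak_weak W C b R"
  shows "R \<le> Cbar W C b"
proof (rule field_le_epsilon)
  fix d :: real assume d: "0 < d"
  \<comment> \<open>The losses per letter are \<open>e * R\<close> from the Fano factor,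
    \<open>e\<close> from the leakage and \<open>2 / n\<close>, which is below \<open>2 * e\<close>
    once \<open>n\<close> exceeds \<open>1 / e\<close>; together at most
    \<open>e * (R + 3)\<close>.\<close>
  define e where "e = min 1 (d / (R + 3))"
  have "e * (R + 3) \<le> d / (R + 3) * (R + 3)"
    using R by (intro mult_right_mono) (auto simp: e_def)
  then have e: "0 < e" "e \<le> 1" "e * (R + 3) \<le> d" using d R by (auto simp: e_def)
  obtain N where N: "\<And>n. n \<ge> N \<Longrightarrow> \<exists>f g. is_code C b n R f g
         \<and> max_err W n R f g \<le> e \<and> leak_weak W n R f \<le> e"
    using ach e unfolding achievable_def by blast
  obtain k :: nat where k: "1 / e < k" using reals_Archimedean2 by blast
  define n where "n = Suc (max N k)"
  have n: "0 < n" "N \<le> n" by (auto simp: n_def)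
  have "1 / e < n" using k by (simp add: n_def)
  then have n2: "1 < n * e" using e by (simp add: field_simps)
  obtain f g where fg: "is_code C b n R f g" "max_err W n R f g \<le> e" "leak_weak W n R f \<le> e"
    using N[OF n(2)] by blast
  have "leak_str W n R f \<le> n * e" using fg(3) n by (simp add: leak_weak_def field_simps)
  with rate_bound[OF n(1) R fg(1,2) e(2)]
  have "(1 - e) * (n * R - 1) - 1 \<le> n * Cbar W C b + n * e" by linarith
  moreover have "(1 - e) * (n * R - 1) - 1 \<ge> n * R - n * e * R - 2"
    using e by (simp add: algebra_simps)
  ultimately have "n * R \<le> n * Cbar W C b + n * e * R + n * e + 2" by linarith
  also have "\<dots> \<le> n * Cbar W C b + n * e * R + n * e + 2 * (n * e)" using n2 by linarith
  also have "\<dots> = n * (Cbar W C b + e * (R + 3))" by (simp add: algebra_simps)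
  finally have "R \<le> Cbar W C b + e * (R + 3)" using n by simp
  then show "R \<le> Cbar W C b + d" using e by linarith
qed

section \<open>One-shot random coding\<close>

text \<open>Subadditivity of the \<open>s\<close>-th power gives
  \<open>(1 + x) powr s \<le> 1 + x powr s\<close>, and \<open>ln (1 + t) \<le> t\<close> finishes.
  Unlike the logarithm, the power factors over letters.\<close>

lemma ln_one_plus_le_powr:
  fixes x s :: real
  assumes x: "0 \<le> x" and s: "0 < s" "s \<le> 1"
  shows "ln (1 + x) \<le> x powr s / s"
proof -
  have le: "t \<le> t powr s" if "0 \<le> t" "t \<le> 1" for t :: real
    using powr_mono'[of s 1 t] that s by simp
  \<comment> \<open>Both fractions lie between 0 and 1, where raising to a power
    \<open>s \<le> 1\<close> cannot decrease a number.\<close>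
  have "1 = 1 / (1 + x) + x / (1 + x)" using x by (simp add: field_simps)
  also have "\<dots> \<le> (1 / (1 + x)) powr s + (x / (1 + x)) powr s"
    using x by (intro add_mono le) auto
  also have "\<dots> = (1 + x powr s) / (1 + x) powr s"
    using x by (simp add: powr_divide add_divide_distrib)
  finally have "(1 + x) powr s \<le> 1 + x powr s" using x by (simp add: field_simps)
  then have "ln ((1 + x) powr s) \<le> ln (1 + x powr s)" using x by (subst ln_le_cancel_iff) (auto intro: add_pos_nonneg)
  also have "\<dots> \<le> x powr s" by (rule ln_add_one_self_le_self) simp
  finally have "s * ln (1 + x) \<le> x powr s" using x by (simp add: ln_powr)
  then show ?thesis using s by (simp add: field_simps)
qed


section \<open>Expectations over codebooks with independent codewords\<close>

definition code_avg :: "'i set \<Rightarrow> 'v set \<Rightarrow> ('v \<Rightarrow> real) \<Rightarrow> (('i \<Rightarrow> 'v) \<Rightarrow> real) \<Rightarrow> real" where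
  "code_avg I V q F = (\<Sum>c\<in>PiE I (\<lambda>_. V). (\<Prod>i\<in>I. q (c i)) * F c)"

lemma code_avg_add: "code_avg I V q (\<lambda>c. F c + G c) = code_avg I V q F + code_avg I V q G"
  and code_avg_diff: "code_avg I V q (\<lambda>c. F c - G c) = code_avg I V q F - code_avg I V q G"
  unfolding code_avg_def by (simp_all add: distrib_left right_diff_distrib sum.distrib sum_subtractf)

lemma code_avg_sum: "code_avg I V q (\<lambda>c. \<Sum>x\<in>X. H x c) = (\<Sum>x\<in>X. code_avg I V q (H x))"
  unfolding code_avg_def sum_distrib_left by (rule sum.swap)

text \<open>Each test function is absorbed into the factor of its own codeword; all other factors
  sum to 1.\<close>

lemma code_avg_pair:
  assumes fin: "finite I" "finite V" and q_sum: "(\<Sum>v\<in>V. q v) = 1"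
    and kl: "k \<in> I" "l \<in> I" "k \<noteq> l"
  shows "code_avg I V q (\<lambda>c. F (c k) * G (c l)) = (\<Sum>v\<in>V. q v * F v) * (\<Sum>v\<in>V. q v * G v)"
proof -
  define r where "r i v = q v * (if i = k then F v else if i = l then G v else 1)" for i v
  have F: "(\<Prod>i\<in>I. if i = k then f else if i = l then g else 1) = f * g" for f g :: real
  proof -
    have "(\<Prod>i\<in>I. if i = k then f else if i = l then g else 1)
        = (\<Prod>i\<in>I. (if i = k then f else 1) * (if i = l then g else 1))"
      using kl by (intro prod.cong) auto
    then show ?thesis using kl fin by (simp add: prod.distrib prod.delta)
  qed
  have "(\<Prod>i\<in>I. q (c i)) * (F (c k) * G (c l)) = (\<Prod>i\<in>I. r i (c i))" for c
  proof -
    have "(\<Prod>i\<in>I. r i (c i))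
        = (\<Prod>i\<in>I. q (c i) * (if i = k then F (c k) else if i = l then G (c l) else 1))"
      unfolding r_def by (intro prod.cong) auto
    then show ?thesis by (simp only: prod.distrib F)
  qed
  then have "code_avg I V q (\<lambda>c. F (c k) * G (c l)) = (\<Prod>i\<in>I. \<Sum>v\<in>V. r i v)"
    unfolding code_avg_def using fin by (simp add: prod_sum_PiE)
  also have "\<dots> = (\<Prod>i\<in>I. if i = k then \<Sum>v\<in>V. q v * F v else if i = l then \<Sum>v\<in>V. q v * G v else 1)"
    using q_sum kl by (intro prod.cong) (auto simp: r_def)
  finally show ?thesis by (simp add: F)
qed

lemma code_avg_single:
  assumes fin: "finite I" "finite V" and q_sum: "(\<Sum>v\<in>V. q v) = 1" and k: "k \<in> I"
  shows "code_avg I V q (\<lambda>c. F (c k)) = (\<Sum>v\<in>V. q v * F v)"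
proof -
  define r where "r i v = q v * (if i = k then F v else 1)" for i v
  have F: "(\<Prod>i\<in>I. if i = k then f else 1) = f" for f :: real
    using k fin by (simp add: prod.delta)
  have "(\<Prod>i\<in>I. q (c i)) * F (c k) = (\<Prod>i\<in>I. r i (c i))" for c
  proof -
    have "(\<Prod>i\<in>I. r i (c i)) = (\<Prod>i\<in>I. q (c i) * (if i = k then F (c k) else 1))"
      unfolding r_def by (intro prod.cong) auto
    then show ?thesis by (simp only: prod.distrib F)
  qed
  then have "code_avg I V q (\<lambda>c. F (c k)) = (\<Prod>i\<in>I. \<Sum>v\<in>V. r i v)"
    unfolding code_avg_def using fin by (simp add: prod_sum_PiE)
  also have "\<dots> = (\<Prod>i\<in>I. if i = k then \<Sum>v\<in>V. q v * F v else 1)"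
    using q_sum by (intro prod.cong) (auto simp: r_def)
  finally show ?thesis by (simp add: F)
qed

lemma code_avg_mono:
  assumes "\<And>v. v \<in> V \<Longrightarrow> 0 \<le> q v" "\<And>c. c \<in> PiE I (\<lambda>_. V) \<Longrightarrow> F c \<le> G c"
  shows "code_avg I V q F \<le> code_avg I V q G"
  unfolding code_avg_def using assms
  by (intro sum_mono mult_left_mono prod_nonneg) (auto simp: PiE_mem)

text \<open>The point found has positive weight as well; later this makes the conditional laws along
  the chosen \<open>u\<close>-word proper.\<close>

lemma weighted_average_exists:
  fixes w F :: "'a \<Rightarrow> real"
  assumes fin: "finite X" and w0: "\<And>x. x \<in> X \<Longrightarrow> 0 \<le> w x" and w1: "(\<Sum>x\<in>X. w x) = 1"
    and le: "(\<Sum>x\<in>X. w x * F x) \<le> B"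
  shows "\<exists>x\<in>X. 0 < w x \<and> F x \<le> B"
proof (rule ccontr)
  assume "\<not> ?thesis"
  then have gt: "B < F x" if "x \<in> X" "0 < w x" for x using that by force
  have nn: "0 \<le> w x * (F x - B)" if "x \<in> X" for x
    using w0[OF that] gt[OF that] by (cases "w x = 0") auto
  have "\<exists>x\<in>X. w x \<noteq> 0"
    using w1 by (metis sum.neutral zero_neq_one)
  then obtain x where x: "x \<in> X" "0 < w x" using w0 by force
  have "0 < (\<Sum>x\<in>X. w x * (F x - B))"
    using x gt[OF x] nn by (intro sum_pos2[OF fin x(1)]) auto
  also have "\<dots> = (\<Sum>x\<in>X. w x * F x) - B"
    using w1 by (simp add: right_diff_distrib sum_subtractf sum_distrib_right[symmetric])
  finally show False using le by simp
qed

lemma code_avg_exists: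
  assumes fin: "finite I" "finite V" and q_sum: "(\<Sum>v\<in>V. q v) = 1"
    and q0: "\<And>v. v \<in> V \<Longrightarrow> 0 \<le> q v" and le: "code_avg I V q F \<le> B"
  shows "\<exists>c\<in>PiE I (\<lambda>_. V). F c \<le> B"
proof -
  have "\<exists>c\<in>PiE I (\<lambda>_. V). 0 < (\<Prod>i\<in>I. q (c i)) \<and> F c \<le> B"
  proof (rule weighted_average_exists)
    show "(\<Sum>c\<in>PiE I (\<lambda>_. V). \<Prod>i\<in>I. q (c i)) = 1"
      using prod_sum_PiE[of I "\<lambda>_. V" "\<lambda>_. q"] fin q_sum by simp
    show "0 \<le> (\<Prod>i\<in>I. q (c i))" if "c \<in> PiE I (\<lambda>_. V)" for c
      using q0 that by (intro prod_nonneg) (auto simp: PiE_mem)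
  qed (use fin le in \<open>auto simp: code_avg_def intro: finite_PiE\<close>)
  then show ?thesis by blast
qed

text \<open>The logarithm is linearised by its tangent at \<open>1 + a\<close>, where \<open>a\<close> is the contribution of
  the codeword \<open>v\<close> itself and \<open>r\<close> that of the others, whose average is at most 1; only pairwise
  independence of the codewords is then needed.\<close>

lemma ln_tangent_powr:
  fixes a r s :: real
  assumes "0 < a" "0 \<le> r" "0 < s" "s \<le> 1"
  shows "ln (a + r) \<le> a powr s / s + (r - 1) / (1 + a)"
proof -
  have "ln ((a + r) / (1 + a)) \<le> (a + r) / (1 + a) - 1"
    using assms by (intro ln_le_minus_one) auto
  also have "\<dots> = (r - 1) / (1 + a)" using assms by (simp add: field_simps)
  finally have "ln (a + r) \<le> ln (1 + a) + (r - 1) / (1 + a)"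
    using assms by (simp add: ln_div)
  then show ?thesis using ln_one_plus_le_powr[of a s] assms by simp
qed

text \<open>The four terms bound, on average over the codebook, the probability that the transmitted
  codeword fails the threshold \<open>T\<close>, that another of the \<open>L J\<close> codewords passes it, the divergence at
  the eavesdropper, and the average of \<open>\<nu>\<close>.\<close>

definition code_bound ::
  "'v set \<Rightarrow> 'y set \<Rightarrow> 'z set \<Rightarrow> ('v \<Rightarrow> real) \<Rightarrow> ('v \<Rightarrow> 'y \<Rightarrow> real) \<Rightarrow> ('v \<Rightarrow> 'z \<Rightarrow> real) \<Rightarrow> ('v \<Rightarrow> real)
    \<Rightarrow> real \<Rightarrow> real \<Rightarrow> real \<Rightarrow> real \<Rightarrow> real" where
  "code_bound V Y Z q A B \<nu> s T L J =
     (\<Sum>v\<in>V. q v * (\<Sum>y\<in>Y. A v y * of_bool (A v y \<le> T * (\<Sum>v\<in>V. q v * A v y)))) + L * J / T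
     + (\<Sum>v\<in>V. q v * (\<Sum>z\<in>Z. B v z * (B v z / (\<Sum>v\<in>V. q v * B v z)) powr s)) / (s * J powr s)
     + (\<Sum>v\<in>V. q v * \<nu> v)"

text \<open>Expectation is linear, so error, divergence and \<open>\<nu>\<close> are averaged as one
  sum and a single codebook meets the bound on that sum. The decoder compares the likelihood of a
  codeword with the mean output law.\<close>

lemma random_coding:
  fixes q :: "'v \<Rightarrow> real" and A :: "'v \<Rightarrow> 'y \<Rightarrow> real" and B :: "'v \<Rightarrow> 'z \<Rightarrow> real"
    and L J :: nat
  assumes fin: "finite V" "finite Y" "finite Z" and q_sum: "(\<Sum>v\<in>V. q v) = 1"
    and q_pos: "\<And>v. v \<in> V \<Longrightarrow> 0 < q v"
    and A0: "\<And>v y. v \<in> V \<Longrightarrow> 0 \<le> A v y" and A1: "\<And>v. v \<in> V \<Longrightarrow> (\<Sum>y\<in>Y. A v y) = 1"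
    and B0: "\<And>v z. v \<in> V \<Longrightarrow> 0 \<le> B v z"
    and T: "0 < T" and s: "0 < s" "s \<le> 1" and J: "0 < J"
  shows "\<exists>c\<in>PiE ({..<L} \<times> {..<J}) (\<lambda>_. V). \<exists>\<phi>. (\<Sum>m<L. \<Sum>j<J.
      (\<Sum>y\<in>Y. A (c (m, j)) y * of_bool (\<phi> y \<noteq> m))
      + (\<Sum>z\<in>Z. B (c (m, j)) z * ln ((\<Sum>j<J. B (c (m, j)) z) / (J * (\<Sum>v\<in>V. q v * B v z))))
      + \<nu> (c (m, j)))
    \<le> L * J * code_bound V Y Z q A B \<nu> s T L J"
proof -
  define QY where "QY y = (\<Sum>v\<in>V. q v * A v y)" for y
  define QZ where "QZ z = (\<Sum>v\<in>V. q v * B v z)" for z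
  have QY0: "0 \<le> QY y" for y unfolding QY_def using q_pos A0 by (intro sum_nonneg mult_nonneg_nonneg) (auto simp: less_imp_le)
  have QZ0: "0 \<le> QZ z" for z unfolding QZ_def using q_pos B0 by (intro sum_nonneg mult_nonneg_nonneg) (auto simp: less_imp_le)
  have QZ_pos: "0 < QZ z" if "v \<in> V" "B v z \<noteq> 0" for v z
  proof -
    have "0 < q v * B v z" using that q_pos[of v] B0[of v z] by simp
    also have "\<dots> \<le> QZ z" unfolding QZ_def using that fin q_pos B0
      by (intro member_le_sum[where f = "\<lambda>v. q v * B v z"]) (auto simp: less_imp_le)
    finally show ?thesis .
  qed
  define I where "I = {..<L} \<times> {..<J}"
  have finI: "finite I" by (simp add: I_def)
  note avg_simps = code_avg_single[OF finI fin(1) q_sum] code_avg_pair[OF finI fin(1) q_sum]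
  define good where "good c y m \<longleftrightarrow> m < L \<and> (\<exists>j<J. T * QY y < A (c (m, j)) y)"
    for c :: "nat \<times> nat \<Rightarrow> 'v" and y m
  \<comment> \<open>If no message or several messages qualify the value is arbitrary; correctness is
    claimed only when exactly one qualifies.\<close>
  define \<phi> where "\<phi> c y = (SOME m. good c y m)" for c y
  \<comment> \<open>The union bound runs over all other codewords, including harmless ones of the
    same message, which keeps one index set for everything.\<close>
  define errb where "errb k c = (\<Sum>y\<in>Y. A (c k) y * of_bool (A (c k) y \<le> T * QY y))
      + (\<Sum>k'\<in>I - {k}. \<Sum>y\<in>Y. A (c k) y * of_bool (T * QY y < A (c k') y))"
    for k and c :: "nat \<times> nat \<Rightarrow> 'v"
  have err: "(\<Sum>y\<in>Y. A (c (m, j)) y * of_bool (\<phi> c y \<noteq> m)) \<le> errb (m, j) c"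
    if c: "c \<in> PiE I (\<lambda>_. V)" and mj: "m < L" "j < J" for c m j
  proof -
    let ?a = "\<lambda>y. A (c (m, j)) y"
    have cV: "c (m, j) \<in> V" using PiE_mem[OF c] mj by (auto simp: I_def)
    have "?a y * of_bool (\<phi> c y \<noteq> m) \<le> ?a y * of_bool (?a y \<le> T * QY y)
        + (\<Sum>k'\<in>I - {(m, j)}. ?a y * of_bool (T * QY y < A (c k') y))" for y
    proof (cases "?a y \<le> T * QY y \<or> (\<exists>k'\<in>I - {(m, j)}. T * QY y < A (c k') y)")
      case True
      then show ?thesis
      proof
        assume "\<exists>k'\<in>I - {(m, j)}. T * QY y < A (c k') y"
        then obtain k' where k': "k' \<in> I - {(m, j)}" "T * QY y < A (c k') y" by blast
        have "?a y * of_bool (T * QY y < A (c k') y)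
           \<le> (\<Sum>k'\<in>I - {(m, j)}. ?a y * of_bool (T * QY y < A (c k') y))"
          using k'(1) finI A0[OF cV]
          by (intro member_le_sum[where f = "\<lambda>k'. ?a y * of_bool (T * QY y < A (c k') y)"]) auto
        then show ?thesis using k'(2) A0[OF cV, of y] by (auto simp: of_bool_def)
      qed (use A0[OF cV, of y] in \<open>auto simp: of_bool_def intro!: add_increasing2 sum_nonneg\<close>)
    next
      case False
      then have "good c y m'  \<longleftrightarrow> m' = m" for m'
        using mj unfolding good_def I_def by (auto simp: not_le)
      then have "\<phi> c y = m" by (simp add: \<phi>_def)
      then show ?thesis using A0[OF cV, of y] by (auto intro!: add_nonneg_nonneg sum_nonneg)
    qed
    then have "(\<Sum>y\<in>Y. ?a y * of_bool (\<phi> c y \<noteq> m)) \<le> (\<Sum>y\<in>Y. ?a y * of_bool (?a y \<le> T * QY y)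
        + (\<Sum>k'\<in>I - {(m, j)}. ?a y * of_bool (T * QY y < A (c k') y)))"
      by (intro sum_mono)
    also have "\<dots> = errb (m, j) c"
      unfolding errb_def sum.distrib by (subst (2) sum.swap) simp
    finally show ?thesis .
  qed
  have avg_err: "code_avg I V q (errb k)
      \<le> (\<Sum>v\<in>V. q v * (\<Sum>y\<in>Y. A v y * of_bool (A v y \<le> T * QY y))) + L * J / T" if k: "k \<in> I" for k
  proof -
    \<comment> \<open>Change of measure: averaging over the transmitted codeword replaces its law by
      \<open>QY\<close>. Where the other codeword passes, \<open>QY y\<close> is below
      \<open>A v y / T\<close>, and \<open>A v\<close> sums to 1.\<close>
    have "code_avg I V q (\<lambda>c. \<Sum>y\<in>Y. A (c k) y * of_bool (T * QY y < A (c k') y)) \<le> 1 / T"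
      if k': "k' \<in> I - {k}" for k'
    proof -
      have "code_avg I V q (\<lambda>c. \<Sum>y\<in>Y. A (c k) y * of_bool (T * QY y < A (c k') y))
        = (\<Sum>y\<in>Y. QY y * (\<Sum>v\<in>V. q v * of_bool (T * QY y < A v y)))"
        unfolding code_avg_sum
      proof (intro sum.cong refl)
        fix y
        show "code_avg I V q (\<lambda>c. A (c k) y * of_bool (T * QY y < A (c k') y))
          = QY y * (\<Sum>v\<in>V. q v * of_bool (T * QY y < A v y))"
          using k k' avg_simps(2)[of k k' "\<lambda>v. A v y" "\<lambda>v. of_bool (T * QY y < A v y)"]
          unfolding QY_def[of y, symmetric] by auto
      qed
      also have "\<dots> = (\<Sum>y\<in>Y. \<Sum>v\<in>V. q v * (QY y * of_bool (T * QY y < A v y)))"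
        by (simp add: sum_distrib_left mult_ac)
      also have "\<dots> \<le> (\<Sum>y\<in>Y. \<Sum>v\<in>V. q v * (A v y / T))"
      proof (intro sum_mono mult_left_mono)
        fix y v assume v: "v \<in> V"
        show "QY y * of_bool (T * QY y < A v y) \<le> A v y / T"
          using T A0[OF v, of y] by (auto simp: of_bool_def field_simps)
      qed (use q_pos in \<open>auto simp: less_imp_le\<close>)
      also have "\<dots> = (\<Sum>v\<in>V. q v * (\<Sum>y\<in>Y. A v y)) / T"
        by (subst sum.swap) (simp add: sum_distrib_left sum_divide_distrib)
      also have "\<dots> = 1 / T" using A1 q_sum by simp
      finally show ?thesis .
    qed
    then have "(\<Sum>k'\<in>I - {k}. code_avg I V q (\<lambda>c. \<Sum>y\<in>Y. A (c k) y * of_bool (T * QY y < A (c k') y)))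
        \<le> (\<Sum>k'\<in>I - {k}. 1 / T)" by (rule sum_mono)
    also have "\<dots> \<le> (\<Sum>k'\<in>I. 1 / T)" using T finI by (intro sum_mono2) auto
    also have "\<dots> = L * J / T" by (simp add: I_def)
    finally show ?thesis
      unfolding errb_def code_avg_add code_avg_sum[of _ _ _ _ "I - {k}"]
      using avg_simps(1)[OF k, of "\<lambda>v. \<Sum>y\<in>Y. A v y * of_bool (A v y \<le> T * QY y)"] by linarith
  qed
  \<comment> \<open>The coefficient of the linear term in the tangent bound. It depends on the
    transmitted codeword only, so its average against any other codeword factors.\<close>
  define h where "h z v = B v z / (1 + B v z / (J * QZ z))" for z v
  define divb where "divb m j c = (\<Sum>z\<in>Z. B (c (m, j)) z * ((B (c (m, j)) z / QZ z) powr s / (s * J powr s)))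
      + (\<Sum>z\<in>Z. (\<Sum>j'\<in>{..<J} - {j}. h z (c (m, j)) * (B (c (m, j')) z / (J * QZ z))) - h z (c (m, j)))"
    for m j and c :: "nat \<times> nat \<Rightarrow> 'v"
  have div: "(\<Sum>z\<in>Z. B (c (m, j)) z * ln ((\<Sum>j<J. B (c (m, j)) z) / (J * QZ z))) \<le> divb m j c"
    if c: "c \<in> PiE I (\<lambda>_. V)" and mj: "m < L" "j < J" for c m j
    unfolding divb_def sum.distrib[symmetric]
  proof (rule sum_mono)
    fix z
    have cV: "c (m, j') \<in> V" if "j' < J" for j' using PiE_mem[OF c] mj that by (auto simp: I_def)
    let ?B = "B (c (m, j)) z"
    show "?B * ln ((\<Sum>j<J. B (c (m, j)) z) / (J * QZ z)) \<le> ?B * ((?B / QZ z) powr s / (s * J powr s))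
       + ((\<Sum>j'\<in>{..<J} - {j}. h z (c (m, j)) * (B (c (m, j')) z / (J * QZ z))) - h z (c (m, j)))"
    proof (cases "?B = 0")
      case False
      then have pos: "0 < ?B" "0 < QZ z" using B0[OF cV[OF mj(2)], of z] QZ_pos[OF cV[OF mj(2)]] by auto
      define a where "a = ?B / (J * QZ z)"
      define r where "r = (\<Sum>j'\<in>{..<J} - {j}. B (c (m, j')) z / (J * QZ z))"
      have a: "0 < a" using pos J by (simp add: a_def)
      have r: "0 \<le> r" using pos cV B0 by (auto simp: r_def intro!: sum_nonneg)
      have "(\<Sum>j<J. B (c (m, j)) z) / (J * QZ z) = a + r"
        using mj(2) unfolding a_def r_def sum_divide_distrib[symmetric] add_divide_distrib[symmetric]
        by (subst sum.remove[of "{..<J}" j]) auto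
      then have "?B * ln ((\<Sum>j<J. B (c (m, j)) z) / (J * QZ z)) \<le> ?B * (a powr s / s + (r - 1) / (1 + a))"
        using pos ln_tangent_powr[OF a r s] by (simp add: mult_left_mono)
      also have "\<dots> = ?B * (a powr s / s) + (?B / (1 + a) * r - ?B / (1 + a))"
        by (simp add: algebra_simps diff_divide_distrib)
      also have "a powr s / s = (?B / QZ z) powr s / (s * J powr s)"
      proof -
        have "a = (?B / QZ z) / J" by (simp add: a_def)
        then have "a powr s = (?B / QZ z) powr s / J powr s"
          using pos by (simp only: powr_divide divide_nonneg_nonneg less_imp_le of_nat_0_le_iff)
        then show ?thesis by simp
      qed
      also have "?B / (1 + a) = h z (c (m, j))" by (simp add: h_def a_def)
      finally show ?thesis by (simp only: r_def sum_distrib_left)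
    qed (simp add: h_def)
  qed
  have avg_div: "code_avg I V q (divb m j)
     \<le> (\<Sum>v\<in>V. q v * (\<Sum>z\<in>Z. B v z * (B v z / QZ z) powr s)) / (s * J powr s)"
    if mj: "m < L" "j < J" for m j
  proof -
    have mjI: "(m, j') \<in> I" if "j' < J" for j' using mj that by (simp add: I_def)
    have "code_avg I V q (\<lambda>c. \<Sum>z\<in>Z. B (c (m, j)) z * ((B (c (m, j)) z / QZ z) powr s / (s * J powr s)))
       = (\<Sum>v\<in>V. q v * (\<Sum>z\<in>Z. B v z * ((B v z / QZ z) powr s / (s * J powr s))))"
      using mjI[OF mj(2)] by (rule avg_simps(1))
    also have "\<dots> = (\<Sum>v\<in>V. q v * (\<Sum>z\<in>Z. B v z * (B v z / QZ z) powr s)) / (s * J powr s)"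
      by (simp add: sum_divide_distrib sum_distrib_left)
    \<comment> \<open>Each other codeword contributes at most \<open>1 / J\<close> on average and
      there are fewer than \<open>J\<close> of them, so the linear term of the tangent bound
      averages to at most zero.\<close>
    moreover have "code_avg I V q (\<lambda>c. \<Sum>z\<in>Z. (\<Sum>j'\<in>{..<J} - {j}. h z (c (m, j)) *
        (B (c (m, j')) z / (J * QZ z))) - h z (c (m, j))) \<le> 0"
      unfolding code_avg_sum code_avg_diff
    proof (rule sum_nonpos)
      fix z
      define H where "H = (\<Sum>v\<in>V. q v * h z v)"
      have H0: "0 \<le> H" unfolding H_def h_def using q_pos B0 QZ0
        by (intro sum_nonneg mult_nonneg_nonneg divide_nonneg_nonneg add_nonneg_nonneg) (auto simp: less_imp_le)
      have "code_avg I V q (\<lambda>c. h z (c (m, j)) * (B (c (m, j')) z / (J * QZ z))) \<le> H * (1 / J)"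
        if j': "j' \<in> {..<J} - {j}" for j'
      proof -
        have "code_avg I V q (\<lambda>c. h z (c (m, j)) * (B (c (m, j')) z / (J * QZ z)))
          = H * (\<Sum>v\<in>V. q v * (B v z / (J * QZ z)))"
          using mjI mj j' unfolding H_def by (intro avg_simps(2)) auto
        also have "(\<Sum>v\<in>V. q v * (B v z / (J * QZ z))) = QZ z / (J * QZ z)"
          by (simp add: QZ_def sum_divide_distrib)
        also have "\<dots> \<le> 1 / J" by simp
        finally show ?thesis using H0 by (simp add: mult_left_mono)
      qed
      then have "(\<Sum>j'\<in>{..<J} - {j}. code_avg I V q (\<lambda>c. h z (c (m, j)) * (B (c (m, j')) z / (J * QZ z))))
          \<le> (\<Sum>j'\<in>{..<J} - {j}. H * (1 / J))" by (rule sum_mono)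
      also have "\<dots> \<le> (\<Sum>j'\<in>{..<J}. H * (1 / J))" using H0 by (intro sum_mono2) auto
      also have "\<dots> = H" using J by simp
      also have "H = code_avg I V q (\<lambda>c. h z (c (m, j)))"
        unfolding H_def using mjI[OF mj(2)] by (simp add: avg_simps(1))
      finally show "(\<Sum>j'\<in>{..<J} - {j}. code_avg I V q (\<lambda>c. h z (c (m, j)) * (B (c (m, j')) z / (J * QZ z))))
         - code_avg I V q (\<lambda>c. h z (c (m, j))) \<le> 0" by simp
    qed
    ultimately show ?thesis unfolding divb_def code_avg_add by linarith
  qed
  let ?F = "\<lambda>c. \<Sum>m<L. \<Sum>j<J. (\<Sum>y\<in>Y. A (c (m, j)) y * of_bool (\<phi> c y \<noteq> m))
      + (\<Sum>z\<in>Z. B (c (m, j)) z * ln ((\<Sum>j<J. B (c (m, j)) z) / (J * QZ z))) + \<nu> (c (m, j))"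
  have "code_avg I V q ?F \<le> code_avg I V q (\<lambda>c. \<Sum>m<L. \<Sum>j<J. errb (m, j) c + divb m j c + \<nu> (c (m, j)))"
    using q_pos err div by (intro code_avg_mono sum_mono add_mono) (auto simp: less_imp_le)
  also have "\<dots> = (\<Sum>m<L. \<Sum>j<J. code_avg I V q (errb (m, j)) + code_avg I V q (divb m j)
      + code_avg I V q (\<lambda>c. \<nu> (c (m, j))))"
    by (simp only: code_avg_sum code_avg_add)
  also have "\<dots> \<le> (\<Sum>m<L. \<Sum>j<J. code_bound V Y Z q A B \<nu> s T L J)"
    unfolding code_bound_def QY_def[symmetric] QZ_def[symmetric]
  proof (intro sum_mono add_mono)
    fix m j assume mj: "m \<in> {..<L}" "j \<in> {..<J}"
    then have I: "(m, j) \<in> I" by (simp add: I_def)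
    show "code_avg I V q (\<lambda>c. \<nu> (c (m, j))) \<le> (\<Sum>v\<in>V. q v * \<nu> v)"
      using avg_simps(1)[OF I, of \<nu>] by simp
    show "code_avg I V q (errb (m, j))
      \<le> (\<Sum>v\<in>V. q v * (\<Sum>y\<in>Y. A v y * of_bool (A v y \<le> T * QY y))) + real L * real J / T"
      using avg_err[OF I] by simp
    show "code_avg I V q (divb m j)
     \<le> (\<Sum>v\<in>V. q v * (\<Sum>z\<in>Z. B v z * (B v z / QZ z) powr s)) / (s * J powr s)"
      using mj by (intro avg_div) auto
  qed
  also have "\<dots> = L * J * code_bound V Y Z q A B \<nu> s T L J" by simp
  finally have "code_avg I V q ?F \<le> L * J * code_bound V Y Z q A B \<nu> s T L J" .
  from code_avg_exists[OF finI fin(1) q_sum _ this]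
  obtain c where "c \<in> PiE I (\<lambda>_. V)" "?F c \<le> L * J * code_bound V Y Z q A B \<nu> s T L J"
    using q_pos less_imp_le by blast
  then show ?thesis unfolding QZ_def I_def by blast
qed

text \<open>Markov's inequality: more than \<open>N\<close> values above \<open>2 * \<beta>\<close>
  would already exceed the total.\<close>

lemma expurgate:
  fixes F :: "nat \<Rightarrow> real" and \<beta> :: real
  assumes nn: "\<And>m. m < 2 * N \<Longrightarrow> 0 \<le> F m" and le: "(\<Sum>m<2 * N. F m) \<le> 2 * N * \<beta>"
  shows "\<exists>S. S \<subseteq> {..<2 * N} \<and> card S = N \<and> (\<forall>m\<in>S. F m \<le> 2 * \<beta>)"
proof -
  define bad where "bad = {m. m < 2 * N \<and> 2 * \<beta> < F m}"
  have finb: "finite bad" by (simp add: bad_def)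
  have "card bad \<le> N"
  proof (rule ccontr)
    assume N: "\<not> card bad \<le> N"
    then have ne: "bad \<noteq> {}" by auto
    have "0 \<le> (\<Sum>m<2 * N. F m)" using nn by (intro sum_nonneg) simp
    then have "0 \<le> 2 * N * \<beta>" using le by linarith
    have "2 * N * \<beta> \<le> card bad * (2 * \<beta>)"
    \<comment> \<open>For \<open>N = 0\<close> nothing fixes the sign of \<open>\<beta>\<close>, but
      then there is no index that could be bad.\<close>
    proof (cases "N = 0")
      case True
      then show ?thesis using ne by (auto simp: bad_def)
    next
      case False
      then have "0 \<le> \<beta>" using \<open>0 \<le> 2 * N * \<beta>\<close> by (simp add: zero_le_mult_iff)
      then show ?thesis using N by (simp add: mult_mono)
    qed
    also have "\<dots> = (\<Sum>m\<in>bad. 2 * \<beta>)" by simp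
    also have "\<dots> < (\<Sum>m\<in>bad. F m)" using finb ne by (intro sum_strict_mono) (auto simp: bad_def)
    also have "\<dots> \<le> (\<Sum>m<2 * N. F m)" using nn by (intro sum_mono2) (auto simp: bad_def)
    finally show False using le by simp
  qed
  then have "N \<le> card ({..<2 * N} - bad)"
    using finb by (subst card_Diff_subset) (auto simp: bad_def)
  then obtain S where "S \<subseteq> {..<2 * N} - bad" "card S = N"
    by (meson obtain_subset_with_card_n)
  then show ?thesis by (intro exI[of _ S]) (auto simp: bad_def not_less)
qed

text \<open>The codebook starts with twice as many messages, and expurgation acts on the sum of
  error, divergence and \<open>\<nu>\<close>-average. All three are nonnegative, the divergence by
  Gibbs' inequality, so the bound on the sum yields three separate ones.\<close>

lemma wiretap_code_exists:
  fixes q :: "'v \<Rightarrow> real" and A :: "'v \<Rightarrow> 'y \<Rightarrow> real" and B :: "'v \<Rightarrow> 'z \<Rightarrow> real"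
    and J :: nat and M :: "'m set"
  assumes fin: "finite V" "finite Y" "finite Z" "finite M" and M: "M \<noteq> {}"
    and q_sum: "(\<Sum>v\<in>V. q v) = 1" and q_pos: "\<And>v. v \<in> V \<Longrightarrow> 0 < q v"
    and A0: "\<And>v y. v \<in> V \<Longrightarrow> 0 \<le> A v y" and A1: "\<And>v. v \<in> V \<Longrightarrow> (\<Sum>y\<in>Y. A v y) = 1"
    and B0: "\<And>v z. v \<in> V \<Longrightarrow> 0 \<le> B v z" and B1: "\<And>v. v \<in> V \<Longrightarrow> (\<Sum>z\<in>Z. B v z) = 1"
    and \<nu>0: "\<And>v. v \<in> V \<Longrightarrow> 0 \<le> \<nu> v"
    and T: "0 < T" and s: "0 < s" "s \<le> 1" and J: "0 < J"
    and bound: "code_bound V Y Z q A B \<nu> s T (2 * card M) J \<le> \<beta>"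
  shows "\<exists>c g. (\<forall>m\<in>M. \<forall>j<J. c m j \<in> V) \<and> (\<forall>y. g y \<in> M) \<and> (\<forall>m\<in>M.
      (\<Sum>j<J. \<Sum>y\<in>Y. A (c m j) y * of_bool (g y \<noteq> m)) / J \<le> 2 * \<beta>
      \<and> (\<Sum>z\<in>Z. (\<Sum>j<J. B (c m j) z) / J * ln ((\<Sum>j<J. B (c m j) z) / J / (\<Sum>v\<in>V. q v * B v z))) \<le> 2 * \<beta>
      \<and> (\<Sum>j<J. \<nu> (c m j)) / J \<le> 2 * \<beta>)"
proof -
  define N where "N = card M"
  define QZ where "QZ z = (\<Sum>v\<in>V. q v * B v z)" for z
  have "\<exists>c\<in>PiE ({..<2 * N} \<times> {..<J}) (\<lambda>_. V). \<exists>\<phi>.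
      (\<Sum>m<2 * N. \<Sum>j<J. (\<Sum>y\<in>Y. A (c (m, j)) y * of_bool (\<phi> y \<noteq> m))
      + (\<Sum>z\<in>Z. B (c (m, j)) z * ln ((\<Sum>j<J. B (c (m, j)) z) / (J * QZ z)))
      + \<nu> (c (m, j)))
    \<le> real (2 * N * J) * code_bound V Y Z q A B \<nu> s T (real (2 * N)) J"
    unfolding QZ_def by (rule random_coding) (use fin q_sum q_pos A0 A1 B0 T s J in auto)
  then obtain c0 \<phi> where c0: "c0 \<in> PiE ({..<2 * N} \<times> {..<J}) (\<lambda>_. V)"
    and le: "(\<Sum>m<2 * N. \<Sum>j<J. (\<Sum>y\<in>Y. A (c0 (m, j)) y * of_bool (\<phi> y \<noteq> m))
      + (\<Sum>z\<in>Z. B (c0 (m, j)) z * ln ((\<Sum>j<J. B (c0 (m, j)) z) / (J * QZ z)))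
      + \<nu> (c0 (m, j)))
    \<le> real (2 * N * J) * code_bound V Y Z q A B \<nu> s T (real (2 * N)) J"
    by blast
  define E where "E m = (\<Sum>j<J. \<Sum>y\<in>Y. A (c0 (m, j)) y * of_bool (\<phi> y \<noteq> m)) / J" for m
  define P where "P m z = (\<Sum>j<J. B (c0 (m, j)) z) / J" for m z
  define D where "D m = (\<Sum>z\<in>Z. P m z * ln (P m z / QZ z))" for m
  define G where "G m = (\<Sum>j<J. \<nu> (c0 (m, j))) / J" for m
  have cV: "c0 (m, j) \<in> V" if "m < 2 * N" "j < J" for m j
    using PiE_mem[OF c0] that by auto
  have E0: "0 \<le> E m" if "m < 2 * N" for m
    unfolding E_def using cV that A0 by (intro divide_nonneg_nonneg sum_nonneg mult_nonneg_nonneg) auto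
  have G0: "0 \<le> G m" if "m < 2 * N" for m
    unfolding G_def using cV that \<nu>0 by (intro divide_nonneg_nonneg sum_nonneg) auto
  have QZ0: "0 \<le> QZ z" for z
    unfolding QZ_def using q_pos B0 by (intro sum_nonneg mult_nonneg_nonneg) (auto simp: less_imp_le)
  have D0: "0 \<le> D m" if m: "m < 2 * N" for m
  proof -
    have P0: "0 \<le> P m z" for z
      unfolding P_def using cV m B0 by (intro divide_nonneg_nonneg sum_nonneg) auto
    have "QZ z \<noteq> 0" if "P m z \<noteq> 0" for z
    proof
      assume "QZ z = 0"
      then have "q v * B v z = 0" if "v \<in> V" for v
        using that fin q_pos B0 unfolding QZ_def
        by (subst (asm) sum_nonneg_eq_0_iff) (auto simp: less_imp_le)
      then have "B v z = 0" if "v \<in> V" for v using that q_pos[OF that] by force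
      then have "P m z = 0" using cV m by (simp add: P_def)
      then show False using that by simp
    qed
    then have "(\<Sum>z\<in>Z. P m z - QZ z) \<le> D m"
      unfolding D_def using P0 QZ0 by (intro sum_mono gibbs_ln) auto
    moreover have "(\<Sum>z\<in>Z. P m z) = 1"
      unfolding P_def sum_divide_distrib[symmetric]
      using cV m B1 J by (subst sum.swap) (simp add: lessThan_def)
    moreover have "(\<Sum>z\<in>Z. QZ z) = 1"
      unfolding QZ_def using B1 q_sum by (subst sum_stochastic_mult) auto
    ultimately show ?thesis by (simp add: sum_subtractf)
  qed
  have "(\<Sum>m<2 * N. E m + D m + G m) * J
     = (\<Sum>m<2 * N. \<Sum>j<J. (\<Sum>y\<in>Y. A (c0 (m, j)) y * of_bool (\<phi> y \<noteq> m))
      + (\<Sum>z\<in>Z. B (c0 (m, j)) z * ln ((\<Sum>j<J. B (c0 (m, j)) z) / (J * QZ z)))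
      + \<nu> (c0 (m, j)))"
    unfolding sum_distrib_right
  proof (intro sum.cong refl)
    fix m
    have "D m * J = (\<Sum>z\<in>Z. (\<Sum>j<J. B (c0 (m, j)) z) * ln ((\<Sum>j<J. B (c0 (m, j)) z) / (J * QZ z)))"
      unfolding D_def sum_distrib_right[of _ Z]
    proof (rule sum.cong[OF refl])
      fix z
      have "P m z * J = (\<Sum>j<J. B (c0 (m, j)) z)" using J by (simp add: P_def)
      moreover have "P m z / QZ z = (\<Sum>j<J. B (c0 (m, j)) z) / (J * QZ z)" by (simp add: P_def)
      ultimately show "P m z * ln (P m z / QZ z) * J
          = (\<Sum>j<J. B (c0 (m, j)) z) * ln ((\<Sum>j<J. B (c0 (m, j)) z) / (J * QZ z))"
        by (metis mult.assoc mult.commute)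
    qed
    also have "\<dots> = (\<Sum>j<J. \<Sum>z\<in>Z. B (c0 (m, j)) z * ln ((\<Sum>j<J. B (c0 (m, j)) z) / (J * QZ z)))"
      unfolding sum_distrib_right by (rule sum.swap)
    finally show "(E m + D m + G m) * J = (\<Sum>j<J. (\<Sum>y\<in>Y. A (c0 (m, j)) y * of_bool (\<phi> y \<noteq> m))
      + (\<Sum>z\<in>Z. B (c0 (m, j)) z * ln ((\<Sum>j<J. B (c0 (m, j)) z) / (J * QZ z)))
      + \<nu> (c0 (m, j)))"
      using J by (simp add: distrib_right sum.distrib E_def G_def)
  qed
  also have "\<dots> \<le> real (2 * N) * J * \<beta>"
    using le bound by (elim order_trans) (auto intro!: mult_left_mono simp: N_def)
  finally have "(\<Sum>m<2 * N. E m + D m + G m) \<le> 2 * N * \<beta>" using J by (simp add: mult_ac)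
  with expurgate[of N "\<lambda>m. E m + D m + G m" \<beta>] E0 D0 G0
  obtain S where S: "S \<subseteq> {..<2 * N}" "card S = N" "\<And>m. m \<in> S \<Longrightarrow> E m + D m + G m \<le> 2 * \<beta>"
    by (auto simp: add_nonneg_nonneg)
  have "finite S" using S(1) finite_subset by blast
  then obtain h where h: "bij_betw h M S"
    using S(2) fin(4) unfolding N_def by (metis finite_same_card_bij)
  define m0 where "m0 = (SOME m. m \<in> M)"
  have m0: "m0 \<in> M" using M by (auto simp: m0_def some_in_eq)
  \<comment> \<open>Survivors are relabelled by \<open>M\<close>, and outputs decoded to a discarded
    index get the default \<open>m0\<close>. This creates no new errors: if the old decoder returns
    the index of \<open>m\<close>, then \<open>g\<close> returns \<open>m\<close>.\<close>
  define g where "g y = (if \<phi> y \<in> S then inv_into M h (\<phi> y) else m0)" for y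
  have g: "g y \<in> M" for y
    using m0 bij_betw_imp_surj_on[OF h] by (auto simp: g_def inv_into_into)
  have g_err: "\<phi> y \<noteq> h m" if "g y \<noteq> m" "m \<in> M" for y m
    using that h by (auto simp: g_def bij_betw_def)
  show ?thesis
  proof (intro exI[of _ "\<lambda>m j. c0 (h m, j)"] exI[of _ g] conjI allI impI ballI g)
    fix m assume m: "m \<in> M"
    then have hS: "h m \<in> S" using h by (auto simp: bij_betw_def)
    then have hm: "h m < 2 * N" using S(1) by auto
    have le: "E (h m) \<le> 2 * \<beta>" "D (h m) \<le> 2 * \<beta>" "G (h m) \<le> 2 * \<beta>"
      using S(3)[OF hS] E0[OF hm] D0[OF hm] G0[OF hm] by linarith+
    show "c0 (h m, j) \<in> V" if "j < J" for j using cV hm that by blast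
    have "(\<Sum>j<J. \<Sum>y\<in>Y. A (c0 (h m, j)) y * of_bool (g y \<noteq> m)) / J \<le> E (h m)"
      unfolding E_def using g_err[OF _ m] A0 cV[OF hm]
      by (intro divide_right_mono sum_mono mult_left_mono) (auto simp: of_bool_def)
    then show "(\<Sum>j<J. \<Sum>y\<in>Y. A (c0 (h m, j)) y * of_bool (g y \<noteq> m)) / J \<le> 2 * \<beta>"
      using le by simp
    show "(\<Sum>z\<in>Z. (\<Sum>j<J. B (c0 (h m, j)) z) / J * ln ((\<Sum>j<J. B (c0 (h m, j)) z) / J
        / (\<Sum>v\<in>V. q v * B v z))) \<le> 2 * \<beta>"
      using le(2) unfolding D_def P_def QZ_def .
    show "(\<Sum>j<J. \<nu> (c0 (h m, j))) / J \<le> 2 * \<beta>" using le(3) unfolding G_def .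
  qed
qed

section \<open>Exponential bounds\<close>

text \<open>At 0 the exponential moment equals 1 and its derivative is the mean, which is negative,
  so the moment drops below 1 just to the right. The cap \<open>s \<le> 1\<close> is what the power
  bound on the logarithm asks for.\<close>

lemma chernoff_base:
  fixes w h :: "'a \<Rightarrow> real"
  assumes w1: "(\<Sum>x\<in>X. w x) = 1" and neg: "(\<Sum>x\<in>X. w x * h x) < 0"
  shows "\<exists>s. 0 < s \<and> s \<le> 1 \<and> (\<Sum>x\<in>X. w x * exp (s * h x)) < 1"
proof -
  have "((\<lambda>s. \<Sum>x\<in>X. w x * exp (s * h x)) has_real_derivative (\<Sum>x\<in>X. w x * (exp (0 * h x) * h x))) (at 0)"
    by (auto intro!: derivative_eq_intros simp: mult.commute)
  then have "((\<lambda>s. \<Sum>x\<in>X. w x * exp (s * h x)) has_real_derivative (\<Sum>x\<in>X. w x * h x)) (at 0)"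
    by simp
  from DERIV_neg_dec_right[OF this neg] obtain d where d: "0 < d"
    "\<And>s. 0 < s \<Longrightarrow> s < d \<Longrightarrow> (\<Sum>x\<in>X. w x * exp (s * h x)) < 1"
    using w1 by auto
  show ?thesis
    by (rule exI[of _ "min (d / 2) 1"]) (use d(1) d(2)[of "min (d / 2) 1"] in auto)
qed

text \<open>The output law given \<open>u\<close>. By the convention on division by zero it vanishes
  identically for \<open>u\<close> of weight zero.\<close>

definition out_dist :: "'v set \<Rightarrow> ('u \<Rightarrow> 'v \<Rightarrow> real) \<Rightarrow> ('v \<Rightarrow> 'y \<Rightarrow> real) \<Rightarrow> 'u \<Rightarrow> 'y \<Rightarrow> real" where
  "out_dist V PUV A u y = (\<Sum>v\<in>V. PUV u v / (\<Sum>v\<in>V. PUV u v) * A v y)"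

context
  fixes U :: "'u set" and V :: "'v set" and Y :: "'y set"
    and PUV :: "'u \<Rightarrow> 'v \<Rightarrow> real" and A :: "'v \<Rightarrow> 'y \<Rightarrow> real"
  assumes fin: "finite U" "finite V" "finite Y"
    and P0: "\<And>u v. u \<in> U \<Longrightarrow> v \<in> V \<Longrightarrow> 0 \<le> PUV u v"
    and A0: "\<And>v y. v \<in> V \<Longrightarrow> 0 \<le> A v y"
    and A1: "\<And>v. v \<in> V \<Longrightarrow> (\<Sum>y\<in>Y. A v y) = 1"
begin

lemma out_dist_pos:
  assumes uv: "u \<in> U" "v \<in> V" and p: "PUV u v * A v y \<noteq> 0"
  shows "0 < PUV u v" "0 < A v y" "0 < (\<Sum>v\<in>V. PUV u v)" "0 < out_dist V PUV A u y"
proof -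
  show pos: "0 < PUV u v" "0 < A v y"
    using p P0[OF uv] A0[OF uv(2), of y] by (auto simp: less_le)
  have "PUV u v \<le> (\<Sum>v\<in>V. PUV u v)"
    using uv fin P0 by (intro member_le_sum[where f = "PUV u"]) auto
  then show Pu: "0 < (\<Sum>v\<in>V. PUV u v)" using pos by linarith
  have "0 < PUV u v / (\<Sum>v\<in>V. PUV u v) * A v y" using pos Pu by simp
  also have "\<dots> \<le> out_dist V PUV A u y"
    unfolding out_dist_def using uv fin P0 A0 Pu
    by (intro member_le_sum[where f = "\<lambda>v. PUV u v / (\<Sum>v\<in>V. PUV u v) * A v y"]) auto
  finally show "0 < out_dist V PUV A u y" .
qed

text \<open>This is the mean of the information density, the log-ratio of the output laws given
  \<open>v\<close> and given \<open>u\<close>.\<close>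

lemma cond_mutual_info_kernel:
  "cond_mutual_info U V Y (\<lambda>u v y. PUV u v * A v y)
    = (\<Sum>u\<in>U. \<Sum>v\<in>V. \<Sum>y\<in>Y. PUV u v * A v y * log 2 (A v y / out_dist V PUV A u y))"
  unfolding cond_mutual_info_def
proof (intro sum.cong refl)
  fix u v y assume uv: "u \<in> U" "v \<in> V"
  have 1: "(\<Sum>a\<in>V. \<Sum>b\<in>Y. PUV u a * A a b) = (\<Sum>v\<in>V. PUV u v)"
    using A1 by (simp add: sum_distrib_left[symmetric])
  have 2: "(\<Sum>b\<in>Y. PUV u v * A v b) = PUV u v"
    using A1 uv by (simp add: sum_distrib_left[symmetric])
  have 3: "(\<Sum>a\<in>V. PUV u a * A a y) = out_dist V PUV A u y * (\<Sum>v\<in>V. PUV u v)" if "(\<Sum>v\<in>V. PUV u v) \<noteq> 0"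
    using that by (simp add: out_dist_def sum_distrib_right)
  show "(if PUV u v * A v y = 0 then 0 else PUV u v * A v y * log 2 (PUV u v * A v y *
      (\<Sum>a\<in>V. \<Sum>b\<in>Y. PUV u a * A a b) / ((\<Sum>b\<in>Y. PUV u v * A v b) * (\<Sum>a\<in>V. PUV u a * A a y))))
      = PUV u v * A v y * log 2 (A v y / out_dist V PUV A u y)"
    using out_dist_pos[OF uv, of y] by (auto simp: 1 2 3)
qed

lemma chernoff_triple:
  assumes tot: "(\<Sum>u\<in>U. \<Sum>v\<in>V. PUV u v) = 1"
    and neg: "(\<Sum>u\<in>U. \<Sum>v\<in>V. \<Sum>y\<in>Y. PUV u v * A v y * h u v y) < 0"
  shows "\<exists>s. 0 < s \<and> s \<le> 1 \<and> (\<Sum>u\<in>U. \<Sum>v\<in>V. \<Sum>y\<in>Y. PUV u v * A v y * exp (s * h u v y)) < 1"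
proof -
  have s: "(\<Sum>(u, v, y)\<in>U \<times> V \<times> Y. f u v y) = (\<Sum>u\<in>U. \<Sum>v\<in>V. \<Sum>y\<in>Y. f u v y)"
    for f :: "'u \<Rightarrow> 'v \<Rightarrow> 'y \<Rightarrow> real"
    by (simp add: sum.cartesian_product)
  have "\<exists>s. 0 < s \<and> s \<le> 1 \<and> (\<Sum>x\<in>U \<times> V \<times> Y. (case x of (u, v, y) \<Rightarrow> PUV u v * A v y) *
      exp (s * (case x of (u, v, y) \<Rightarrow> h u v y))) < 1"
  proof (rule chernoff_base)
    show "(\<Sum>(u, v, y)\<in>U \<times> V \<times> Y. PUV u v * A v y) = 1"
      unfolding s using tot A1 by (simp add: sum_distrib_left[symmetric])
    show "(\<Sum>x\<in>U \<times> V \<times> Y. (case x of (u, v, y) \<Rightarrow> PUV u v * A v y) * (case x of (u, v, y) \<Rightarrow> h u v y)) < 0"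
      using neg s[of "\<lambda>u v y. PUV u v * A v y * h u v y"] by (simp add: case_prod_unfold)
  qed
  then show ?thesis
    using s[of "\<lambda>u v y. PUV u v * A v y * exp (_ * h u v y)"] by (simp add: case_prod_unfold)
qed

text \<open>The information density has mean \<open>I\<close>, so a shift by \<delta> in the right
  direction gives a negative mean, and the exponential of a log-ratio is a power. The first bound
  serves the decoding threshold, the second the divergence at the eavesdropper.\<close>

lemma info_chernoff:
  fixes I \<delta> :: real
  assumes tot: "(\<Sum>u\<in>U. \<Sum>v\<in>V. PUV u v) = 1"
    and I: "I = cond_mutual_info U V Y (\<lambda>u v y. PUV u v * A v y)" and \<delta>: "0 < \<delta>"
  shows "\<exists>s. 0 < s \<and> s \<le> 1 \<and>
      (\<Sum>u\<in>U. \<Sum>v\<in>V. \<Sum>y\<in>Y. PUV u v * A v y * (2 powr (I - \<delta>) * out_dist V PUV A u y / A v y) powr s) < 1"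
    and "\<exists>s. 0 < s \<and> s \<le> 1 \<and>
      (\<Sum>u\<in>U. \<Sum>v\<in>V. \<Sum>y\<in>Y. PUV u v * A v y * (A v y / (2 powr (I + \<delta>) * out_dist V PUV A u y)) powr s) < 1"
proof -
  let ?i = "\<lambda>u v y. ln (A v y / out_dist V PUV A u y)"
  have tot3: "(\<Sum>u\<in>U. \<Sum>v\<in>V. \<Sum>y\<in>Y. PUV u v * A v y * k) = k" for k
    using tot A1 by (simp add: sum_distrib_left[symmetric] sum_distrib_right[symmetric])
  have Iln: "(\<Sum>u\<in>U. \<Sum>v\<in>V. \<Sum>y\<in>Y. PUV u v * A v y * ?i u v y) = I * ln 2"
    unfolding I cond_mutual_info_kernel by (simp add: log_def sum_divide_distrib[symmetric])
  have "(\<Sum>u\<in>U. \<Sum>v\<in>V. \<Sum>y\<in>Y. PUV u v * A v y * ((I - \<delta>) * ln 2 - ?i u v y)) < 0"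
    using \<delta> by (simp add: right_diff_distrib sum_subtractf Iln tot3 left_diff_distrib distrib_right)
  from chernoff_triple[OF tot this] obtain s where s: "0 < s" "s \<le> 1"
    "(\<Sum>u\<in>U. \<Sum>v\<in>V. \<Sum>y\<in>Y. PUV u v * A v y * exp (s * ((I - \<delta>) * ln 2 - ?i u v y))) < 1" by blast
  have eq: "PUV u v * A v y * exp (s * ((I - \<delta>) * ln 2 - ?i u v y))
      = PUV u v * A v y * (2 powr (I - \<delta>) * out_dist V PUV A u y / A v y) powr s" if "u \<in> U" "v \<in> V" for u v y
  proof (cases "PUV u v * A v y = 0")
    case False
    then show ?thesis
      using out_dist_pos[OF that False] by (simp add: powr_def ln_mult_pos ln_divide_pos algebra_simps)
  qed auto
  show "\<exists>s. 0 < s \<and> s \<le> 1 \<and>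
      (\<Sum>u\<in>U. \<Sum>v\<in>V. \<Sum>y\<in>Y. PUV u v * A v y * (2 powr (I - \<delta>) * out_dist V PUV A u y / A v y) powr s) < 1"
    using s by (intro exI[of _ s] conjI) (simp_all only: eq cong: sum.cong)
  have "(\<Sum>u\<in>U. \<Sum>v\<in>V. \<Sum>y\<in>Y. PUV u v * A v y * (?i u v y - (I + \<delta>) * ln 2)) < 0"
    using \<delta> by (simp add: right_diff_distrib sum_subtractf Iln tot3 left_diff_distrib distrib_right)
  from chernoff_triple[OF tot this] obtain s where s: "0 < s" "s \<le> 1"
    "(\<Sum>u\<in>U. \<Sum>v\<in>V. \<Sum>y\<in>Y. PUV u v * A v y * exp (s * (?i u v y - (I + \<delta>) * ln 2))) < 1" by blast
  have eq: "PUV u v * A v y * exp (s * (?i u v y - (I + \<delta>) * ln 2))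
      = PUV u v * A v y * (A v y / (2 powr (I + \<delta>) * out_dist V PUV A u y)) powr s" if "u \<in> U" "v \<in> V" for u v y
  proof (cases "PUV u v * A v y = 0")
    case False
    then show ?thesis
      using out_dist_pos[OF that False] by (simp add: powr_def ln_mult_pos ln_divide_pos algebra_simps)
  qed auto
  show "\<exists>s. 0 < s \<and> s \<le> 1 \<and>
      (\<Sum>u\<in>U. \<Sum>v\<in>V. \<Sum>y\<in>Y. PUV u v * A v y * (A v y / (2 powr (I + \<delta>) * out_dist V PUV A u y)) powr s) < 1"
    using s by (intro exI[of _ s] conjI) (simp_all only: eq cong: sum.cong)
qed

end

section \<open>Product formulas for laws, prefix channels and costs of words\<close>

lemma sum_words_power:
  fixes g :: "'a \<Rightarrow> real"
  shows "(\<Sum>xs\<in>words n A. \<Prod>i<n. g (xs ! i)) = (\<Sum>a\<in>A. g a) ^ n"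
  using sum_words_prod[of "\<lambda>_. g"] by simp

lemma sum_words_power3:
  fixes F :: "'u \<Rightarrow> 'v \<Rightarrow> 'y \<Rightarrow> real"
  shows "(\<Sum>us\<in>words n U. \<Sum>vs\<in>words n V. \<Sum>ys\<in>words n Y. \<Prod>i<n. F (us ! i) (vs ! i) (ys ! i))
    = (\<Sum>u\<in>U. \<Sum>v\<in>V. \<Sum>y\<in>Y. F u v y) ^ n"
proof -
  have "(\<Sum>ys\<in>words n Y. \<Prod>i<n. F (us ! i) (vs ! i) (ys ! i)) = (\<Prod>i<n. \<Sum>y\<in>Y. F (us ! i) (vs ! i) y)" for us vs
    by (rule sum_words_prod)
  moreover have "(\<Sum>vs\<in>words n V. \<Prod>i<n. \<Sum>y\<in>Y. F (us ! i) (vs ! i) y)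
      = (\<Prod>i<n. \<Sum>v\<in>V. \<Sum>y\<in>Y. F (us ! i) v y)" for us
    by (rule sum_words_prod)
  ultimately show ?thesis
    by (simp add: sum_words_power[where g = "\<lambda>u. \<Sum>v\<in>V. \<Sum>y\<in>Y. F u v y"])
qed

lemma sum_words_power2:
  fixes F :: "'u \<Rightarrow> 'v \<Rightarrow> real"
  shows "(\<Sum>us\<in>words n U. \<Sum>vs\<in>words n V. \<Prod>i<n. F (us ! i) (vs ! i)) = (\<Sum>u\<in>U. \<Sum>v\<in>V. F u v) ^ n"
proof -
  have "(\<Sum>vs\<in>words n V. \<Prod>i<n. F (us ! i) (vs ! i)) = (\<Prod>i<n. \<Sum>v\<in>V. F (us ! i) v)" for us
    by (rule sum_words_prod)
  then show ?thesis by (simp add: sum_words_power[where g = "\<lambda>u. \<Sum>v\<in>V. F u v"])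
qed

lemma prodch_compose:
  fixes K :: "'v \<Rightarrow> 'x::finite \<Rightarrow> real"
  assumes "length vs = n"
  shows "(\<Sum>xs\<in>seqs n. prodch K vs xs * prodch T xs ys) = prodch (\<lambda>v y. \<Sum>x\<in>UNIV. K v x * T x y) vs ys"
proof -
  have "(\<Sum>xs\<in>seqs n. prodch K vs xs * prodch T xs ys)
      = (\<Sum>xs\<in>words n UNIV. \<Prod>i<n. K (vs ! i) (xs ! i) * T (xs ! i) (ys ! i))"
    unfolding seqs_eq_words using assms
    by (intro sum.cong refl) (auto simp: prodch_def prod.distrib words_def)
  also have "\<dots> = (\<Prod>i<n. \<Sum>x\<in>UNIV. K (vs ! i) x * T x (ys ! i))"
    by (rule sum_words_prod)
  finally show ?thesis using assms by (simp add: prodch_def)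
qed

lemma cost_n_eq: "cost_n C xs = (\<Sum>i<length xs. C (xs ! i)) / length xs"
  by (simp add: cost_n_def sum_list_sum_nth atLeast0LessThan)

text \<open>Averaging over the prefix channel turns the letter cost on \<open>x\<close> into a
  letter cost on \<open>v\<close>, so the constraint can be checked on codewords.\<close>

lemma prodch_cost:
  fixes K :: "'v \<Rightarrow> 'x::finite \<Rightarrow> real"
  assumes len: "length vs = n" and K1: "\<And>v. v \<in> set vs \<Longrightarrow> (\<Sum>x\<in>UNIV. K v x) = 1"
  shows "(\<Sum>xs\<in>seqs n. prodch K vs xs * cost_n C xs) = cost_n (\<lambda>v. \<Sum>x\<in>UNIV. K v x * C x) vs"
proof -
  have "(\<Sum>xs\<in>seqs n. prodch K vs xs * cost_n C xs)
      = (\<Sum>xs\<in>words n UNIV. \<Sum>k<n. ((\<Prod>i<n. K (vs ! i) (xs ! i)) * C (xs ! k)) / n)"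
    unfolding seqs_eq_words using len
    by (intro sum.cong refl) (auto simp: prodch_def cost_n_eq words_def sum_distrib_left sum_divide_distrib)
  also have "\<dots> = (\<Sum>k<n. (\<Sum>xs\<in>words n UNIV. (\<Prod>i<n. K (vs ! i) (xs ! i)) * C (xs ! k)) / n)"
    by (subst sum.swap) (simp add: sum_divide_distrib)
  also have "\<dots> = (\<Sum>k<n. (\<Sum>x\<in>UNIV. K (vs ! k) x * C x) / n)"
    using len K1 by (intro sum.cong refl arg_cong2[where f = "(/)"] sum_words_marginal) auto
  finally show ?thesis using len by (simp add: cost_n_eq sum_divide_distrib)
qed

text \<open>The mean divergence of \<open>P m\<close> from \<open>Q\<close> exceeds the information
  by the divergence of the mixture \<open>R\<close> from \<open>Q\<close>. Dropping this nonnegative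
  excess leaves a bound free of the message law; \<open>ln 2\<close> converts to bits.\<close>

lemma mutual_info_le_divergence:
  fixes P :: "'m \<Rightarrow> 'z \<Rightarrow> real"
  assumes fin: "finite M" "finite Z"
    and PM: "\<And>m. m \<in> M \<Longrightarrow> 0 \<le> PM m" "(\<Sum>m\<in>M. PM m) = 1"
    and P: "\<And>m z. m \<in> M \<Longrightarrow> z \<in> Z \<Longrightarrow> 0 \<le> P m z" "\<And>m. m \<in> M \<Longrightarrow> (\<Sum>z\<in>Z. P m z) = 1"
    and Q: "\<And>z. z \<in> Z \<Longrightarrow> 0 \<le> Q z" "(\<Sum>z\<in>Z. Q z) = 1"
    and ac: "\<And>m z. m \<in> M \<Longrightarrow> z \<in> Z \<Longrightarrow> P m z \<noteq> 0 \<Longrightarrow> Q z \<noteq> 0"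
    and D: "\<And>m. m \<in> M \<Longrightarrow> (\<Sum>z\<in>Z. P m z * ln (P m z / Q z)) \<le> d"
  shows "mutual_info M Z (\<lambda>m z. PM m * P m z) \<le> d / ln 2"
proof -
  define R where "R z = (\<Sum>m\<in>M. PM m * P m z)" for z
  have R0: "0 \<le> R z" if "z \<in> Z" for z
    unfolding R_def using PM P that by (intro sum_nonneg mult_nonneg_nonneg) auto
  have R1: "(\<Sum>z\<in>Z. R z) = 1"
    unfolding R_def using PM P by (subst sum_stochastic_mult) auto
  have RQ: "Q z \<noteq> 0" if "z \<in> Z" "R z \<noteq> 0" for z
  proof -
    have "\<exists>m\<in>M. PM m * P m z \<noteq> 0" using that unfolding R_def by (meson sum.neutral)
    then show ?thesis using ac that by auto
  qed
  have "(if PM m * P m z = 0 then 0 else PM m * P m z * log 2 (PM m * P m z /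
      ((\<Sum>z\<in>Z. PM m * P m z) * (\<Sum>m\<in>M. PM m * P m z))))
     = (PM m * (P m z * ln (P m z / Q z)) - PM m * P m z * ln (R z / Q z)) / ln 2"
    if mz: "m \<in> M" "z \<in> Z" for m z
  proof (cases "PM m * P m z = 0")
    case False
    then have pos: "0 < PM m" "0 < P m z" using PM(1)[OF mz(1)] P(1)[OF mz] by (auto simp: less_le)
    have "PM m * P m z \<le> R z" unfolding R_def using mz fin PM P
      by (intro member_le_sum[where f = "\<lambda>m. PM m * P m z"]) auto
    then have "0 < R z" using pos by (smt (verit) mult_pos_pos)
    moreover have "0 < Q z" using ac[OF mz] pos Q(1)[OF mz(2)] by (auto simp: less_le)
    moreover have "(\<Sum>z\<in>Z. PM m * P m z) = PM m" using P(2)[OF mz(1)] by (simp add: sum_distrib_left[symmetric])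
    ultimately show ?thesis
      using pos by (simp add: R_def[symmetric] log_def ln_divide_pos ln_mult_pos field_simps)
  qed auto
  then have "mutual_info M Z (\<lambda>m z. PM m * P m z)
     = (\<Sum>m\<in>M. \<Sum>z\<in>Z. (PM m * (P m z * ln (P m z / Q z)) - PM m * P m z * ln (R z / Q z)) / ln 2)"
    unfolding mutual_info_def by (intro sum.cong refl) blast
  also have "\<dots> = ((\<Sum>m\<in>M. PM m * (\<Sum>z\<in>Z. P m z * ln (P m z / Q z))) - (\<Sum>z\<in>Z. R z * ln (R z / Q z))) / ln 2"
    unfolding R_def sum_distrib_right
    by (subst (2) sum.swap) (simp add: sum_divide_distrib[symmetric] sum_subtractf sum_distrib_left)
  also have "\<dots> \<le> d / ln 2"
  proof (rule divide_right_mono)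
    have "(\<Sum>m\<in>M. PM m * (\<Sum>z\<in>Z. P m z * ln (P m z / Q z))) \<le> (\<Sum>m\<in>M. PM m * d)"
      using PM D by (intro sum_mono mult_left_mono) auto
    also have "\<dots> = d" using PM by (simp add: sum_distrib_right[symmetric])
    finally have "(\<Sum>m\<in>M. PM m * (\<Sum>z\<in>Z. P m z * ln (P m z / Q z))) \<le> d" .
    moreover have "(\<Sum>z\<in>Z. R z - Q z) \<le> (\<Sum>z\<in>Z. R z * ln (R z / Q z))"
      using R0 Q RQ by (intro sum_mono gibbs_ln) auto
    ultimately show "(\<Sum>m\<in>M. PM m * (\<Sum>z\<in>Z. P m z * ln (P m z / Q z))) - (\<Sum>z\<in>Z. R z * ln (R z / Q z)) \<le> d"
      using R1 Q by (simp add: sum_subtractf)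
  qed simp
  finally show ?thesis .
qed

section \<open>Block codes\<close>

lemma words_nth: "xs \<in> words n A \<Longrightarrow> i < n \<Longrightarrow> xs ! i \<in> A"
  by (auto simp: words_def)

text \<open>The one-shot bound is averaged over \<open>u\<close>-words under their product law,
  which turns the sums over words into \<open>n\<close>-th powers, and a word of positive weight not
  above the average is fixed. The threshold is \<open>\<tau> ^ n\<close>, and \<open>J\<close> has
  to reach \<open>\<sigma> ^ n\<close>.\<close>

lemma block_code_exists:
  fixes A :: "'v \<Rightarrow> 'y::finite \<Rightarrow> real" and B :: "'v \<Rightarrow> 'z::finite \<Rightarrow> real"
    and PUV :: "'u \<Rightarrow> 'v \<Rightarrow> real" and M :: "'m set" and J n :: nat
    and \<tau> \<sigma> r s :: real
  assumes fin: "finite U" "finite V" "finite M" and M: "M \<noteq> {}"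
    and P0: "\<And>u v. u \<in> U \<Longrightarrow> v \<in> V \<Longrightarrow> 0 \<le> PUV u v" and P1: "(\<Sum>u\<in>U. \<Sum>v\<in>V. PUV u v) = 1"
    and A0: "\<And>v y. v \<in> V \<Longrightarrow> 0 \<le> A v y" and A1: "\<And>v. v \<in> V \<Longrightarrow> (\<Sum>y\<in>UNIV. A v y) = 1"
    and B0: "\<And>v z. v \<in> V \<Longrightarrow> 0 \<le> B v z" and B1: "\<And>v. v \<in> V \<Longrightarrow> (\<Sum>z\<in>UNIV. B v z) = 1"
    and \<nu>0: "\<And>vs. vs \<in> words n V \<Longrightarrow> 0 \<le> \<nu> vs"
    and \<tau>: "0 < \<tau>" and \<sigma>: "0 < \<sigma>" and r: "0 < r" and s: "0 < s" "s \<le> 1"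
    and J: "0 < J" "\<sigma> ^ n \<le> J"
    and bound: "(\<Sum>u\<in>U. \<Sum>v\<in>V. \<Sum>y\<in>UNIV. PUV u v * A v y * (\<tau> * out_dist V PUV A u y / A v y) powr r) ^ n
      + 2 * card M * J / \<tau> ^ n
      + (\<Sum>u\<in>U. \<Sum>v\<in>V. \<Sum>z\<in>UNIV. PUV u v * B v z * (B v z / (\<sigma> * out_dist V PUV B u z)) powr s) ^ n / s
      + (\<Sum>us\<in>words n U. \<Sum>vs\<in>words n V. (\<Prod>i<n. PUV (us ! i) (vs ! i)) * \<nu> vs) \<le> \<beta>"
  shows "\<exists>c g Q. (\<forall>m\<in>M. \<forall>j<J. c m j \<in> words n V) \<and> (\<forall>ys. g ys \<in> M)
      \<and> (\<forall>zs. 0 \<le> Q zs) \<and> (\<Sum>zs\<in>seqs n. Q zs) = 1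
      \<and> (\<forall>m\<in>M. \<forall>j<J. \<forall>zs. prodch B (c m j) zs \<noteq> 0 \<longrightarrow> Q zs \<noteq> 0)
      \<and> (\<forall>m\<in>M. (\<Sum>j<J. \<Sum>ys\<in>seqs n. prodch A (c m j) ys * of_bool (g ys \<noteq> m)) / J \<le> 2 * \<beta>
      \<and> (\<Sum>zs\<in>seqs n. (\<Sum>j<J. prodch B (c m j) zs) / J * ln ((\<Sum>j<J. prodch B (c m j) zs) / J / Q zs)) \<le> 2 * \<beta>
      \<and> (\<Sum>j<J. \<nu> (c m j)) / J \<le> 2 * \<beta>)"
proof -
  define P where "P u = (\<Sum>v\<in>V. PUV u v)" for u
  define q where "q u v = PUV u v / P u" for u v
  define w where "w us = (\<Prod>i<n. P (us ! i))" for us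
  define qn where "qn us vs = (\<Prod>i<n. q (us ! i) (vs ! i))" for us vs
  define PP where "PP us vs = (\<Prod>i<n. PUV (us ! i) (vs ! i))" for us vs
  \<comment> \<open>One-shot coding asks for strictly positive codeword probabilities, so the
    codeword alphabet is cut down to the support.\<close>
  define Vn where "Vn us = {vs \<in> words n V. 0 < qn us vs}" for us
  have PU0: "0 \<le> P u" if "u \<in> U" for u unfolding P_def using P0 that by (intro sum_nonneg) auto
  have q0: "0 \<le> q u v" if "u \<in> U" "v \<in> V" for u v unfolding q_def using P0 PU0 that by simp
  have w0: "0 \<le> w us" if "us \<in> words n U" for us
    unfolding w_def using PU0 words_nth[OF that] by (intro prod_nonneg) auto
  have qn0: "0 \<le> qn us vs" if "us \<in> words n U" "vs \<in> words n V" for us vs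
    unfolding qn_def using q0 words_nth[OF that(1)] words_nth[OF that(2)] by (intro prod_nonneg) auto
  have PP0: "0 \<le> PP us vs" if "us \<in> words n U" "vs \<in> words n V" for us vs
    unfolding PP_def using P0 words_nth[OF that(1)] words_nth[OF that(2)] by (intro prod_nonneg) auto
  have w_pos: "0 < P (us ! i)" if "us \<in> words n U" "0 < w us" "i < n" for us i
  proof -
    have "w us \<noteq> 0" using that by simp
    then have "P (us ! i) \<noteq> 0" using that(3) unfolding w_def by (subst (asm) prod_zero_iff) auto
    then show ?thesis using PU0[OF words_nth[OF that(1,3)]] by simp
  qed
  have w_qn: "w us * qn us vs = PP us vs" if "us \<in> words n U" "0 < w us" for us vs
    unfolding w_def qn_def PP_def prod.distrib[symmetric] q_def
    using w_pos[OF that] by (intro prod.cong) force+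
  have finVn: "finite (Vn us)" for us unfolding Vn_def using fin by simp
  have Vn_sum: "(\<Sum>vs\<in>Vn us. qn us vs * F vs) = (\<Sum>vs\<in>words n V. qn us vs * F vs)"
    if "us \<in> words n U" for us and F :: "'v list \<Rightarrow> real"
    unfolding Vn_def using fin qn0[OF that]
    by (intro sum.mono_neutral_left) (auto simp: less_le)
  have out: "(\<Sum>vs\<in>Vn us. qn us vs * prodch D vs ys) = prodch (out_dist V PUV D) us ys"
    if us: "us \<in> words n U" for us ys and D :: "'v \<Rightarrow> 'c \<Rightarrow> real"
  proof -
    have "(\<Sum>vs\<in>Vn us. qn us vs * prodch D vs ys)
        = (\<Sum>vs\<in>words n V. \<Prod>i<n. q (us ! i) (vs ! i) * D (vs ! i) (ys ! i))"
      unfolding Vn_sum[OF us] by (intro sum.cong) (auto simp: qn_def prodch_def prod.distrib words_def)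
    also have "\<dots> = (\<Prod>i<n. \<Sum>v\<in>V. q (us ! i) v * D v (ys ! i))" by (rule sum_words_prod)
    finally show ?thesis using us by (simp add: prodch_def words_def out_dist_def q_def P_def)
  qed
  have chn0: "0 \<le> prodch D vs ys" if "vs \<in> words n V" "\<And>v y. v \<in> V \<Longrightarrow> 0 \<le> D v y"
    for vs ys and D :: "'v \<Rightarrow> 'c \<Rightarrow> real"
    unfolding prodch_def using words_nth[OF that(1)] that by (intro prod_nonneg) (auto simp: words_def)
  have chn1: "(\<Sum>ys\<in>seqs n. prodch D vs ys) = 1" if "vs \<in> words n V" "\<And>v. v \<in> V \<Longrightarrow> (\<Sum>y\<in>UNIV. D v y) = 1"
    for vs and D :: "'v \<Rightarrow> 'c \<Rightarrow> real"
    unfolding seqs_eq_words using that by (intro sum_prodch) (auto simp: words_def)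
  have out0: "0 \<le> out_dist V PUV D u y" if "u \<in> U" "\<And>v y. v \<in> V \<Longrightarrow> 0 \<le> D v y"
    for u y and D :: "'v \<Rightarrow> 'c \<Rightarrow> real"
    unfolding out_dist_def using that P0 PU0[unfolded P_def]
    by (intro sum_nonneg mult_nonneg_nonneg divide_nonneg_nonneg) auto
  have outB0: "0 \<le> out_dist V PUV B u z" if "u \<in> U" for u z
    by (rule out0) (use that B0 in auto)
  have chnA0: "0 \<le> prodch A vs ys" and chnA1: "(\<Sum>ys\<in>seqs n. prodch A vs ys) = 1"
    and chnB0: "0 \<le> prodch B vs zs" and chnB1: "(\<Sum>zs\<in>seqs n. prodch B vs zs) = 1"
    if "vs \<in> words n V" for vs ys zs
    using that A0 A1 B0 B1 by (auto intro: chn0 chn1)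
  define cb where "cb us = code_bound (Vn us) (seqs n :: 'y list set) (seqs n :: 'z list set) (qn us)
      (prodch A) (prodch B) \<nu> s (\<tau> ^ n) (2 * real (card M)) J" for us
  define F1 where "F1 u v y = PUV u v * A v y * (\<tau> * out_dist V PUV A u y / A v y) powr r" for u v y
  define F2 where "F2 u v z = PUV u v * B v z * (B v z / (\<sigma> * out_dist V PUV B u z)) powr s" for u v z
  define G1 where "G1 us = (\<Sum>vs\<in>words n V. \<Sum>ys\<in>seqs n. \<Prod>i<n. F1 (us ! i) (vs ! i) (ys ! i))" for us
  define G2 where "G2 us = (\<Sum>vs\<in>words n V. \<Sum>zs\<in>seqs n. \<Prod>i<n. F2 (us ! i) (vs ! i) (zs ! i))" for us
  define G3 where "G3 us = (\<Sum>vs\<in>words n V. PP us vs * \<nu> vs)" for us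
  have step: "w us * cb us \<le> G1 us + w us * (2 * card M * J / \<tau> ^ n) + G2 us / s + G3 us"
    if us: "us \<in> words n U" for us
  proof (cases "w us = 0")
    \<comment> \<open>\<open>cb us\<close> is not controlled here, since the conditional laws may
      degenerate, but its weight is zero.\<close>
    case True
    have "0 \<le> G1 us" unfolding G1_def F1_def
      using words_nth[OF us] P0 A0 by (intro sum_nonneg prod_nonneg) (auto simp: words_nth)
    moreover have "0 \<le> G2 us" unfolding G2_def F2_def
      using words_nth[OF us] P0 B0 by (intro sum_nonneg prod_nonneg) (auto simp: words_nth)
    moreover have "0 \<le> G3 us" unfolding G3_def
      using PP0[OF us] \<nu>0 by (intro sum_nonneg mult_nonneg_nonneg) auto
    ultimately show ?thesis using True s by simp
  next
    case False
    then have wpos: "0 < w us" using w0[OF us] by simp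
    have len: "length us = n" using us by (simp add: words_def)
    \<comment> \<open>Multiplication by the weight of \<open>us\<close> turns conditional weights
      into joint ones, which are products without quotients.\<close>
    have move: "w us * (\<Sum>vs\<in>Vn us. qn us vs * F vs) = (\<Sum>vs\<in>words n V. PP us vs * F vs)" for F
      unfolding Vn_sum[OF us] by (simp add: sum_distrib_left w_qn[OF us wpos, symmetric] mult.assoc)
    have 1: "w us * (\<Sum>vs\<in>Vn us. qn us vs * (\<Sum>ys\<in>seqs n. prodch A vs ys *
        of_bool (prodch A vs ys \<le> \<tau> ^ n * prodch (out_dist V PUV A) us ys))) \<le> G1 us"
      unfolding move unfolding G1_def sum_distrib_left
    proof (intro sum_mono)
      fix vs ys assume vs: "vs \<in> words n V"
      let ?a = "prodch A vs ys" and ?b = "\<tau> ^ n * prodch (out_dist V PUV A) us ys"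
      have a0: "0 \<le> ?a" by (rule chnA0[OF vs])
      \<comment> \<open>The indicator is dominated by a power: on the event, with \<open>?a\<close>
        nonzero, the ratio is at least 1, and its \<open>r\<close>-th power factors over the
        letters.\<close>
      have "?a * of_bool (?a \<le> ?b) \<le> ?a * (?b / ?a) powr r"
      proof (cases "?a = 0 \<or> \<not> ?a \<le> ?b")
        case False
        then have "1 \<le> ?b / ?a" using a0 by simp
        then have "1 \<le> (?b / ?a) powr r" using r by (simp add: ge_one_powr_ge_zero)
        then show ?thesis using False a0 by (simp add: mult_le_cancel_left1)
      qed (use a0 in auto)
      then have "PP us vs * (?a * of_bool (?a \<le> ?b)) \<le> PP us vs * (?a * (?b / ?a) powr r)"
        using PP0[OF us vs] by (rule mult_left_mono)
      also have "?b / ?a = (\<Prod>i<n. \<tau> * out_dist V PUV A (us ! i) (ys ! i) / A (vs ! i) (ys ! i))"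
        using len vs by (simp add: prodch_def words_def prod.distrib prod_dividef)
      also have "\<dots> powr r = (\<Prod>i<n. (\<tau> * out_dist V PUV A (us ! i) (ys ! i) / A (vs ! i) (ys ! i)) powr r)"
        by (rule prod_powr_distrib)
      also have "PP us vs * (?a * \<dots>) = (\<Prod>i<n. F1 (us ! i) (vs ! i) (ys ! i))"
        using vs by (simp add: PP_def prodch_def F1_def prod.distrib words_def)
      finally show "PP us vs * (?a * of_bool (?a \<le> ?b)) \<le> (\<Prod>i<n. F1 (us ! i) (vs ! i) (ys ! i))" .
    qed
    have 2: "w us * ((\<Sum>vs\<in>Vn us. qn us vs * (\<Sum>zs\<in>seqs n. prodch B vs zs *
        (prodch B vs zs / prodch (out_dist V PUV B) us zs) powr s)) / (s * J powr s)) \<le> G2 us / s"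
    proof -
      \<comment> \<open>\<open>J\<close> is replaced by \<open>\<sigma> ^ n\<close>, which
        distributes one factor to each letter.\<close>
      have Js: "(\<sigma> ^ n) powr s \<le> J powr s" using J \<sigma> s by (intro powr_mono2) auto
      have pos: "0 < (\<sigma> ^ n) powr s" using \<sigma> by simp
      have "PP us vs * (prodch B vs zs * (prodch B vs zs / prodch (out_dist V PUV B) us zs) powr s) / J powr s
          \<le> (\<Prod>i<n. F2 (us ! i) (vs ! i) (zs ! i))" if vs: "vs \<in> words n V" for vs zs
      proof -
        let ?b = "prodch B vs zs" and ?d = "prodch (out_dist V PUV B) us zs"
        have b0: "0 \<le> ?b" by (rule chnB0[OF vs])
        have d0: "0 \<le> ?d" unfolding prodch_def using outB0 words_nth[OF us] len
          by (intro prod_nonneg) auto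
        have "PP us vs * (?b * (?b / ?d) powr s) / J powr s \<le> PP us vs * (?b * (?b / ?d) powr s) / (\<sigma> ^ n) powr s"
          using Js pos PP0[OF us vs] b0 J by (intro divide_left_mono) auto
        also have "\<dots> = PP us vs * (?b * (?b / (\<sigma> ^ n * ?d)) powr s)"
          using b0 d0 \<sigma> by (simp add: powr_divide powr_mult mult.commute)
        also have "?b / (\<sigma> ^ n * ?d) = (\<Prod>i<n. B (vs ! i) (zs ! i) / (\<sigma> * out_dist V PUV B (us ! i) (zs ! i)))"
          using len vs by (simp add: prodch_def words_def prod.distrib prod_dividef)
        also have "\<dots> powr s = (\<Prod>i<n. (B (vs ! i) (zs ! i) / (\<sigma> * out_dist V PUV B (us ! i) (zs ! i))) powr s)"
          by (rule prod_powr_distrib)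
        also have "PP us vs * (?b * \<dots>) = (\<Prod>i<n. F2 (us ! i) (vs ! i) (zs ! i))"
          using vs by (simp add: PP_def prodch_def F2_def prod.distrib words_def)
        finally show ?thesis .
      qed
      then have "(\<Sum>vs\<in>words n V. \<Sum>zs\<in>seqs n. PP us vs * (prodch B vs zs *
          (prodch B vs zs / prodch (out_dist V PUV B) us zs) powr s) / J powr s) \<le> G2 us"
        unfolding G2_def by (intro sum_mono)
      moreover have "w us * ((\<Sum>vs\<in>Vn us. qn us vs * (\<Sum>zs\<in>seqs n. prodch B vs zs *
        (prodch B vs zs / prodch (out_dist V PUV B) us zs) powr s)) / (s * J powr s))
        = (\<Sum>vs\<in>words n V. \<Sum>zs\<in>seqs n. PP us vs * (prodch B vs zs *
          (prodch B vs zs / prodch (out_dist V PUV B) us zs) powr s) / J powr s) / s"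
        unfolding times_divide_eq_right move
        by (simp add: sum_distrib_left sum_divide_distrib mult_ac)
      ultimately show ?thesis using s by (simp add: divide_right_mono)
    qed
    have 3: "w us * (\<Sum>vs\<in>Vn us. qn us vs * \<nu> vs) = G3 us" unfolding move G3_def ..
    show ?thesis
      unfolding cb_def code_bound_def out[OF us] distrib_left using 1 2 3 by simp
  qed
  have "\<exists>us\<in>words n U. 0 < w us \<and> cb us \<le> \<beta>"
  proof (rule weighted_average_exists)
    show "finite (words n U)" using fin by simp
    show "(\<Sum>us\<in>words n U. w us) = 1"
      unfolding w_def sum_words_power using P1 by (simp add: P_def)
    have w1: "(\<Sum>us\<in>words n U. w us) = 1" by fact
    have "(\<Sum>us\<in>words n U. w us * cb us)
      \<le> (\<Sum>us\<in>words n U. G1 us + w us * (2 * card M * J / \<tau> ^ n) + G2 us / s + G3 us)"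
      by (intro sum_mono step)
    also have "\<dots> = (\<Sum>us\<in>words n U. G1 us) + 2 * card M * J / \<tau> ^ n
        + (\<Sum>us\<in>words n U. G2 us) / s + (\<Sum>us\<in>words n U. G3 us)"
      using w1 by (simp add: sum.distrib sum_distrib_right[symmetric] sum_divide_distrib[symmetric])
    also have "\<dots> \<le> \<beta>"
    proof -
      have "(\<Sum>us\<in>words n U. G1 us) = (\<Sum>u\<in>U. \<Sum>v\<in>V. \<Sum>y\<in>UNIV. F1 u v y) ^ n"
        unfolding G1_def seqs_eq_words by (rule sum_words_power3)
      moreover have "(\<Sum>us\<in>words n U. G2 us) = (\<Sum>u\<in>U. \<Sum>v\<in>V. \<Sum>z\<in>UNIV. F2 u v z) ^ n"
        unfolding G2_def seqs_eq_words by (rule sum_words_power3)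
      ultimately show ?thesis
        using bound unfolding G3_def F1_def F2_def PP_def by simp
    qed
    finally show "(\<Sum>us\<in>words n U. w us * cb us) \<le> \<beta>" .
  qed (use w0 in auto)
  then obtain us where us: "us \<in> words n U" and wpos: "0 < w us" and le: "cb us \<le> \<beta>" by blast
  define Q where "Q zs = (\<Sum>vs\<in>Vn us. qn us vs * prodch B vs zs)" for zs
  have Vn: "vs \<in> words n V" "0 < qn us vs" if "vs \<in> Vn us" for vs using that by (auto simp: Vn_def)
  have qn1: "(\<Sum>vs\<in>Vn us. qn us vs) = 1"
  proof -
    have "(\<Sum>vs\<in>Vn us. qn us vs) = (\<Prod>i<n. \<Sum>v\<in>V. q (us ! i) v)"
      using Vn_sum[OF us, of "\<lambda>_. 1"] by (simp add: qn_def sum_words_prod[where g = "\<lambda>i. q (us ! i)"])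
    also have "\<dots> = 1"
      using w_pos[OF us wpos] by (intro prod.neutral) (force simp: q_def P_def sum_divide_distrib[symmetric])
    finally show ?thesis .
  qed
  have "\<exists>c g. (\<forall>m\<in>M. \<forall>j<J. c m j \<in> Vn us) \<and> (\<forall>ys. g ys \<in> M) \<and> (\<forall>m\<in>M.
      (\<Sum>j<J. \<Sum>ys\<in>seqs n. prodch A (c m j) ys * of_bool (g ys \<noteq> m)) / J \<le> 2 * \<beta>
      \<and> (\<Sum>zs\<in>seqs n. (\<Sum>j<J. prodch B (c m j) zs) / J * ln ((\<Sum>j<J. prodch B (c m j) zs) / J
         / (\<Sum>vs\<in>Vn us. qn us vs * prodch B vs zs))) \<le> 2 * \<beta>
      \<and> (\<Sum>j<J. \<nu> (c m j)) / J \<le> 2 * \<beta>)"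
  proof (rule wiretap_code_exists)
    show "code_bound (Vn us) (seqs n :: 'y list set) (seqs n :: 'z list set) (qn us) (prodch A) (prodch B)
        \<nu> s (\<tau> ^ n) (real (2 * card M)) J \<le> \<beta>"
      using le unfolding cb_def by simp
  qed (use fin finVn M qn1 Vn s J \<tau> \<nu>0 chnA0 chnB0 chnA1 chnB1 in auto)
  then obtain c g where c: "\<forall>m\<in>M. \<forall>j<J. c m j \<in> Vn us" and rest: "\<forall>ys. g ys \<in> M" "\<forall>m\<in>M.
      (\<Sum>j<J. \<Sum>ys\<in>seqs n. prodch A (c m j) ys * of_bool (g ys \<noteq> m)) / J \<le> 2 * \<beta>
      \<and> (\<Sum>zs\<in>seqs n. (\<Sum>j<J. prodch B (c m j) zs) / J * ln ((\<Sum>j<J. prodch B (c m j) zs) / J / Q zs)) \<le> 2 * \<beta>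
      \<and> (\<Sum>j<J. \<nu> (c m j)) / J \<le> 2 * \<beta>"
    unfolding Q_def by blast
  have Q0: "0 \<le> Q zs" for zs
    unfolding Q_def using Vn chnB0 by (intro sum_nonneg mult_nonneg_nonneg) (auto simp: less_imp_le)
  have Q1: "(\<Sum>zs\<in>seqs n. Q zs) = 1"
    unfolding Q_def using Vn chnB1 qn1 by (subst sum_stochastic_mult) auto
  have ac: "Q zs \<noteq> 0" if "vs \<in> Vn us" "prodch B vs zs \<noteq> 0" for vs zs
  proof -
    have "0 < qn us vs * prodch B vs zs"
      using that Vn[OF that(1)] chnB0[OF Vn(1)[OF that(1)], of zs] by (auto simp: less_le)
    also have "\<dots> \<le> Q zs" unfolding Q_def using that finVn Vn chnB0
      by (intro member_le_sum[where f = "\<lambda>vs. qn us vs * prodch B vs zs"]) (auto simp: less_imp_le)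
    finally show ?thesis by simp
  qed
  show ?thesis
    using c rest Q0 Q1 ac Vn by (intro exI[of _ c] exI[of _ g] exI[of _ Q]) blast
qed

section \<open>Achievability\<close>

lemma leak_le_divergence:
  fixes W :: "'x::finite \<Rightarrow> ('y::finite \<times> 'z::finite) pmf" and n :: nat and f :: "nat \<Rightarrow> 'x list \<Rightarrow> real"
  defines "P m zs \<equiv> \<Sum>xs\<in>seqs n. f m xs * prodch (chZ W) xs zs"
  assumes code: "is_code C b n R f g"
    and PM: "\<And>m. m \<in> msgs n R \<Longrightarrow> 0 \<le> PM m" "(\<Sum>m\<in>msgs n R. PM m) = 1"
    and Q: "\<And>zs. 0 \<le> Q zs" "(\<Sum>zs\<in>seqs n. Q zs) = 1"
    and ac: "\<And>m zs. m \<in> msgs n R \<Longrightarrow> P m zs \<noteq> 0 \<Longrightarrow> Q zs \<noteq> 0"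
    and D: "\<And>m. m \<in> msgs n R \<Longrightarrow> (\<Sum>zs\<in>seqs n. P m zs * ln (P m zs / Q zs)) \<le> d"
  shows "leak W n R f PM \<le> d / ln 2"
  unfolding leak_def P_def[symmetric]
proof (rule mutual_info_le_divergence[where Q = Q])
  have f: "0 \<le> f m xs" "(\<Sum>xs\<in>seqs n. f m xs) = 1" if "m \<in> msgs n R" "xs \<in> seqs n" for m xs
    using code that by (auto simp: is_code_def)
  show "0 \<le> P m zs" if "m \<in> msgs n R" for m zs
    unfolding P_def using f[OF that] by (intro sum_nonneg mult_nonneg_nonneg prodch_nonneg) auto
  have one: "(\<Sum>zs\<in>seqs n. prodch (chZ W) xs zs) = 1" if "xs \<in> seqs n" for xs
    using that unfolding seqs_eq_words by (intro sum_prodch) (auto simp: words_def)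
  show "(\<Sum>zs\<in>seqs n. P m zs) = 1" if "m \<in> msgs n R" for m
    unfolding P_def using code that by (subst sum_stochastic_mult) (auto simp: one is_code_def)
qed (use PM Q ac D in auto)

text \<open>The uniform law is one of the candidates. The work lies in bounding the leakages above,
  without which \<open>Sup\<close> would give no information.\<close>

lemma leak_str_le_leak_sem:
  fixes W :: "'x::finite \<Rightarrow> ('y::finite \<times> 'z::finite) pmf"
  assumes code: "is_code C b n R f g" and R: "0 \<le> R"
  shows "leak_str W n R f \<le> leak_sem W n R f"
  unfolding leak_str_def leak_sem_def
proof (rule cSup_upper)
  show "leak W n R f (\<lambda>m. 1 / real (card (msgs n R))) \<in> {leak W n R f PM | PM.
      (\<forall>m\<in>msgs n R. 0 \<le> PM m) \<and> (\<Sum>m\<in>msgs n R. PM m) = 1}"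
    using card_msgs_bounds(1)[OF R, of n]
    by (intro CollectI exI[of _ "\<lambda>m. 1 / real (card (msgs n R))"]) auto
  define P where "P m zs = (\<Sum>xs\<in>seqs n. f m xs * prodch (chZ W) xs zs)" for m and zs :: "'z list"
  \<comment> \<open>The uniform law on words is positive everywhere, so it serves as a reference law
    for every encoder.\<close>
  define Q where "Q zs = 1 / real (card (seqs n :: 'z list set))" for zs :: "'z list"
  define D where "D m = (\<Sum>zs\<in>seqs n. P m zs * ln (P m zs / Q zs))" for m
  have ne: "replicate n undefined \<in> (seqs n :: 'z list set)" by (simp add: seqs_def)
  then have Qpos: "0 < Q zs" for zs unfolding Q_def by (auto simp: card_gt_0_iff)
  have "leak W n R f PM \<le> Max (D ` msgs n R) / ln 2"
    if "\<forall>m\<in>msgs n R. 0 \<le> PM m" "(\<Sum>m\<in>msgs n R. PM m) = 1" for PM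
  proof (rule leak_le_divergence[OF code, where Q = Q])
    show "(\<Sum>zs\<in>seqs n. Q zs) = 1" using ne by (auto simp: Q_def)
    show "(\<Sum>zs\<in>seqs n. (\<Sum>xs\<in>seqs n. f m xs * prodch (chZ W) xs zs)
        * ln ((\<Sum>xs\<in>seqs n. f m xs * prodch (chZ W) xs zs) / Q zs)) \<le> Max (D ` msgs n R)"
      if "m \<in> msgs n R" for m
      using that unfolding D_def P_def by (intro Max_ge) auto
    show "0 \<le> Q zs" "Q zs \<noteq> 0" for zs using Qpos[of zs] by auto
  qed (use that in auto)
  then show "bdd_above {leak W n R f PM | PM.
      (\<forall>m\<in>msgs n R. 0 \<le> PM m) \<and> (\<Sum>m\<in>msgs n R. PM m) = 1}"
    by (intro bdd_aboveI[of _ "Max (D ` msgs n R) / ln 2"]) blast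
qed

lemma leak_sem_le:
  assumes R: "0 \<le> R"
    and "\<And>PM. (\<forall>m\<in>msgs n R. 0 \<le> PM m) \<Longrightarrow> (\<Sum>m\<in>msgs n R. PM m) = 1 \<Longrightarrow> leak W n R f PM \<le> d"
  shows "leak_sem W n R f \<le> d"
  unfolding leak_sem_def
proof (rule cSup_least)
  have "(\<Sum>m\<in>msgs n R. of_bool (m = 1)) = (1::real)"
    using card_msgs_bounds(4)[OF R, of n] by (simp add: of_bool_def)
  then show "{leak W n R f PM | PM. (\<forall>m\<in>msgs n R. 0 \<le> PM m) \<and> (\<Sum>m\<in>msgs n R. PM m) = 1} \<noteq> {}"
    by (auto intro!: exI[of _ "\<lambda>m. of_bool (m = 1)"])
qed (use assms in blast)

lemma achievable_sem_imp_str: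
  fixes W :: "'x::finite \<Rightarrow> ('y::finite \<times> 'z::finite) pmf"
  assumes "achievable leak_sem W C b R" "0 \<le> R"
  shows "achievable leak_str W C b R"
  unfolding achievable_def
proof (intro allI impI)
  fix \<epsilon> :: real assume "0 < \<epsilon>"
  then obtain N where N: "\<And>n. n \<ge> N \<Longrightarrow> \<exists>f g. is_code C b n R f g
         \<and> max_err W n R f g \<le> \<epsilon> \<and> leak_sem W n R f \<le> \<epsilon>"
    using assms unfolding achievable_def by blast
  show "\<exists>N. \<forall>n\<ge>N. \<exists>f g. is_code C b n R f g
         \<and> max_err W n R f g \<le> \<epsilon> \<and> leak_str W n R f \<le> \<epsilon>"
  proof (intro exI[of _ N] allI impI)
    fix n assume "N \<le> n"
    then obtain f g where fg: "is_code C b n R f g" "max_err W n R f g \<le> \<epsilon>" "leak_sem W n R f \<le> \<epsilon>"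
      using N by blast
    then have "leak_str W n R f \<le> \<epsilon>"
      using leak_str_le_leak_sem[OF fg(1) assms(2), where W = W] by linarith
    then show "\<exists>f g. is_code C b n R f g \<and> max_err W n R f g \<le> \<epsilon> \<and> leak_str W n R f \<le> \<epsilon>"
      using fg by blast
  qed
qed

lemma achievable_str_imp_weak:
  assumes "achievable leak_str W C b R"
  shows "achievable leak_weak W C b R"
  unfolding achievable_def
proof (intro allI impI)
  fix \<epsilon> :: real assume \<epsilon>: "0 < \<epsilon>"
  then obtain N where N: "\<And>n. n \<ge> N \<Longrightarrow> \<exists>f g. is_code C b n R f g
         \<and> max_err W n R f g \<le> \<epsilon> \<and> leak_str W n R f \<le> \<epsilon>"
    using assms unfolding achievable_def by blast
  have "leak_weak W n R f \<le> \<epsilon>" if "leak_str W n R f \<le> \<epsilon>" "1 \<le> n" for n f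
  proof -
    have "leak_str W n R f / n \<le> \<epsilon> / n" using that by (intro divide_right_mono) auto
    also have "\<dots> \<le> \<epsilon>" using that \<epsilon> by (simp add: divide_le_eq)
    finally show ?thesis by (simp add: leak_weak_def)
  qed
  then show "\<exists>N. \<forall>n\<ge>N. \<exists>f g. is_code C b n R f g
         \<and> max_err W n R f g \<le> \<epsilon> \<and> leak_weak W n R f \<le> \<epsilon>"
    using N by (intro exI[of _ "max N 1"] allI impI) (metis max.boundedE)
qed

lemma max_err_le:
  assumes "0 \<le> R" "\<And>m. m \<in> msgs n R \<Longrightarrow> (\<Sum>xs\<in>seqs n. f m xs *
        (\<Sum>ys\<in>{ys\<in>seqs n. g ys \<noteq> m}. prodch (chY W) xs ys)) \<le> e"
  shows "max_err W n R f g \<le> e"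
  unfolding max_err_def using assms card_msgs_bounds(4)[OF assms(1), of n] by (subst Max_le_iff) auto

text \<open>If the mean cost is below \<open>b\<close>, then \<open>\<eta> > 0\<close> is a slack and \<open>\<nu>\<close> indicates the words of cost
  above \<open>b - \<eta>\<close>; if every letter is affordable, then \<open>\<eta> = 0\<close> and \<open>\<nu> = 0\<close>.\<close>

lemma cost_control:
  fixes c :: "'v \<Rightarrow> real"
  assumes fin: "finite U" "finite V"
    and P0: "\<And>u v. u \<in> U \<Longrightarrow> v \<in> V \<Longrightarrow> 0 \<le> PUV u v" and P1: "(\<Sum>u\<in>U. \<Sum>v\<in>V. PUV u v) = 1"
    and c0: "\<And>v. v \<in> V \<Longrightarrow> 0 \<le> c v"
    and cost: "(\<Sum>u\<in>U. \<Sum>v\<in>V. PUV u v * c v) < b \<or> (\<forall>v\<in>V. c v \<le> b)"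
  obtains \<epsilon>\<^sub>0 \<kappa> \<eta> \<rho> \<nu> where "0 < \<epsilon>\<^sub>0" "0 \<le> \<kappa>" "\<kappa> * \<epsilon>\<^sub>0 \<le> \<eta>" "0 \<le> \<rho>" "\<rho> < 1" "\<forall>vs. 0 \<le> \<nu> vs"
    "\<forall>n>0. \<forall>vs\<in>words n V. cost_n c vs \<le> b - \<eta> + \<kappa> * \<nu> vs"
    "\<forall>n>0. (\<Sum>us\<in>words n U. \<Sum>vs\<in>words n V. (\<Prod>i<n. PUV (us ! i) (vs ! i)) * \<nu> vs) \<le> \<rho> ^ n"
  using cost
proof
  assume all: "\<forall>v\<in>V. c v \<le> b"
  have "cost_n c vs \<le> b" if "0 < n" "vs \<in> words n V" for n vs
  proof -
    have "(\<Sum>i<n. c (vs ! i)) \<le> (\<Sum>i<n. b)"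
      using all words_nth[OF that(2)] by (intro sum_mono) auto
    then show ?thesis using that by (simp add: cost_n_eq words_def field_simps)
  qed
  then show thesis
    by (intro that[of 1 0 0 0 "\<lambda>_. 0"]) auto
next
  assume lt: "(\<Sum>u\<in>U. \<Sum>v\<in>V. PUV u v * c v) < b"
  define mean where "mean = (\<Sum>u\<in>U. \<Sum>v\<in>V. PUV u v * c v)"
  have mean0: "0 \<le> mean" unfolding mean_def using P0 c0 by (intro sum_nonneg mult_nonneg_nonneg) auto
  \<comment> \<open>Half of the gap, so that \<open>a\<close> lies midway between the mean and
    \<open>b\<close>: one half is slack, the other forces exponential decay.\<close>
  define \<eta> where "\<eta> = (b - mean) / 2"
  define a where "a = b - \<eta>"
  have \<eta>: "0 < \<eta>" "0 \<le> a" "mean < a" using lt[folded mean_def] mean0 unfolding \<eta>_def a_def by (simp_all add: field_simps)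
  \<comment> \<open>An upper bound on every letter cost, hence on the cost of a word that violates
    the threshold.\<close>
  define \<kappa> where "\<kappa> = (\<Sum>v\<in>V. c v)"
  have \<kappa>: "0 \<le> \<kappa>" "\<And>v. v \<in> V \<Longrightarrow> c v \<le> \<kappa>"
    unfolding \<kappa>_def using c0 fin by (auto intro!: sum_nonneg member_le_sum[where f = c])
  define \<nu> :: "'v list \<Rightarrow> real" where "\<nu> vs = of_bool (a < cost_n c vs)" for vs
  have sum3: "(\<Sum>u\<in>U. \<Sum>v\<in>V. \<Sum>y\<in>{()}. PUV u v * 1 * h u v y) = (\<Sum>u\<in>U. \<Sum>v\<in>V. PUV u v * h u v ())" for h
    by simp
  \<comment> \<open>A one-point output alphabet turns the bound for triples into one for
    pairs.\<close>
  have "\<exists>s. 0 < s \<and> s \<le> 1 \<and> (\<Sum>u\<in>U. \<Sum>v\<in>V. \<Sum>y\<in>{()}. PUV u v * 1 * exp (s * (c v - a))) < 1"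
  proof (rule chernoff_triple)
    show "(\<Sum>u\<in>U. \<Sum>v\<in>V. \<Sum>y\<in>{()}. PUV u v * 1 * (c v - a)) < 0"
      using \<eta>(3) P1 by (simp add: right_diff_distrib sum_subtractf mean_def[symmetric] sum_distrib_right[symmetric])
  qed (use fin P0 P1 in auto)
  then obtain s where s: "0 < s" "(\<Sum>u\<in>U. \<Sum>v\<in>V. PUV u v * exp (s * (c v - a))) < 1" by auto
  define \<rho> where "\<rho> = (\<Sum>u\<in>U. \<Sum>v\<in>V. PUV u v * exp (s * (c v - a)))"
  have \<rho>: "0 \<le> \<rho>" "\<rho> < 1"
    using s P0 by (auto simp: \<rho>_def intro!: sum_nonneg mult_nonneg_nonneg)
  have "cost_n c vs \<le> b - \<eta> + \<kappa> * \<nu> vs" if "0 < n" "vs \<in> words n V" for n vs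
  proof (cases "a < cost_n c vs")
    case True
    have "(\<Sum>i<n. c (vs ! i)) \<le> (\<Sum>i<n. \<kappa>)"
      using \<kappa> words_nth[OF that(2)] by (intro sum_mono) auto
    then have "cost_n c vs \<le> \<kappa>" using that by (simp add: cost_n_eq words_def field_simps)
    then show ?thesis using True \<eta>(2) by (simp add: \<nu>_def a_def)
  qed (simp add: \<nu>_def a_def)
  moreover have "(\<Sum>us\<in>words n U. \<Sum>vs\<in>words n V. (\<Prod>i<n. PUV (us ! i) (vs ! i)) * \<nu> vs) \<le> \<rho> ^ n"
    if n: "0 < n" for n
  proof -
    have "(\<Sum>us\<in>words n U. \<Sum>vs\<in>words n V. (\<Prod>i<n. PUV (us ! i) (vs ! i)) * \<nu> vs)
      \<le> (\<Sum>us\<in>words n U. \<Sum>vs\<in>words n V. \<Prod>i<n. PUV (us ! i) (vs ! i) * exp (s * (c (vs ! i) - a)))"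
    proof (intro sum_mono)
      fix us vs assume us: "us \<in> words n U" and vs: "vs \<in> words n V"
      have "\<nu> vs \<le> exp (s * (\<Sum>i<n. c (vs ! i) - a))"
      proof (cases "a < cost_n c vs")
        case True
        then have "0 \<le> (\<Sum>i<n. c (vs ! i) - a)"
          using n vs by (simp add: cost_n_eq words_def sum_subtractf field_simps)
        then show ?thesis using s True by (simp add: \<nu>_def)
      qed (simp add: \<nu>_def)
      also have "\<dots> = (\<Prod>i<n. exp (s * (c (vs ! i) - a)))"
        by (simp add: exp_sum sum_distrib_left)
      finally show "(\<Prod>i<n. PUV (us ! i) (vs ! i)) * \<nu> vs
          \<le> (\<Prod>i<n. PUV (us ! i) (vs ! i) * exp (s * (c (vs ! i) - a)))"
        unfolding prod.distrib using P0 words_nth[OF us] words_nth[OF vs]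
        by (intro mult_left_mono prod_nonneg) auto
    qed
    also have "\<dots> = \<rho> ^ n" unfolding \<rho>_def by (rule sum_words_power2)
    finally show ?thesis .
  qed
  \<comment> \<open>The tolerable violation probability is the slack divided by the worst cost;
    adding 1 covers \<open>\<kappa> = 0\<close>.\<close>
  moreover have "\<kappa> * (\<eta> / (\<kappa> + 1)) \<le> \<eta>" "0 < \<eta> / (\<kappa> + 1)" using \<kappa> \<eta> by (auto simp: field_simps)
  ultimately show thesis
    using \<kappa>(1) \<rho> by (intro that[of "\<eta> / (\<kappa> + 1)" \<kappa> \<eta> \<rho> \<nu>]) (auto simp: \<nu>_def)
qed

text \<open>A random codeword of mean cost exactly \<open>b\<close> need not become unlikely to
  exceed \<open>b\<close>. The alternative in the cost hypothesis excludes this, by a strict margin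
  or by affordable letters throughout.\<close>

lemma achievable_below_gain:
  fixes W :: "'x::finite \<Rightarrow> ('y::finite \<times> 'z::finite) pmf" and K :: "'v \<Rightarrow> 'x \<Rightarrow> real"
  assumes fin: "finite U" "finite V"
    and P0: "\<And>u v. u \<in> U \<Longrightarrow> v \<in> V \<Longrightarrow> 0 \<le> PUV u v" and P1: "(\<Sum>u\<in>U. \<Sum>v\<in>V. PUV u v) = 1"
    and K0: "\<And>v x. v \<in> V \<Longrightarrow> 0 \<le> K v x" and K1: "\<And>v. v \<in> V \<Longrightarrow> (\<Sum>x\<in>UNIV. K v x) = 1"
    and C0: "\<And>x. 0 \<le> C x"
    and cost: "(\<Sum>u\<in>U. \<Sum>v\<in>V. \<Sum>x\<in>UNIV. PUV u v * K v x * C x) < b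
      \<or> (\<forall>v\<in>V. (\<Sum>x\<in>UNIV. K v x * C x) \<le> b)"
    and R: "0 \<le> R" "R < secrecy_gain W U V PUV K"
  shows "achievable leak_sem W C b R"
  unfolding achievable_def
proof (intro allI impI)
  fix \<epsilon> :: real assume \<epsilon>: "0 < \<epsilon>"
  define A where "A v y = (\<Sum>x\<in>UNIV. K v x * chY W x y)" for v y
  define B where "B v z = (\<Sum>x\<in>UNIV. K v x * chZ W x z)" for v z
  define c where "c v = (\<Sum>x\<in>UNIV. K v x * C x)" for v
  have A0: "0 \<le> A v y" if "v \<in> V" for v y unfolding A_def using K0[OF that] by (intro sum_nonneg) auto
  have B0: "0 \<le> B v z" if "v \<in> V" for v z unfolding B_def using K0[OF that] by (intro sum_nonneg) auto
  have c0: "0 \<le> c v" if "v \<in> V" for v unfolding c_def using K0[OF that] C0 by (intro sum_nonneg) auto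
  have A1: "(\<Sum>y\<in>UNIV. A v y) = 1" if "v \<in> V" for v
    unfolding A_def using K1[OF that] by (subst sum_stochastic_mult) auto
  have B1: "(\<Sum>z\<in>UNIV. B v z) = 1" if "v \<in> V" for v
    unfolding B_def using K1[OF that] by (subst sum_stochastic_mult) auto
  define IY where "IY = cond_mutual_info U V UNIV (\<lambda>u v y. PUV u v * A v y)"
  define IZ where "IZ = cond_mutual_info U V UNIV (\<lambda>u v z. PUV u v * B v z)"
  have gain: "secrecy_gain W U V PUV K = IY - IZ"
    by (simp add: secrecy_gain_def IY_def IZ_def A_def B_def sum_distrib_left mult.assoc)
  have IZ0: "0 \<le> IZ" unfolding IZ_def using fin P0 B0 by (intro cond_mutual_info_nonneg) auto
  \<comment> \<open>A third of the rate gap: one share for the threshold, one for the number of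
    codewords per message, and one that remains as exponent, since
    \<open>R + (IZ + \<delta>) - (IY - \<delta>) = - \<delta>\<close>.\<close>
  define \<delta> where "\<delta> = (IY - IZ - R) / 3"
  have \<delta>: "0 < \<delta>" using R by (simp add: \<delta>_def gain)
  define \<tau> where "\<tau> = 2 powr (IY - \<delta>)"
  define \<sigma> where "\<sigma> = 2 powr (IZ + \<delta>)"
  have \<tau>: "0 < \<tau>" and \<sigma>: "1 \<le> \<sigma>" using IZ0 \<delta> by (auto simp: \<tau>_def \<sigma>_def ge_one_powr_ge_zero)
  obtain r where r: "0 < r" "(\<Sum>u\<in>U. \<Sum>v\<in>V. \<Sum>y\<in>UNIV. PUV u v * A v y *
      (\<tau> * out_dist V PUV A u y / A v y) powr r) < 1"
    using info_chernoff(1)[OF fin finite P0 A0 A1 P1 IY_def \<delta>] unfolding \<tau>_def by blast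
  obtain s where s: "0 < s" "s \<le> 1" "(\<Sum>u\<in>U. \<Sum>v\<in>V. \<Sum>z\<in>UNIV. PUV u v * B v z *
      (B v z / (\<sigma> * out_dist V PUV B u z)) powr s) < 1"
    using info_chernoff(2)[OF fin finite P0 B0 B1 P1 IZ_def \<delta>] unfolding \<sigma>_def by blast
  define \<rho>1 where "\<rho>1 = (\<Sum>u\<in>U. \<Sum>v\<in>V. \<Sum>y\<in>UNIV. PUV u v * A v y *
      (\<tau> * out_dist V PUV A u y / A v y) powr r)"
  define \<rho>2 where "\<rho>2 = (\<Sum>u\<in>U. \<Sum>v\<in>V. \<Sum>z\<in>UNIV. PUV u v * B v z *
      (B v z / (\<sigma> * out_dist V PUV B u z)) powr s)"
  have \<rho>12: "0 \<le> \<rho>1" "\<rho>1 < 1" "0 \<le> \<rho>2" "\<rho>2 < 1"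
    using r s P0 A0 B0 by (auto simp: \<rho>1_def \<rho>2_def intro!: sum_nonneg mult_nonneg_nonneg)
  have c_eq: "(\<Sum>x\<in>UNIV. PUV u v * K v x * C x) = PUV u v * c v" for u v
    by (simp add: c_def sum_distrib_left mult.assoc)
  have "(\<Sum>u\<in>U. \<Sum>v\<in>V. PUV u v * c v) < b \<or> (\<forall>v\<in>V. c v \<le> b)"
    using cost by (simp only: c_eq c_def[symmetric])
  from cost_control[OF fin P0 P1 c0 this]
  obtain \<epsilon>\<^sub>0 \<kappa> \<eta> \<rho>3 and \<nu> :: "'v list \<Rightarrow> real" where \<epsilon>0: "0 < \<epsilon>\<^sub>0" and \<kappa>: "0 \<le> \<kappa>" "\<kappa> * \<epsilon>\<^sub>0 \<le> \<eta>"
    and \<rho>3: "0 \<le> \<rho>3" "\<rho>3 < 1" and \<nu>0: "\<forall>vs. 0 \<le> \<nu> vs"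
    and \<nu>_cost: "\<forall>n>0. \<forall>vs\<in>words n V. cost_n c vs \<le> b - \<eta> + \<kappa> * \<nu> vs"
    and \<nu>_avg: "\<forall>n>0. (\<Sum>us\<in>words n U. \<Sum>vs\<in>words n V. (\<Prod>i<n. PUV (us ! i) (vs ! i)) * \<nu> vs) \<le> \<rho>3 ^ n"
    .
  \<comment> \<open>The factor 4 combines the doubled message set of the expurgation with the
    rounding up of \<open>\<sigma> ^ n\<close>, which at most doubles it as
    \<open>\<sigma> \<ge> 1\<close>.\<close>
  define \<beta> where "\<beta> n = \<rho>1 ^ n + 4 * (2 powr (- \<delta>)) ^ n + \<rho>2 ^ n / s + \<rho>3 ^ n" for n
  have "\<beta> \<longlonglongrightarrow> 0 + 4 * 0 + 0 / s + 0"
    unfolding \<beta>_def using \<rho>12 \<rho>3 \<delta> s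
    by (intro tendsto_add tendsto_mult tendsto_divide tendsto_const LIMSEQ_power_zero)
      (auto simp: powr_less_one)
  \<comment> \<open>After expurgation each quantity is at most \<open>2 * \<epsilon>'\<close>: this
    must fit the error, the leakage after conversion from nats to bits, and the violation
    \<open>\<epsilon>\<^sub>0\<close> that the cost slack can pay for.\<close>
  moreover define \<epsilon>' where "\<epsilon>' = min (min \<epsilon> (\<epsilon> * ln 2)) \<epsilon>\<^sub>0 / 2"
  have \<epsilon>': "0 < \<epsilon>'" "2 * \<epsilon>' \<le> \<epsilon>" "2 * \<epsilon>' \<le> \<epsilon> * ln 2" "2 * \<epsilon>' \<le> \<epsilon>\<^sub>0"
    using \<epsilon> \<epsilon>0 by (auto simp: \<epsilon>'_def)
  ultimately have "eventually (\<lambda>n. \<beta> n < \<epsilon>') sequentially"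
    by (intro order_tendstoD(2)) auto
  then obtain N where N: "\<And>n. n \<ge> N \<Longrightarrow> \<beta> n < \<epsilon>'"
    unfolding eventually_sequentially by blast
  have "\<exists>f g. is_code C b n R f g \<and> max_err W n R f g \<le> \<epsilon> \<and> leak_sem W n R f \<le> \<epsilon>"
    if n: "n \<ge> max N 1" for n
  proof -
    let ?M = "msgs n R"
    have n0: "0 < n" using n by simp
    define J where "J = nat \<lceil>\<sigma> ^ n\<rceil>"
    have \<sigma>n: "1 \<le> \<sigma> ^ n" using \<sigma> by simp
    have J: "0 < J" "\<sigma> ^ n \<le> J" "J \<le> 2 * \<sigma> ^ n"
      using \<sigma>n unfolding J_def by linarith+
    have M: "?M \<noteq> {}" "card ?M \<le> 2 powr (n * R)" using card_msgs_bounds[OF R(1), of n] by auto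
    have "2 * card ?M * J / \<tau> ^ n \<le> 4 * (2 powr (- \<delta>)) ^ n"
    proof -
      have "real (card ?M) * J \<le> 2 powr (n * R) * (2 * \<sigma> ^ n)"
        using M J by (intro mult_mono) auto
      then have "2 * card ?M * J / \<tau> ^ n \<le> 2 * (2 powr (n * R) * (2 * \<sigma> ^ n)) / \<tau> ^ n"
        using \<tau> by (intro divide_right_mono) (auto simp: mult_ac)
      also have "\<dots> = 4 * (2 powr R * \<sigma> / \<tau>) ^ n"
        by (simp add: power_divide power_mult_distrib powr_power)
      also have "2 powr R * \<sigma> / \<tau> = 2 powr (- \<delta>)"
      proof -
        have "- \<delta> = R + (IZ + \<delta>) - (IY - \<delta>)" by (simp add: \<delta>_def field_simps)
        then show ?thesis
          by (simp only: \<sigma>_def \<tau>_def powr_diff[of 2 "R + (IZ + \<delta>)" "IY - \<delta>"] powr_add[of 2 R "IZ + \<delta>"])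
      qed
      finally show ?thesis .
    qed
    then have bound: "\<rho>1 ^ n + 2 * card ?M * J / \<tau> ^ n + \<rho>2 ^ n / s
       + (\<Sum>us\<in>words n U. \<Sum>vs\<in>words n V. (\<Prod>i<n. PUV (us ! i) (vs ! i)) * \<nu> vs) \<le> \<epsilon>'"
      using N[of n] n \<nu>_avg[rule_format, OF n0] by (simp add: \<beta>_def)
    have "\<exists>c g Q. (\<forall>m\<in>?M. \<forall>j<J. c m j \<in> words n V) \<and> (\<forall>ys. g ys \<in> ?M)
      \<and> (\<forall>zs. 0 \<le> Q zs) \<and> (\<Sum>zs\<in>seqs n. Q zs) = 1
      \<and> (\<forall>m\<in>?M. \<forall>j<J. \<forall>zs. prodch B (c m j) zs \<noteq> 0 \<longrightarrow> Q zs \<noteq> 0)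
      \<and> (\<forall>m\<in>?M. (\<Sum>j<J. \<Sum>ys\<in>seqs n. prodch A (c m j) ys * of_bool (g ys \<noteq> m)) / J \<le> 2 * \<epsilon>'
      \<and> (\<Sum>zs\<in>seqs n. (\<Sum>j<J. prodch B (c m j) zs) / J * ln ((\<Sum>j<J. prodch B (c m j) zs) / J / Q zs)) \<le> 2 * \<epsilon>'
      \<and> (\<Sum>j<J. \<nu> (c m j)) / J \<le> 2 * \<epsilon>')"
    proof (rule block_code_exists[where U = U and PUV = PUV and \<tau> = \<tau> and \<sigma> = \<sigma> and r = r and s = s])
      show "(\<Sum>u\<in>U. \<Sum>v\<in>V. \<Sum>y\<in>UNIV. PUV u v * A v y * (\<tau> * out_dist V PUV A u y / A v y) powr r) ^ n
        + 2 * card ?M * J / \<tau> ^ n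
        + (\<Sum>u\<in>U. \<Sum>v\<in>V. \<Sum>z\<in>UNIV. PUV u v * B v z * (B v z / (\<sigma> * out_dist V PUV B u z)) powr s) ^ n / s
        + (\<Sum>us\<in>words n U. \<Sum>vs\<in>words n V. (\<Prod>i<n. PUV (us ! i) (vs ! i)) * \<nu> vs) \<le> \<epsilon>'"
        using bound unfolding \<rho>1_def \<rho>2_def .
    qed (use fin M P0 P1 A0 A1 B0 B1 \<nu>0 \<tau> \<sigma> r s J in auto)
    then obtain cw g Q where cw: "\<And>m j. m \<in> ?M \<Longrightarrow> j < J \<Longrightarrow> cw m j \<in> words n V"
      and g: "\<And>ys. g ys \<in> ?M" and Q: "\<And>zs. 0 \<le> Q zs" "(\<Sum>zs\<in>seqs n. Q zs) = 1"
      and ac: "\<And>m j zs. m \<in> ?M \<Longrightarrow> j < J \<Longrightarrow> prodch B (cw m j) zs \<noteq> 0 \<Longrightarrow> Q zs \<noteq> 0"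
      and err: "\<And>m. m \<in> ?M \<Longrightarrow> (\<Sum>j<J. \<Sum>ys\<in>seqs n. prodch A (cw m j) ys * of_bool (g ys \<noteq> m)) / J \<le> 2 * \<epsilon>'"
      and div: "\<And>m. m \<in> ?M \<Longrightarrow> (\<Sum>zs\<in>seqs n. (\<Sum>j<J. prodch B (cw m j) zs) / J *
          ln ((\<Sum>j<J. prodch B (cw m j) zs) / J / Q zs)) \<le> 2 * \<epsilon>'"
      and viol: "\<And>m. m \<in> ?M \<Longrightarrow> (\<Sum>j<J. \<nu> (cw m j)) / J \<le> 2 * \<epsilon>'"
      by blast
    \<comment> \<open>The encoder draws one of the \<open>J\<close> codewords of the message
      uniformly, as local randomness, and sends it through the prefix channel
      \<open>K\<close>.\<close>
    define f where "f m xs = (\<Sum>j<J. prodch K (cw m j) xs) / J" for m xs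
    have f_avg: "(\<Sum>xs\<in>seqs n. f m xs * k xs) = (\<Sum>j<J. \<Sum>xs\<in>seqs n. prodch K (cw m j) xs * k xs) / J" for m k
      unfolding f_def
      by (subst sum.swap) (simp add: sum_distrib_right sum_divide_distrib)
    have len: "length (cw m j) = n" "set (cw m j) \<subseteq> V" if "m \<in> ?M" "j < J" for m j
      using cw[OF that] by (auto simp: words_def)
    have code: "is_code C b n R f g"
      unfolding is_code_def
    proof (intro conjI ballI)
      fix m assume m: "m \<in> ?M"
      show "0 \<le> f m xs" for xs
        unfolding f_def prodch_def using len[OF m] K0
        by (intro divide_nonneg_nonneg sum_nonneg prod_nonneg) (auto simp: subset_iff)
      have "(\<Sum>xs\<in>seqs n. prodch K (cw m j) xs) = 1" if "j < J" for j
        unfolding seqs_eq_words using len[OF m that] K1 by (intro sum_prodch) auto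
      then show "(\<Sum>xs\<in>seqs n. f m xs) = 1"
        using f_avg[of m "\<lambda>_. 1"] J by simp
      have "(\<Sum>xs\<in>seqs n. f m xs * cost_n C xs) = (\<Sum>j<J. cost_n c (cw m j)) / J"
        unfolding f_avg c_def using len[OF m] K1
        by (intro arg_cong2[where f = "(/)"] sum.cong prodch_cost) auto
      also have "\<dots> \<le> (\<Sum>j<J. b - \<eta> + \<kappa> * \<nu> (cw m j)) / J"
        using \<nu>_cost n0 cw[OF m] by (intro divide_right_mono sum_mono) auto
      also have "\<dots> = b - \<eta> + \<kappa> * ((\<Sum>j<J. \<nu> (cw m j)) / J)"
        using J by (simp add: sum.distrib sum_distrib_left[symmetric] add_divide_distrib)
      also have "\<dots> \<le> b - \<eta> + \<kappa> * \<epsilon>\<^sub>0"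
        using viol[OF m] \<epsilon>' \<kappa> by (intro add_left_mono mult_left_mono) auto
      also have "\<dots> \<le> b" using \<kappa> by simp
      finally show "(\<Sum>xs\<in>seqs n. f m xs * cost_n C xs) \<le> b" .
    qed (use g in auto)
    have "max_err W n R f g \<le> \<epsilon>"
    proof (rule max_err_le[OF R(1)])
      fix m assume m: "m \<in> ?M"
      have "(\<Sum>xs\<in>seqs n. f m xs * (\<Sum>ys\<in>{ys\<in>seqs n. g ys \<noteq> m}. prodch (chY W) xs ys))
        = (\<Sum>j<J. \<Sum>ys\<in>seqs n. prodch A (cw m j) ys * of_bool (g ys \<noteq> m)) / J"
        unfolding f_avg
      proof (intro arg_cong2[where f = "(/)"] sum.cong refl)
        fix j assume "j \<in> {..<J}"
        then have j: "j < J" by simp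
        have "(\<Sum>xs\<in>seqs n. prodch K (cw m j) xs * (\<Sum>ys\<in>{ys\<in>seqs n. g ys \<noteq> m}. prodch (chY W) xs ys))
          = (\<Sum>ys\<in>{ys\<in>seqs n. g ys \<noteq> m}. \<Sum>xs\<in>seqs n. prodch K (cw m j) xs * prodch (chY W) xs ys)"
          unfolding sum_distrib_left by (rule sum.swap)
        also have "\<dots> = (\<Sum>ys\<in>{ys\<in>seqs n. g ys \<noteq> m}. prodch A (cw m j) ys)"
          unfolding A_def using len[OF m j] by (simp add: prodch_compose)
        also have "\<dots> = (\<Sum>ys\<in>seqs n. prodch A (cw m j) ys * of_bool (g ys \<noteq> m))"
          by (intro sum.mono_neutral_cong_left) auto
        finally show "(\<Sum>xs\<in>seqs n. prodch K (cw m j) xs * (\<Sum>ys\<in>{ys\<in>seqs n. g ys \<noteq> m}. prodch (chY W) xs ys))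
          = (\<Sum>ys\<in>seqs n. prodch A (cw m j) ys * of_bool (g ys \<noteq> m))" .
      qed
      then show "(\<Sum>xs\<in>seqs n. f m xs * (\<Sum>ys\<in>{ys\<in>seqs n. g ys \<noteq> m}. prodch (chY W) xs ys)) \<le> \<epsilon>"
        using err[OF m] \<epsilon>' by linarith
    qed
    moreover have "leak_sem W n R f \<le> \<epsilon>"
    proof (rule leak_sem_le[OF R(1)])
      fix PM :: "nat \<Rightarrow> real" assume PM: "\<forall>m\<in>?M. 0 \<le> PM m" "(\<Sum>m\<in>?M. PM m) = 1"
      have P: "(\<Sum>xs\<in>seqs n. f m xs * prodch (chZ W) xs zs) = (\<Sum>j<J. prodch B (cw m j) zs) / J"
        if "m \<in> ?M" for m zs
        unfolding f_avg B_def using len[OF that]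
        by (intro arg_cong2[where f = "(/)"] sum.cong prodch_compose) auto
      have "leak W n R f PM \<le> (\<epsilon> * ln 2) / ln 2"
      proof (rule leak_le_divergence[OF code _ PM(2) Q])
        show "Q zs \<noteq> 0" if "m \<in> ?M" "(\<Sum>xs\<in>seqs n. f m xs * prodch (chZ W) xs zs) \<noteq> 0" for m zs
        proof -
          have "(\<Sum>j<J. prodch B (cw m j) zs) \<noteq> 0" using that(2) P[OF that(1)] by auto
          then obtain j where "j < J" "prodch B (cw m j) zs \<noteq> 0"
            by (meson lessThan_iff sum.neutral)
          then show ?thesis using ac[OF that(1)] by blast
        qed
        show "(\<Sum>zs\<in>seqs n. (\<Sum>xs\<in>seqs n. f m xs * prodch (chZ W) xs zs)
            * ln ((\<Sum>xs\<in>seqs n. f m xs * prodch (chZ W) xs zs) / Q zs)) \<le> \<epsilon> * ln 2" if "m \<in> ?M" for m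
          using div[OF that] \<epsilon>' unfolding P[OF that] by linarith
      qed (use PM in auto)
      then show "leak W n R f PM \<le> \<epsilon>" by simp
    qed
    ultimately show ?thesis using code by blast
  qed
  then show "\<exists>N. \<forall>n\<ge>N. \<exists>f g. is_code C b n R f g \<and> max_err W n R f g \<le> \<epsilon> \<and> leak_sem W n R f \<le> \<epsilon>"
    by (intro exI[of _ "max N 1"]) simp
qed

section \<open>Coincidence of the capacities\<close>

text \<open>The value \<open>None\<close> of the conditioning variable forces the value
  \<open>None\<close> of the second one, so this slice carries no information; the other slices are
  merely scaled.\<close>

lemma cond_mutual_info_mix:
  fixes p' :: "'u option \<Rightarrow> 'v option \<Rightarrow> 'b \<Rightarrow> real"
  assumes fin: "finite U" "finite V" and t: "(\<Sum>b\<in>B. t b) = 1" and l: "l \<noteq> 0" "l \<noteq> 1"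
    and p': "\<And>u v b. p' (Some u) (Some v) b = (1 - l) * p u v b" "\<And>b. p' None None b = l * t b"
      "\<And>u b. p' (Some u) None b = 0" "\<And>v b. p' None (Some v) b = 0"
  shows "cond_mutual_info (insert None (Some ` U)) (insert None (Some ` V)) B p'
       = (1 - l) * cond_mutual_info U V B p"
proof -
  have sum_opt: "(\<Sum>v\<in>insert None (Some ` V). F v) = F None + (\<Sum>v\<in>V. F (Some v))"
    for F :: "'v option \<Rightarrow> real"
    using fin by (simp add: sum.reindex)
  have sum_opt': "(\<Sum>u\<in>insert None (Some ` U). F u) = F None + (\<Sum>u\<in>U. F (Some u))"
    for F :: "'u option \<Rightarrow> real"
    using fin by (simp add: sum.reindex)
  have "cond_mutual_info (insert None (Some ` U)) (insert None (Some ` V)) B p'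
      = (\<Sum>b\<in>B. if l * t b = 0 then 0 else l * t b * log 2 (l * t b * (\<Sum>b\<in>B. l * t b)
            / ((\<Sum>b\<in>B. l * t b) * (l * t b))))
      + cond_mutual_info U V B (\<lambda>u v b. (1 - l) * p u v b)"
    unfolding cond_mutual_info_def sum_opt sum_opt' p' by (simp cong: if_cong)
  also have "(\<Sum>b\<in>B. if l * t b = 0 then 0 else l * t b * log 2 (l * t b * (\<Sum>b\<in>B. l * t b)
            / ((\<Sum>b\<in>B. l * t b) * (l * t b)))) = 0"
    using t l by (intro sum.neutral) (auto simp: sum_distrib_left[symmetric])
  finally show ?thesis using l by (simp add: cond_mutual_info_scale)
qed

text \<open>Keeps the set of achievable rates nonempty even when \<open>Cbar\<close> is 0. At rate 0
  there is one message, and a constant cheap word causes neither error nor leakage.\<close>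

lemma achievable_zero:
  fixes W :: "'x::finite \<Rightarrow> ('y::finite \<times> 'z::finite) pmf"
  assumes x0: "C x0 \<le> b"
  shows "achievable leak_sem W C b 0"
  unfolding achievable_def
proof (intro allI impI exI[of _ 1])
  fix \<epsilon> :: real and n :: nat assume \<epsilon>: "0 < \<epsilon>" and n: "1 \<le> n"
  define w where "w = replicate n x0"
  have w: "w \<in> seqs n" by (simp add: w_def seqs_def)
  define f where "f m xs = (of_bool (xs = w) :: real)" for m :: nat and xs
  have f_sum: "(\<Sum>xs\<in>seqs n. f m xs * k xs) = k w" for m k
    using w by (simp add: f_def of_bool_def if_distrib[of "\<lambda>x. x * _"] cong: if_cong)
  have M: "msgs n 0 = {1}" by (auto simp: msgs_def)
  have "cost_n C w = C x0" using n by (simp add: cost_n_def w_def sum_list_replicate)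
  then have code: "is_code C b n 0 f (\<lambda>_ :: 'y list. 1)"
    unfolding is_code_def f_sum using f_sum[of _ "\<lambda>_. 1"] x0 by (auto simp: M f_def)
  have "max_err W n 0 f (\<lambda>_. 1) \<le> \<epsilon>"
    using \<epsilon> by (intro max_err_le) (auto simp: M f_sum)
  moreover have "leak_sem W n 0 f \<le> \<epsilon>"
  proof (rule leak_sem_le)
    fix PM :: "nat \<Rightarrow> real" assume PM: "\<forall>m\<in>msgs n 0. 0 \<le> PM m" "(\<Sum>m\<in>msgs n 0. PM m) = 1"
    have "(\<Sum>zs\<in>seqs n. prodch (chZ W) w zs) = 1"
      using w unfolding seqs_eq_words by (intro sum_prodch) (auto simp: words_def)
    then have "leak W n 0 f PM \<le> 0 / ln 2"
      using PM by (intro leak_le_divergence[OF code, where Q = "prodch (chZ W) w"])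
        (auto simp: f_sum prodch_nonneg intro!: sum_nonpos)
    then show "leak W n 0 f PM \<le> \<epsilon>" using \<epsilon> by simp
  qed simp
  ultimately show "\<exists>f g. is_code C b n 0 f g \<and> max_err W n 0 f g \<le> \<epsilon> \<and> leak_sem W n 0 f \<le> \<epsilon>"
    using code by blast
qed

text \<open>A near-optimal competitor may use the whole budget \<open>b\<close>, so it is first
  altered to meet the stricter cost alternative of the coding lemma, at a loss of gain smaller than
  the distance to \<open>R\<close>.\<close>

lemma achievable_below_Cbar:
  fixes W :: "'x::finite \<Rightarrow> ('y::finite \<times> 'z::finite) pmf"
  assumes C0: "\<And>x. 0 \<le> C x" and x0: "C x0 \<le> b" "\<And>x. C x0 \<le> C x"
    and R: "0 \<le> R" "R < Cbar W C b"
  shows "achievable leak_sem W C b R"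
proof -
  define K0 where "K0 x = (of_bool (x = x0) :: real)" for x
  have K0_sum: "(\<Sum>x\<in>UNIV. K0 x * k x) = k x0" for k
    by (simp add: K0_def of_bool_def if_distrib[of "\<lambda>x. x * _"] cong: if_cong)
  have K0_1: "(\<Sum>x\<in>UNIV. K0 x) = 1" using K0_sum[of "\<lambda>_. 1"] by simp
  have "Cbar_witness C b {0::nat} {0::nat} (\<lambda>_ _. 1) (\<lambda>_. K0)"
    using x0 by (simp add: Cbar_witness_def K0_sum K0_1) (simp add: K0_def)
  then have "{secrecy_gain W U V PUV K | (U :: nat set) (V :: nat set) PUV K. Cbar_witness C b U V PUV K} \<noteq> {}"
    by blast
  from less_cSupD[OF this R(2)[unfolded Cbar_eq]]
  obtain U V :: "nat set" and PUV K where wit: "Cbar_witness C b U V PUV K"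
    and gain: "R < secrecy_gain W U V PUV K"
    by blast
  have fin: "finite U" "finite V" and P0: "\<And>u v. u \<in> U \<Longrightarrow> v \<in> V \<Longrightarrow> 0 \<le> PUV u v"
    and P1: "(\<Sum>u\<in>U. \<Sum>v\<in>V. PUV u v) = 1"
    and K: "\<And>v x. v \<in> V \<Longrightarrow> 0 \<le> K v x" "\<And>v. v \<in> V \<Longrightarrow> (\<Sum>x\<in>UNIV. K v x) = 1"
    and cost: "(\<Sum>u\<in>U. \<Sum>v\<in>V. \<Sum>x\<in>UNIV. PUV u v * K v x * C x) \<le> b"
    using wit by (auto simp: Cbar_witness_def)
  show ?thesis
  proof (cases "C x0 < b")
    case True
    let ?g = "secrecy_gain W U V PUV K"
    \<comment> \<open>With this weight \<open>(1 - l) * ?g\<close> is the midpoint of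
      \<open>R\<close> and \<open>?g\<close>.\<close>
    define l where "l = (?g - R) / (2 * ?g)"
    have g: "0 < ?g" using gain R by linarith
    have l: "0 < l" "l < 1" using g gain R by (auto simp: l_def field_simps)
    have lg: "R < (1 - l) * ?g" using g gain by (simp add: l_def field_simps)
    define PUV' where "PUV' u v = (case (u, v) of (Some u, Some v) \<Rightarrow> (1 - l) * PUV u v
        | (None, None) \<Rightarrow> l | _ \<Rightarrow> 0)" for u v
    define K' where "K' v = (case v of None \<Rightarrow> K0 | Some v \<Rightarrow> K v)" for v
    let ?U = "insert None (Some ` U)" and ?V = "insert None (Some ` V)"
    have mix: "cond_mutual_info ?U ?V UNIV (\<lambda>u v y. \<Sum>x\<in>UNIV. PUV' u v * K' v x * T x y)
       = (1 - l) * cond_mutual_info U V UNIV (\<lambda>u v y. \<Sum>x\<in>UNIV. PUV u v * K v x * T x y)"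
      if "\<And>x. (\<Sum>y\<in>UNIV. T x y) = 1" for T :: "'x \<Rightarrow> 'c::finite \<Rightarrow> real"
      using fin l that
      by (intro cond_mutual_info_mix[where t = "T x0"])
        (auto simp: PUV'_def K'_def mult.assoc sum_distrib_left[symmetric] K0_sum)
    have sums: "(\<Sum>u\<in>?U. \<Sum>v\<in>?V. F u v) = F None None + (\<Sum>v\<in>V. F None (Some v))
        + (\<Sum>u\<in>U. F (Some u) None + (\<Sum>v\<in>V. F (Some u) (Some v)))" for F :: "nat option \<Rightarrow> nat option \<Rightarrow> real"
      using fin by (simp add: sum.reindex)
    show ?thesis
    proof (rule achievable_below_gain[where U = ?U and V = ?V and PUV = PUV' and K = K'])
      show "(\<Sum>u\<in>?U. \<Sum>v\<in>?V. PUV' u v) = 1"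
        unfolding sums using P1 by (simp add: PUV'_def sum_distrib_left[symmetric])
      show "0 \<le> PUV' u v" if "u \<in> ?U" "v \<in> ?V" for u v
        using that P0 l by (auto simp: PUV'_def)
      show "0 \<le> K' v x" if "v \<in> ?V" for v x
        using that K by (auto simp: K'_def K0_def)
      show "(\<Sum>x\<in>UNIV. K' v x) = 1" if "v \<in> ?V" for v
        using that K K0_1 by (auto simp: K'_def)
      have "(\<Sum>u\<in>?U. \<Sum>v\<in>?V. \<Sum>x\<in>UNIV. PUV' u v * K' v x * C x)
        = l * C x0 + (1 - l) * (\<Sum>u\<in>U. \<Sum>v\<in>V. \<Sum>x\<in>UNIV. PUV u v * K v x * C x)"
        unfolding sums by (simp add: PUV'_def K'_def mult.assoc sum_distrib_left[symmetric] K0_sum)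
      also have "\<dots> < l * b + (1 - l) * b"
        using True cost l by (intro add_less_le_mono mult_strict_left_mono mult_left_mono) auto
      also have "\<dots> = b" by (simp add: algebra_simps)
      finally show "(\<Sum>u\<in>?U. \<Sum>v\<in>?V. \<Sum>x\<in>UNIV. PUV' u v * K' v x * C x) < b
          \<or> (\<forall>v\<in>?V. (\<Sum>x\<in>UNIV. K' v x * C x) \<le> b)" ..
      show "R < secrecy_gain W ?U ?V PUV' K'"
        using lg unfolding secrecy_gain_def by (simp add: mix right_diff_distrib)
    qed (use fin C0 R in auto)
  next
    case False
    then have b: "C x0 = b" using x0 by simp
    define c where "c v = (\<Sum>x\<in>UNIV. K v x * C x)" for v
    \<comment> \<open>Since no letter costs less than \<open>b\<close>, a letter \<open>v\<close>
      costs more than \<open>b\<close> only where \<open>PUV u v\<close> vanishes for all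
      \<open>u\<close>. Its kernel may be replaced by the cheapest input: all letters become
      affordable and the joint law is unchanged.\<close>
    define K' where "K' v = (if c v \<le> b then K v else K0)" for v
    have cb: "b \<le> c v" if "v \<in> V" for v
    proof -
      have "b = (\<Sum>x\<in>UNIV. K v x * b)" using K(2)[OF that] by (simp add: sum_distrib_right[symmetric])
      also have "\<dots> \<le> c v" unfolding c_def using K(1)[OF that] x0(2) b by (intro sum_mono mult_left_mono) auto
      finally show ?thesis .
    qed
    have "(\<Sum>u\<in>U. \<Sum>v\<in>V. PUV u v * (c v - b)) \<le> 0"
    proof -
      have "(\<Sum>u\<in>U. \<Sum>v\<in>V. PUV u v * c v) \<le> b"
        using cost by (simp add: c_def mult.assoc sum_distrib_left)
      moreover have "(\<Sum>u\<in>U. \<Sum>v\<in>V. PUV u v * b) = b" using P1 by (simp add: sum_distrib_right[symmetric])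
      ultimately show ?thesis by (simp add: right_diff_distrib sum_subtractf)
    qed
    moreover have nn: "0 \<le> PUV u v * (c v - b)" if "u \<in> U" "v \<in> V" for u v
      using P0[OF that] cb[OF that(2)] by simp
    ultimately have "(\<Sum>u\<in>U. \<Sum>v\<in>V. PUV u v * (c v - b)) = 0"
      by (intro antisym sum_nonneg) auto
    then have rows: "\<forall>u\<in>U. (\<Sum>v\<in>V. PUV u v * (c v - b)) = 0"
      using fin nn by (subst (asm) sum_nonneg_eq_0_iff) (auto intro: sum_nonneg)
    have zero: "PUV u v * (c v - b) = 0" if "u \<in> U" "v \<in> V" for u v
      using rows[rule_format, OF that(1)] nn[OF that(1)] that(2) fin
      by (subst (asm) sum_nonneg_eq_0_iff) auto
    have same: "PUV u v * K' v x = PUV u v * K v x" if "u \<in> U" "v \<in> V" for u v x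
      using zero[OF that] by (auto simp: K'_def)
    show ?thesis
    proof (rule achievable_below_gain[where U = U and V = V and PUV = PUV and K = K'])
      have "(\<Sum>x\<in>UNIV. K' v x * C x) \<le> b" for v
        using b by (auto simp: K'_def K0_sum c_def)
      then show "(\<Sum>u\<in>U. \<Sum>v\<in>V. \<Sum>x\<in>UNIV. PUV u v * K' v x * C x) < b
          \<or> (\<forall>v\<in>V. (\<Sum>x\<in>UNIV. K' v x * C x) \<le> b)" by blast
      have "cond_mutual_info U V UNIV (\<lambda>u v y. \<Sum>x\<in>UNIV. PUV u v * K' v x * T x y)
         = cond_mutual_info U V UNIV (\<lambda>u v y. \<Sum>x\<in>UNIV. PUV u v * K v x * T x y)"
        for T :: "'x \<Rightarrow> 'c \<Rightarrow> real"
        by (intro cond_mutual_info_cong) (simp add: same)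
      note this [simp]
      show "R < secrecy_gain W U V PUV K'"
        using gain by (simp add: secrecy_gain_def)
    qed (use fin P0 P1 K K0_1 C0 R in \<open>auto simp: K'_def K0_def\<close>)
  qed
qed

theorem theorem1:
  fixes W :: "'x::finite \<Rightarrow> ('y::finite \<times> 'z::finite) pmf"
    and C :: "'x \<Rightarrow> real" and b :: real
  assumes "\<forall>x. 0 \<le> C x"
    and "Min (range C) \<le> b"
  shows "capacity leak_sem W C b = Cbar W C b
       \<and> capacity leak_str W C b = Cbar W C b
       \<and> capacity leak_weak W C b = Cbar W C b"
proof -
  have "Min (range C) \<in> range C" by (intro Min_in) auto
  then obtain x0 where "Min (range C) = C x0" by blast
  moreover have "Min (range C) \<le> C x" for x by (intro Min_le) auto
  ultimately have x0: "C x0 \<le> b" "\<And>x. C x0 \<le> C x" using assms(2) by auto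
  have Sup_eq: "Sup {R. 0 \<le> R \<and> P R} = Cbar W C b"
    if zero: "P 0" and below: "\<And>R. 0 \<le> R \<Longrightarrow> R < Cbar W C b \<Longrightarrow> P R"
      and upper: "\<And>R. 0 \<le> R \<Longrightarrow> P R \<Longrightarrow> R \<le> Cbar W C b" for P :: "real \<Rightarrow> bool"
  proof (rule cSup_eq_non_empty)
    show "{R. 0 \<le> R \<and> P R} \<noteq> {}" using zero by blast
    show "R \<le> Cbar W C b" if "R \<in> {R. 0 \<le> R \<and> P R}" for R using that upper by blast
    show "Cbar W C b \<le> y" if y: "\<And>R. R \<in> {R. 0 \<le> R \<and> P R} \<Longrightarrow> R \<le> y" for y
    \<comment> \<open>Only nonnegative rates belong to the set; a negative \<open>R\<close> lies
      below every upper bound because rate 0 is achievable.\<close>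
    proof (rule dense_le)
      fix R assume R: "R < Cbar W C b"
      show "R \<le> y"
      proof (cases "0 \<le> R")
        case True
        then show ?thesis using y below R by blast
      next
        case False
        have "0 \<le> y" using y zero by blast
        then show ?thesis using False by linarith
      qed
    qed
  qed
  have sem0: "achievable leak_sem W C b 0" using x0(1) by (rule achievable_zero)
  have sem: "achievable leak_sem W C b R" if "0 \<le> R" "R < Cbar W C b" for R
    using assms(1) x0 that by (intro achievable_below_Cbar) auto
  have str: "achievable leak_str W C b R" if "0 \<le> R" "achievable leak_sem W C b R" for R
    using that by (intro achievable_sem_imp_str)
  have weak: "achievable leak_weak W C b R" if "achievable leak_str W C b R" for R
    using that by (rule achievable_str_imp_weak)
  have upper: "R \<le> Cbar W C b" if "0 \<le> R" "achievable leak_weak W C b R" for R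
    using that by (rule achievable_weak_le_Cbar)
  show ?thesis
    unfolding capacity_def
    using sem0 sem str weak upper by (intro conjI Sup_eq) blast+
qed

end
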